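(* Let $f=h+g:\mathbb{R}^n\to\mathbb{R}$ with $h,g$ convex and continuously differentiable, where $f$ is $L_f$-smooth and $\mu$-strongly convex ($\mu\ge 0$), $h$ is $L_h$-smooth with an oracle $O_h$ that in one call produces $\nabla h(\cdot)$, $g$ is $L_g$-smooth with a basic oracle $O_g$ that in $\kappa_g$ calls produces $\nabla g(\cdot)$, and let $\mathcal{M}_{inn}$ be a method satisfying the inner-method assumption stated in the context (with parameter $\tau_g$). Assume $L_g\ge L_h$. Let $x^*$ be a minimizer of $f$, let $R\ge\|x^0-x^*\|_2$ for the starting point $x^0$, and let $\varepsilon>0$, $\delta\in(0,1)$, $L\in(0,L_h]$. Then: (a) If $\mu=0$, the algorithm SAE (with parameter $L$) outputs a point $\hat x$ such that $f(\hat x)-f(x^* )\le\varepsilon$ with probability at least $1-\delta$ in $$O\left(\sqrt{\tfrac{LR^2}{\varepsilon}}\cdot\left(1+\tfrac{L_h}{L}\right)\right)$$ calls to the oracle $O_h$ for $h$ and $$O\left(\sqrt{\tfrac{LR^2}{\varepsilon}}\cdot\left(\kappa_g+\tfrac{L_h}{L}\cdot\left(\tfrac{\tau_g}{\sqrt{L+L_h}}\ln\tfrac{R}{\delta\sqrt{\varepsilon}}\right)\right)\right)$$ calls to the basic oracle $O_g$ for $g$. (b) If $\mu>0$, the algorithm R-SAE (with parameter $L$, starting point $\eta_0=x^0$) outputs a point $\hat x$ such that $f(\hat x)-f(x^* )\le\varepsilon$ with probability at least $1-\delta$ in $$O\left(\sqrt{\tfrac{L}{\mu}}\ln\left(\tfrac{\mu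 R^2}{\varepsilon}\right)\cdot\left(1+\tfrac{L_h}{L}\right)\right)$$ calls to the oracle $O_h$ for $h$ and $$O\left(\sqrt{\tfrac{L}{\mu}}\ln\left(\tfrac{\mu R^2}{\varepsilon}\right)\cdot\left(\kappa_g+\tfrac{L_h}{L}\cdot\tfrac{\tau_g}{\sqrt{L+L_h}}\ln\tfrac{1}{\delta}\right)\right)$$ calls to the basic oracle $O_g$ for $g$.
   Context: A function is $\ell$-smooth if its gradient is $\ell$-Lipschitz with respect to the Euclidean norm $\|\cdot\|_2$; strong convexity is with respect to $\|\cdot\|_2$ ($0$-strongly convex means convex). $O(\cdot)$ is used in the non-asymptotic sense and hides only numerical constant factors; the dependence on $L,L_h,\mu,\tau_g,\kappa_g,R,\varepsilon,\delta$ is as displayed. **Inner-method assumption.** For $\beta\in\mathbb{R}^n$ and $\alpha>0$ let $\varphi(v)=\langle\beta,v\rangle+\frac{\alpha}{2}\|v\|_2^2+g(v)$ with minimizer $v^*$. $\mathcal{M}_{inn}(\varphi(\cdot),v^0,N)$ denotes the (possibly random) output of a (possibly randomized) method started at $v^0$ and using $N$ calls to $O_g$; $\mathbb{E}$ is the expectation with respect to all the randomness of the method. There exist a parameter $\tau_g>\sqrt{\alpha}$ that depends on $g$ and $\mathcal{M}_{inn}$ but is independent of $\alpha$, a constant $C>0$ and a numerical constant $C_0>0$ such that for any accuracy $\tilde\varepsilon>0$ the method $\mathcal{M}_{inn}(\varphi(\cdot),v^0,N(\tilde\varepsilon))$ outputs a point $\hat v$ with $\mathbb{E}(\varphi(\hat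 v)-\varphi(v^* ))\le\tilde\varepsilon$ in $N(\tilde\varepsilon)=\frac{C_0\tau_g}{\sqrt{\alpha}}\ln\frac{C\|v^0-v^*\|_2^2}{\tilde\varepsilon}$ calls to $O_g$. **Algorithm SAE$(x^0,L,N)$ (Splitting Accelerated Envelope).** Input: $x^0=y^0=z^0$, $L\in(0,L_h]$, number of iterations $N$; $A_0=0$. For $k=0,\dots,N-1$: - $a_{k+1}=\frac{1/L+\sqrt{1/L^2+4A_k/L}}{2}$, $A_{k+1}=A_k+a_{k+1}$, $x^{k+1}=\frac{A_k}{A_{k+1}}y^k+\frac{a_{k+1}}{A_{k+1}}z^k$; - $y^{k+1}=\mathrm{GMCO}(x^{k+1},F_{L,x^{k+1}}(\cdot))$, where $F_{L,x}(y)=f(y)+\frac{L}{2}\|y-x\|_2^2$; - $z^{k+1}=z^k-a_{k+1}\nabla f(y^{k+1})$. Output $\hat x=y^N$. In the theorem, $N$ is chosen according to the target accuracy $\varepsilon$. **Procedure GMCO$(\zeta^0,F_{L,\zeta^0}(\cdot))$.** For $k=1,2,\dots$: set $$\varphi_k(\zeta)=\langle\nabla h(\zeta^{k-1}),\zeta-\zeta^{k-1}\rangle+g(\zeta)+\tfrac{L}{2}\|\zeta-\zeta^0\|_2^2+\tfrac{L_h}{2}\|\zeta-\zeta^{k-1}\|_2^2$$ (up to an additive constant this has the form of $\varphi$ above with $\alpha=L+L_h$), let $\zeta^k=\mathcal{M}_{inn}(\varphi_k,\zeta^{k-1},N_{\mathcal{M}})$, and stop and return $\zeta^k$ if $\|\nabla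 F_{L,\zeta^0}(\zeta^k)\|_2\le\frac{L}{2}\|\zeta^k-\zeta^0\|_2$. Here $N_{\mathcal{M}}=\frac{C_0\tau_g}{\sqrt{L+L_h}}\ln\frac{C_1L_hR}{\delta\sqrt{\varepsilon L}}$ if $\mu=0$ and $N_{\mathcal{M}}=\frac{C_0\tau_g}{\sqrt{L+L_h}}\ln\frac{C_1L_h}{\delta\sqrt{\mu L}}$ if $\mu>0$, where $C_0,C_1>0$ are appropriately chosen numerical constants. **Algorithm R-SAE (restarted SAE), $\mu>0$.** Input: starting point $\eta_0$, strong convexity constant $\mu>0$, parameter $L$. For $t=1,2,\dots$: $\eta_t=\mathrm{SAE}(\eta_{t-1},L,N_0)$ with $N_0=\sqrt{8L/\mu}$. Output $\hat x=\eta_t$ for the last $t$, the number of restarts being chosen according to $\varepsilon$.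
   Formalization: Proved for ε≤LR² (a), μ≤L (b), ln(μR²/ε) read as max{1,·}; C_1≥10^9(1+C·L_g/L_h²); O_g bounds carry the full log of N_M, the displayed log only if it dominates C_1L_h/√L resp. C_1L_h/√(μL); O_g calls of GMCO's stopping tests are bounded separately by κ_g·L_h/L per iteration. *)

theory Defs
  imports "HOL-Probability.Probability"
begin

section \<open>Smooth and strongly convex functions\<close>

definition grad :: "('a::euclidean_space \<Rightarrow> real) \<Rightarrow> 'a \<Rightarrow> 'a" where
  "grad f x = (THE D. GDERIV f x :> D)"

definition cont_differentiable :: "('a::euclidean_space \<Rightarrow> real) \<Rightarrow> bool" where
  "cont_differentiable f \<longleftrightarrow> (\<forall>x. \<exists>D. GDERIV f x :> D) \<and> continuous_on UNIV (grad f)"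

definition smooth_fun :: "real \<Rightarrow> ('a::euclidean_space \<Rightarrow> real) \<Rightarrow> bool" where
  "smooth_fun l f \<longleftrightarrow> (\<forall>x. \<exists>D. GDERIV f x :> D) \<and> l-lipschitz_on UNIV (grad f)"

definition strongly_convex :: "real \<Rightarrow> ('a::euclidean_space \<Rightarrow> real) \<Rightarrow> bool" where
  "strongly_convex \<mu> f \<longleftrightarrow>
     (\<forall>x y t. 0 \<le> t \<and> t \<le> 1 \<longrightarrow>
        f ((1 - t) *\<^sub>R x + t *\<^sub>R y)
          \<le> (1 - t) * f x + t * f y - \<mu> / 2 * t * (1 - t) * (norm (x - y))\<^sup>2)"

lemma GDERIV_unique:
  assumes "GDERIV f x :> D" and "GDERIV f x :> (E::'a::euclidean_space)"
  shows "D = E"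
proof -
  have "(\<lambda>h. inner h D) = (\<lambda>h. inner h E)"
    using assms unfolding gderiv_def by (rule has_derivative_unique)
  then show ?thesis
    by (metis vector_eq_ldot)
qed

lemma grad_eqI: "GDERIV f x :> D \<Longrightarrow> grad f x = D"
  unfolding grad_def by (blast intro: the_equality GDERIV_unique)

section \<open>The inner method\<close>

text \<open>
  \<open>inner_obj g \<alpha> \<beta>\<close> is the function \<open>\<phi>\<close> that the inner method minimises.  A randomized
  method is a function \<open>M \<phi> v N s\<close> of the objective, the starting point \<open>v\<close>, the number \<open>N\<close>
  of calls to the basic oracle of \<open>g\<close> that it may use, and a random seed \<open>s\<close> drawn from a
  probability space \<open>\<Xi>\<close>; a deterministic method ignores the seed.
\<close>

definition inner_obj ::
  "('a::euclidean_space \<Rightarrow> real) \<Rightarrow> real \<Rightarrow> 'a \<Rightarrow> 'a \<Rightarrow> real" where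
  "inner_obj g \<alpha> \<beta> v = inner \<beta> v + \<alpha> / 2 * (norm v)\<^sup>2 + g v"

type_synonym ('a, 's) rmethod = "('a \<Rightarrow> real) \<Rightarrow> 'a \<Rightarrow> nat \<Rightarrow> 's \<Rightarrow> 'a"

text \<open>
  The parameters \<open>\<tau>\<close>, \<open>C0\<close>, \<open>C\<close> do not depend on \<open>\<alpha>\<close>.  The number of calls is an
  integer, so the budget \<open>C0 * \<tau> / sqrt \<alpha> * ln (C * |v0 - vs|^2 / \<epsilon>')\<close> means: any integral
  budget that is at least this large suffices for accuracy \<open>\<epsilon>'\<close>.  If \<open>v0 = vs\<close>, the
  logarithm is minus infinity; the library value \<open>ln 0 = 0\<close> gives the same condition here,
  since every budget is then allowed in both cases.
  The expectation is a nonnegative integral, so no integrability has to be presupposed.  The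
  measurability clause makes this expectation, and the runs of the algorithms that call the
  method repeatedly, well defined.
\<close>

definition inner_method ::
  "'s measure \<Rightarrow> ('a::euclidean_space \<Rightarrow> real) \<Rightarrow> ('a, 's) rmethod
     \<Rightarrow> real \<Rightarrow> real \<Rightarrow> real \<Rightarrow> bool" where
  "inner_method \<Xi> g M \<tau> C0 C \<longleftrightarrow>
     (\<forall>\<alpha>. 0 < \<alpha> \<and> sqrt \<alpha> < \<tau> \<longrightarrow>
       (\<forall>N. (\<lambda>(s, \<beta>, v). M (inner_obj g \<alpha> \<beta>) v N s)
              \<in> \<Xi> \<Otimes>\<^sub>M (borel \<Otimes>\<^sub>M borel) \<rightarrow>\<^sub>M borel) \<and>
       (\<forall>\<beta> v0 vs \<epsilon>' N.
          is_arg_min (inner_obj g \<alpha> \<beta>) (\<lambda>_. True) vs \<and> 0 < \<epsilon>' \<and>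
          C0 * \<tau> / sqrt \<alpha> * ln (C * (norm (v0 - vs))\<^sup>2 / \<epsilon>') \<le> real N \<longrightarrow>
          (\<integral>\<^sup>+ s. ennreal (inner_obj g \<alpha> \<beta> (M (inner_obj g \<alpha> \<beta>) v0 N s)
                           - inner_obj g \<alpha> \<beta> vs) \<partial>\<Xi>) \<le> ennreal \<epsilon>'))"

section \<open>Procedure GMCO\<close>

definition prox_obj ::
  "('a::euclidean_space \<Rightarrow> real) \<Rightarrow> real \<Rightarrow> 'a \<Rightarrow> 'a \<Rightarrow> real" where
  "prox_obj f L x y = f y + L / 2 * (norm (y - x))\<^sup>2"

text \<open>
  \<open>gmco_obj\<close> is \<open>\<phi>\<^sub>k\<close> with \<open>\<zeta> = \<zeta>\<^sup>k\<^sup>-\<^sup>1\<close>.  The method is called on the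
  representative of \<open>\<phi>\<^sub>k\<close>, up to an additive constant, that has the form \<open>inner_obj\<close>.
\<close>

definition gmco_obj ::
  "('a::euclidean_space \<Rightarrow> real) \<Rightarrow> ('a \<Rightarrow> real) \<Rightarrow> real \<Rightarrow> real \<Rightarrow> 'a \<Rightarrow> 'a \<Rightarrow> 'a \<Rightarrow> real" where
  "gmco_obj h g L Lh \<zeta>0 \<zeta> v =
     inner (grad h \<zeta>) (v - \<zeta>) + g v
       + L / 2 * (norm (v - \<zeta>0))\<^sup>2 + Lh / 2 * (norm (v - \<zeta>))\<^sup>2"

definition gmco_lin ::
  "('a::euclidean_space \<Rightarrow> real) \<Rightarrow> real \<Rightarrow> real \<Rightarrow> 'a \<Rightarrow> 'a \<Rightarrow> 'a" where
  "gmco_lin h L Lh \<zeta>0 \<zeta> = grad h \<zeta> - L *\<^sub>R \<zeta>0 - Lh *\<^sub>R \<zeta>"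

lemma gmco_obj_eq_inner_obj:
  "gmco_obj h g L Lh \<zeta>0 \<zeta> v = inner_obj g (L + Lh) (gmco_lin h L Lh \<zeta>0 \<zeta>) v
     + (L / 2 * (norm \<zeta>0)\<^sup>2 + Lh / 2 * (norm \<zeta>)\<^sup>2 - inner (grad h \<zeta>) \<zeta>)"
  unfolding gmco_obj_def inner_obj_def gmco_lin_def power2_norm_eq_inner
  by (simp add: algebra_simps inner_commute add_divide_distrib diff_divide_distrib)

primrec gmco_iter ::
  "('a::euclidean_space \<Rightarrow> real) \<Rightarrow> ('a \<Rightarrow> real) \<Rightarrow> ('a, 's) rmethod \<Rightarrow> real \<Rightarrow> real \<Rightarrow> nat
     \<Rightarrow> 'a \<Rightarrow> (nat \<Rightarrow> 's) \<Rightarrow> nat \<Rightarrow> 'a" where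
  "gmco_iter h g M L Lh NM \<zeta>0 \<omega> 0 = \<zeta>0"
| "gmco_iter h g M L Lh NM \<zeta>0 \<omega> (Suc k) =
     (let \<zeta> = gmco_iter h g M L Lh NM \<zeta>0 \<omega> k
      in M (inner_obj g (L + Lh) (gmco_lin h L Lh \<zeta>0 \<zeta>)) \<zeta> NM (\<omega> k))"

definition gmco_stop ::
  "('a::euclidean_space \<Rightarrow> real) \<Rightarrow> real \<Rightarrow> 'a \<Rightarrow> 'a \<Rightarrow> bool" where
  "gmco_stop f L \<zeta>0 \<zeta> \<longleftrightarrow> norm (grad (prox_obj f L \<zeta>0) \<zeta>) \<le> L / 2 * norm (\<zeta> - \<zeta>0)"

text \<open>
  Returns the output together with the number of iterations performed, and \<open>None\<close> if the loop
  does not terminate.  The call in iteration \<open>k + 1\<close> uses the seed \<open>\<omega> k\<close>.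
\<close>

definition gmco ::
  "('a::euclidean_space \<Rightarrow> real) \<Rightarrow> ('a \<Rightarrow> real) \<Rightarrow> ('a, 's) rmethod \<Rightarrow> real \<Rightarrow> real \<Rightarrow> nat
     \<Rightarrow> 'a \<Rightarrow> (nat \<Rightarrow> 's) \<Rightarrow> ('a \<times> nat) option" where
  "gmco h g M L Lh NM \<zeta>0 \<omega> =
     (let stop = (\<lambda>k. 1 \<le> k \<and> gmco_stop (\<lambda>x. h x + g x) L \<zeta>0 (gmco_iter h g M L Lh NM \<zeta>0 \<omega> k))
      in if \<exists>k. stop k
         then Some (gmco_iter h g M L Lh NM \<zeta>0 \<omega> (LEAST k. stop k), LEAST k. stop k)
         else None)"

section \<open>Algorithms SAE and R-SAE\<close>

definition sae_step :: "real \<Rightarrow> real \<Rightarrow> real" where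
  "sae_step L A = (1 / L + sqrt (1 / L\<^sup>2 + 4 * A / L)) / 2"

primrec sae_A :: "real \<Rightarrow> nat \<Rightarrow> real" where
  "sae_A L 0 = 0"
| "sae_A L (Suc k) = sae_A L k + sae_step L (sae_A L k)"

text \<open>
  The state after \<open>k\<close> iterations consists of \<open>y\<^sup>k\<close>, \<open>z\<^sup>k\<close> and the total number of GMCO
  iterations so far.  The GMCO run in iteration \<open>k + 1\<close> uses the seeds \<open>\<omega> (k, 0), \<omega> (k, 1), \<dots>\<close>.
\<close>

primrec sae_state ::
  "('a::euclidean_space \<Rightarrow> real) \<Rightarrow> ('a \<Rightarrow> real) \<Rightarrow> ('a, 's) rmethod \<Rightarrow> real \<Rightarrow> real \<Rightarrow> nat
     \<Rightarrow> 'a \<Rightarrow> (nat \<times> nat \<Rightarrow> 's) \<Rightarrow> nat \<Rightarrow> ('a \<times> 'a \<times> nat) option" where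
  "sae_state h g M L Lh NM x0 \<omega> 0 = Some (x0, x0, 0)"
| "sae_state h g M L Lh NM x0 \<omega> (Suc k) =
     (case sae_state h g M L Lh NM x0 \<omega> k of
        None \<Rightarrow> None
      | Some (y, z, m) \<Rightarrow>
          let a = sae_step L (sae_A L k);
              A = sae_A L k;
              A' = sae_A L (Suc k);
              x = (A / A') *\<^sub>R y + (a / A') *\<^sub>R z
          in case gmco h g M L Lh NM x (\<lambda>j. \<omega> (k, j)) of
               None \<Rightarrow> None
             | Some (y', m') \<Rightarrow> Some (y', z - a *\<^sub>R grad (\<lambda>u. h u + g u) y', m + m'))"

definition sae ::
  "('a::euclidean_space \<Rightarrow> real) \<Rightarrow> ('a \<Rightarrow> real) \<Rightarrow> ('a, 's) rmethod \<Rightarrow> real \<Rightarrow> real \<Rightarrow> nat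
     \<Rightarrow> 'a \<Rightarrow> nat \<Rightarrow> (nat \<times> nat \<Rightarrow> 's) \<Rightarrow> ('a \<times> nat) option" where
  "sae h g M L Lh NM x0 N \<omega> =
     map_option (\<lambda>(y, z, m). (y, m)) (sae_state h g M L Lh NM x0 \<omega> N)"

text \<open>\<open>rsae \<dots> T\<close> performs \<open>T\<close> restarts, each of \<open>N0\<close> iterations of SAE.\<close>

primrec rsae ::
  "('a::euclidean_space \<Rightarrow> real) \<Rightarrow> ('a \<Rightarrow> real) \<Rightarrow> ('a, 's) rmethod \<Rightarrow> real \<Rightarrow> real \<Rightarrow> nat
     \<Rightarrow> nat \<Rightarrow> 'a \<Rightarrow> (nat \<times> nat \<times> nat \<Rightarrow> 's) \<Rightarrow> nat \<Rightarrow> ('a \<times> nat) option" where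
  "rsae h g M L Lh NM N0 \<eta>0 \<omega> 0 = Some (\<eta>0, 0)"
| "rsae h g M L Lh NM N0 \<eta>0 \<omega> (Suc t) =
     (case rsae h g M L Lh NM N0 \<eta>0 \<omega> t of
        None \<Rightarrow> None
      | Some (\<eta>, m) \<Rightarrow>
          (case sae h g M L Lh NM \<eta> N0 (\<lambda>(k, j). \<omega> (t, k, j)) of
             None \<Rightarrow> None
           | Some (\<eta>', m') \<Rightarrow> Some (\<eta>', m + m')))"

definition restart_length :: "real \<Rightarrow> real \<Rightarrow> nat" where
  "restart_length L \<mu> = nat \<lceil>sqrt (8 * L / \<mu>)\<rceil>"

definition inner_budget :: "real \<Rightarrow> real \<Rightarrow> real \<Rightarrow> real \<Rightarrow> real \<Rightarrow> nat" where
  "inner_budget C0 \<tau> L Lh X = nat \<lceil>C0 * \<tau> / sqrt (L + Lh) * ln X\<rceil>"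

text \<open>The arguments of the logarithm in \<open>N\<^sub>M\<close> for \<open>\<mu> = 0\<close> and for \<open>\<mu> > 0\<close>.\<close>

definition log_arg0 :: "real \<Rightarrow> real \<Rightarrow> real \<Rightarrow> real \<Rightarrow> real \<Rightarrow> real \<Rightarrow> real" where
  "log_arg0 C1 Lh R \<delta> \<epsilon> L = C1 * Lh * R / (\<delta> * sqrt (\<epsilon> * L))"

definition log_arg1 :: "real \<Rightarrow> real \<Rightarrow> real \<Rightarrow> real \<Rightarrow> real \<Rightarrow> real" where
  "log_arg1 C1 Lh \<delta> \<mu> L = C1 * Lh / (\<delta> * sqrt (\<mu> * L))"

section \<open>Oracle calls\<close>

text \<open>
  Calls made in \<open>n\<close> iterations of SAE with \<open>m\<close> iterations of GMCO in total.  Each GMCO iteration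
  evaluates \<open>grad h\<close> to set up \<open>\<phi>\<^sub>k\<close> and once more in the stopping test, and spends \<open>NM\<close> calls
  in the inner method; each SAE iteration evaluates \<open>grad h\<close> and \<open>grad g\<close> once for
  \<open>z\<^sup>k\<^sup>+\<^sup>1\<close>.  The calls to the basic oracle of \<open>g\<close> caused by the stopping tests are counted
  separately in \<open>test_calls\<close>: the bound for the basic oracle charges \<open>\<kappa>\<close> only once per
  SAE iteration.
\<close>

definition h_calls :: "nat \<Rightarrow> nat \<Rightarrow> nat" where
  "h_calls n m = n + 2 * m"

definition g_calls :: "nat \<Rightarrow> nat \<Rightarrow> nat \<Rightarrow> nat \<Rightarrow> nat" where
  "g_calls \<kappa> NM n m = \<kappa> * n + NM * m"

definition test_calls :: "nat \<Rightarrow> nat \<Rightarrow> nat" where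
  "test_calls \<kappa> m = \<kappa> * m"

section \<open>Numerical constants\<close>

text \<open>
  \<open>bigO_const\<close> is the constant hidden in the \<open>O\<close>-bounds and \<open>log_const\<close> enters the lower
  bound for the constant \<open>C1\<close> in \<open>N\<^sub>M\<close>.  They are fixed numbers because an existential
  quantifier inside the theorem would let them depend on the dimension, which is a type
  variable there.  Their values are not meant to be sharp.
  The lower bound for \<open>C1\<close> is \<open>log_const * (1 + C * Lg / Lh^2)\<close>: neither \<open>C\<close> nor \<open>Lg\<close>
  occurs elsewhere in \<open>N\<^sub>M\<close>, and an accuracy in terms of \<open>\<phi>\<close> bounds the gradient in the
  stopping test only up to a factor that involves \<open>Lg\<close>.
\<close>

definition bigO_const :: real where
  "bigO_const = 10 ^ 6"

definition log_const :: real where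
  "log_const = 10 ^ 9"

end

theory Submission
  imports Defs
begin

text \<open>
  The proof separates the quality of the output, which is deterministic, from the number of calls,
  which is random.

  Quality. The stopping test of GMCO is the relative error criterion of the accelerated hybrid
  proximal extragradient method. It alone makes \<open>A * (f y - f u) + |z - u|^2 / 2\<close> nonincreasing
  (\<open>sae_potential_step\<close>), whatever the inner method has done before the test succeeded. As
  \<open>sae_A L N \<ge> N^2 / (4 * L)\<close>, every terminating run of SAE satisfies
  \<open>f y - f u \<le> 2 * L * |x0 - u|^2 / N^2\<close> (\<open>sae_convergence\<close>), and under strong convexity every
  terminating restart halves the squared distance to the minimizer (\<open>rsae_convergence\<close>). What
  remains is to show that the total number of inner calls is small with probability at least
  \<open>1 - \<delta>\<close>.

  Cost of one GMCO run. GMCO is a proximal gradient method for an \<open>L\<close>-strongly convex function with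
  an \<open>Lh\<close>-smooth part. Let \<open>\<sigma>\<close> denote the error of an inner call, relative to the squared distance
  between its starting point and the exact solution. If the errors in a block of \<open>O(Lh / L)\<close> calls
  have a small sum, then the block behaves like an exact one: it reduces the distance to the
  minimizer by a constant factor and reaches a gradient that is small enough for the test
  (\<open>block_decrease\<close>). Blocks with larger errors can delay the test, but only in proportion to
  the errors: a run that has not stopped after \<open>J\<close> calls satisfies \<open>J \<le> K * (1 + 1201 * \<Sum> \<sigma>)\<close>
  with \<open>K = O(Lh / L)\<close> (\<open>running_gmco_length\<close>).

  Probability. Given the past, an inner call has expected error at most a constant times
  \<open>C * Lg / (Lh^2 * X)\<close>, where \<open>X\<close> is the argument of the logarithm in the budget. By the choice of
  \<open>X\<close>, this is a small multiple of \<open>\<delta> * L / Lh\<close>. Hence the number of calls beyond \<open>K\<close> in a run has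
  expectation at most \<open>K * \<delta> / 2\<close> (\<open>excess_calls_expectation\<close>). By Markov's inequality for the sum
  over all runs, the total number of calls exceeds \<open>2 * K\<close> per run with probability at most \<open>\<delta>\<close>
  (\<open>total_calls_with_high_probability\<close>). Both the expected total excess and the tolerated excess
  are proportional to the number of runs, so the logarithm in the budget may be independent of the
  number of restarts.
\<close>

section \<open>Convex and smooth functions\<close>

lemma gderiv_along_line:
  assumes "GDERIV f (x + t *\<^sub>R w) :> D"
  shows "((\<lambda>t. f (x + t *\<^sub>R w)) has_real_derivative inner D w) (at t)"
proof -
  have "((\<lambda>t. x + t *\<^sub>R w) has_derivative (\<lambda>s. s *\<^sub>R w)) (at t)"
    by (auto intro!: derivative_eq_intros)
  from has_derivative_compose[OF this assms[unfolded gderiv_def]]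
  show ?thesis
    by (simp add: has_field_derivative_def inner_commute mult.commute[of _ "inner D w"])
qed

text \<open>Along the line through \<open>x\<close> and \<open>y\<close> this is the tangent inequality of a convex function of
  one variable.\<close>

lemma convex_above_tangent:
  fixes f :: "'a::euclidean_space \<Rightarrow> real"
  assumes cvx: "convex_on UNIV f" and D: "GDERIV f x :> D"
  shows "f y \<ge> f x + inner D (y - x)"
proof -
  let ?\<psi> = "\<lambda>t. f (x + t *\<^sub>R (y - x))"
  have "convex_on UNIV ?\<psi>"
  proof (rule convex_onI)
    fix t a b :: real assume t: "0 < t" "t < 1"
    have "x + ((1 - t) *\<^sub>R a + t *\<^sub>R b) *\<^sub>R (y - x)
        = (1 - t) *\<^sub>R (x + a *\<^sub>R (y - x)) + t *\<^sub>R (x + b *\<^sub>R (y - x))"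
      by (simp add: algebra_simps)
    then show "?\<psi> ((1 - t) *\<^sub>R a + t *\<^sub>R b) \<le> (1 - t) * ?\<psi> a + t * ?\<psi> b"
      using convex_onD[OF cvx, of t "x + a *\<^sub>R (y - x)" "x + b *\<^sub>R (y - x)"] t by simp
  qed simp
  moreover have "(?\<psi> has_real_derivative inner D (y - x)) (at 0)"
    using gderiv_along_line[of f x 0 "y - x" D] D by simp
  ultimately have "?\<psi> 1 - ?\<psi> 0 \<ge> inner D (y - x) * (1 - 0)"
    by (intro convex_on_imp_above_tangent[of UNIV]) auto
  then show ?thesis by simp
qed

lemma smooth_fun_gderiv: "smooth_fun l f \<Longrightarrow> GDERIV f x :> grad f x"
  unfolding smooth_fun_def using grad_eqI by metis

lemma smooth_fun_lipschitz: "smooth_fun l f \<Longrightarrow> norm (grad f x - grad f y) \<le> l * norm (x - y)"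
  unfolding smooth_fun_def lipschitz_on_def dist_norm by blast

lemma smooth_fun_continuous: "smooth_fun l f \<Longrightarrow> continuous_on UNIV f"
  unfolding smooth_fun_def gderiv_def
  by (metis continuous_at_imp_continuous_on has_derivative_continuous)

lemma smooth_fun_continuous_grad: "smooth_fun l f \<Longrightarrow> continuous_on UNIV (grad f)"
  unfolding smooth_fun_def using lipschitz_on_continuous_on by blast

lemma smooth_fun_add:
  assumes "smooth_fun l f" "smooth_fun k g"
  shows "smooth_fun (l + k) (\<lambda>x. f x + g x)"
    and "grad (\<lambda>x. f x + g x) = (\<lambda>x. grad f x + grad g x)"
proof -
  have D: "GDERIV (\<lambda>x. f x + g x) x :> grad f x + grad g x" for x
    using GDERIV_add smooth_fun_gderiv assms by blast
  then show eq: "grad (\<lambda>x. f x + g x) = (\<lambda>x. grad f x + grad g x)"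
    by (auto intro: grad_eqI)
  show "smooth_fun (l + k) (\<lambda>x. f x + g x)"
    using assms D lipschitz_on_add[of l UNIV "grad f" k "grad g"]
    unfolding smooth_fun_def eq by blast
qed

text \<open>The descent lemma: along a segment, the derivative exceeds its initial value by at most
  \<open>l\<close> times the distance travelled.\<close>

lemma smooth_fun_upper_bound:
  assumes "smooth_fun l f"
  shows "f y \<le> f x + inner (grad f x) (y - x) + l / 2 * (norm (y - x))\<^sup>2"
proof -
  let ?w = "y - x"
  let ?\<psi> = "\<lambda>t. f (x + t *\<^sub>R ?w) - t * inner (grad f x) ?w - l / 2 * t\<^sup>2 * (norm ?w)\<^sup>2"
  let ?\<psi>' = "\<lambda>t. inner (grad f (x + t *\<^sub>R ?w)) ?w - inner (grad f x) ?w - l * t * (norm ?w)\<^sup>2"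
  have "?\<psi> 1 \<le> ?\<psi> 0"
  proof (rule DERIV_nonpos_imp_nonincreasing[of 0 1])
    fix t :: real assume t: "0 \<le> t" "t \<le> 1"
    have "(?\<psi> has_real_derivative ?\<psi>' t) (at t)"
      by (rule derivative_eq_intros gderiv_along_line smooth_fun_gderiv[OF assms] refl
        | simp)+
    moreover have "inner (grad f (x + t *\<^sub>R ?w) - grad f x) ?w
        \<le> norm (grad f (x + t *\<^sub>R ?w) - grad f x) * norm ?w"
      by (rule norm_cauchy_schwarz)
    moreover have "norm (grad f (x + t *\<^sub>R ?w) - grad f x) * norm ?w \<le> (l * (t * norm ?w)) * norm ?w"
      using smooth_fun_lipschitz[OF assms, of "x + t *\<^sub>R ?w" x] t
      by (intro mult_right_mono) auto
    ultimately show "\<exists>D. (?\<psi> has_real_derivative D) (at t) \<and> D \<le> 0"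
      by (intro exI[of _ "?\<psi>' t"]) (auto simp: inner_diff_left power2_eq_square algebra_simps)
  qed simp
  then show ?thesis by simp
qed

text \<open>One gradient step of length \<open>1 / l\<close> already lowers the value by this much, and it cannot
  fall below the minimum.\<close>

lemma smooth_fun_grad_bound:
  assumes sm: "smooth_fun l f" and l: "0 < l" and min: "\<And>y. f xs \<le> f y"
  shows "(norm (grad f x))\<^sup>2 \<le> 2 * l * (f x - f xs)"
proof -
  let ?y = "x - (1 / l) *\<^sub>R grad f x"
  have "f xs \<le> f x + inner (grad f x) (?y - x) + l / 2 * (norm (?y - x))\<^sup>2"
    using min[of ?y] smooth_fun_upper_bound[OF sm, of ?y x] by simp
  also have "\<dots> = f x - (norm (grad f x))\<^sup>2 / (2 * l)"
    using l by (simp add: power2_norm_eq_inner[symmetric] power_mult_distrib power2_eq_square field_simps)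
  finally show ?thesis using l by (simp add: field_simps)
qed

lemma smooth_fun_grad_minimizer:
  assumes "smooth_fun l f" "0 < l" "\<And>y. f xs \<le> f y"
  shows "grad f xs = 0"
  using smooth_fun_grad_bound[OF assms, of xs] by simp

text \<open>Comparing the minimizer with nearby points of the segment towards \<open>x\<close> gives the bound up
  to a factor \<open>1 - t\<close>, which tends to \<open>1\<close>.\<close>

lemma strongly_convex_growth:
  assumes sc: "strongly_convex \<mu> f" and min: "\<And>y. f xs \<le> f y"
  shows "\<mu> / 2 * (norm (x - xs))\<^sup>2 \<le> f x - f xs"
proof (rule tendsto_upperbound[of "\<lambda>t. \<mu> / 2 * (1 - t) * (norm (x - xs))\<^sup>2" _ "at_right (0::real)"])
  show "((\<lambda>t. \<mu> / 2 * (1 - t) * (norm (x - xs))\<^sup>2) \<longlongrightarrow> \<mu> / 2 * (norm (x - xs))\<^sup>2) (at_right 0)"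
    by (rule tendsto_eq_intros refl | simp)+
  have "\<mu> / 2 * (1 - t) * (norm (x - xs))\<^sup>2 \<le> f x - f xs" if "t \<in> {0<..<1}" for t
  proof -
    have "f xs \<le> (1 - t) * f xs + t * f x - \<mu> / 2 * t * (1 - t) * (norm (xs - x))\<^sup>2"
      using min[of "(1 - t) *\<^sub>R xs + t *\<^sub>R x"] sc that
      unfolding strongly_convex_def by (smt (verit) greaterThanLessThan_iff)
    then have "t * (\<mu> / 2 * (1 - t) * (norm (x - xs))\<^sup>2) \<le> t * (f x - f xs)"
      by (simp add: norm_minus_commute algebra_simps)
    then show ?thesis using that by simp
  qed
  then show "\<forall>\<^sub>F t in at_right 0. \<mu> / 2 * (1 - t) * (norm (x - xs))\<^sup>2 \<le> f x - f xs"
    by (intro eventually_at_rightI[of 0 1]) auto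
qed simp

section \<open>Regularized objectives\<close>

lemma smooth_fun_quadratic:
  fixes \<beta> :: "'a::euclidean_space"
  assumes "0 \<le> \<alpha>"
  shows "smooth_fun \<alpha> (\<lambda>v. inner \<beta> v + \<alpha> / 2 * (norm v)\<^sup>2)"
    and "grad (\<lambda>v. inner \<beta> v + \<alpha> / 2 * (norm v)\<^sup>2) = (\<lambda>v. \<beta> + \<alpha> *\<^sub>R v)"
proof -
  have D: "GDERIV (\<lambda>v. inner \<beta> v + \<alpha> / 2 * (norm v)\<^sup>2) v :> \<beta> + \<alpha> *\<^sub>R v" for v
    unfolding gderiv_def power2_norm_eq_inner
    by (auto intro!: derivative_eq_intros simp: inner_commute algebra_simps)
  then show eq: "grad (\<lambda>v. inner \<beta> v + \<alpha> / 2 * (norm v)\<^sup>2) = (\<lambda>v. \<beta> + \<alpha> *\<^sub>R v)"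
    by (auto intro: grad_eqI)
  show "smooth_fun \<alpha> (\<lambda>v. inner \<beta> v + \<alpha> / 2 * (norm v)\<^sup>2)"
    unfolding smooth_fun_def eq lipschitz_on_def dist_norm
    using D assms by (auto simp: scaleR_diff_right[symmetric])
qed

lemma smooth_fun_inner_obj:
  assumes "smooth_fun l g" "0 \<le> \<alpha>"
  shows "smooth_fun (\<alpha> + l) (inner_obj g \<alpha> \<beta>)"
    and "grad (inner_obj g \<alpha> \<beta>) v = \<beta> + \<alpha> *\<^sub>R v + grad g v"
  using smooth_fun_add[OF smooth_fun_quadratic(1)[OF assms(2)] assms(1)]
  unfolding smooth_fun_quadratic(2)[OF assms(2)] inner_obj_def[abs_def] by auto

lemma inner_obj_lower_bound:
  assumes cvx: "convex_on UNIV g" and sm: "smooth_fun l g"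
  shows "inner_obj g \<alpha> \<beta> u \<ge> inner_obj g \<alpha> \<beta> w + inner (\<beta> + \<alpha> *\<^sub>R w + grad g w) (u - w)
           + \<alpha> / 2 * (norm (u - w))\<^sup>2"
  using convex_above_tangent[OF cvx smooth_fun_gderiv[OF sm], of w u]
  unfolding inner_obj_def power2_norm_eq_inner
  by (simp add: inner_commute algebra_simps add_divide_distrib diff_divide_distrib)

text \<open>The quadratic term dominates the affine minorant of \<open>g\<close>, so that the sublevel sets are
  bounded.\<close>

lemma inner_obj_has_minimizer:
  fixes g :: "'a::euclidean_space \<Rightarrow> real"
  assumes cvx: "convex_on UNIV g" and sm: "smooth_fun l g" and \<alpha>: "0 < \<alpha>"
  shows "\<exists>v. \<forall>u. inner_obj g \<alpha> \<beta> v \<le> inner_obj g \<alpha> \<beta> u"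
proof -
  let ?\<phi> = "inner_obj g \<alpha> \<beta>"
  define G where "G = norm (\<beta> + grad g 0)"
  define \<rho> where "\<rho> = 2 * G / \<alpha>"
  have G: "0 \<le> G" and \<rho>: "0 \<le> \<rho>" using \<alpha> by (auto simp: G_def \<rho>_def)
  have "continuous_on UNIV ?\<phi>"
    unfolding inner_obj_def[abs_def] by (intro continuous_intros smooth_fun_continuous[OF sm])
  then have "continuous_on (cball 0 \<rho>) ?\<phi>" by (rule continuous_on_subset) simp
  then obtain v where v: "\<And>u. u \<in> cball 0 \<rho> \<Longrightarrow> ?\<phi> v \<le> ?\<phi> u"
    using continuous_attains_inf[of "cball (0::'a) \<rho>" ?\<phi>] \<rho> by (metis compact_cball cball_eq_empty not_less)
  have "?\<phi> v \<le> ?\<phi> u" for u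
  proof (cases "norm u \<le> \<rho>")
    case True then show ?thesis using v by simp
  next
    case False
    have "?\<phi> u \<ge> ?\<phi> 0 + inner (\<beta> + grad g 0) u + \<alpha> / 2 * (norm u)\<^sup>2"
      using inner_obj_lower_bound[OF cvx sm, of \<alpha> \<beta> 0 u] by simp
    moreover have "inner (\<beta> + grad g 0) u \<ge> - (G * norm u)"
      using Cauchy_Schwarz_ineq2[of "\<beta> + grad g 0" u] unfolding G_def by linarith
    moreover have "G * norm u \<le> \<alpha> / 2 * (norm u)\<^sup>2"
    proof -
      have "G \<le> \<alpha> / 2 * norm u" using False \<alpha> by (simp add: \<rho>_def field_simps)
      then have "G * norm u \<le> \<alpha> / 2 * norm u * norm u" by (rule mult_right_mono) simp
      then show ?thesis by (simp add: power2_eq_square)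
    qed
    ultimately show ?thesis using v[of 0] \<rho> by force
  qed
  then show ?thesis by blast
qed

definition inner_argmin ::
  "('a::euclidean_space \<Rightarrow> real) \<Rightarrow> real \<Rightarrow> 'a \<Rightarrow> 'a" where
  "inner_argmin g \<alpha> \<beta> = (SOME v. \<forall>u. inner_obj g \<alpha> \<beta> v \<le> inner_obj g \<alpha> \<beta> u)"

lemma inner_argmin_minimal:
  assumes "convex_on UNIV g" "smooth_fun l g" "0 < \<alpha>"
  shows "inner_obj g \<alpha> \<beta> (inner_argmin g \<alpha> \<beta>) \<le> inner_obj g \<alpha> \<beta> u"
  unfolding inner_argmin_def using someI_ex[OF inner_obj_has_minimizer[OF assms, of \<beta>]] by blast

lemma smooth_fun_const_nonneg: "smooth_fun l f \<Longrightarrow> 0 \<le> l"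
  unfolding smooth_fun_def lipschitz_on_def by blast

lemma inner_argmin_stationary:
  assumes "convex_on UNIV g" "smooth_fun l g" "0 < \<alpha>"
  shows "\<beta> + \<alpha> *\<^sub>R inner_argmin g \<alpha> \<beta> + grad g (inner_argmin g \<alpha> \<beta>) = 0"
proof -
  have "grad (inner_obj g \<alpha> \<beta>) (inner_argmin g \<alpha> \<beta>) = 0"
    using assms smooth_fun_const_nonneg[OF assms(2)]
    by (intro smooth_fun_grad_minimizer[OF smooth_fun_inner_obj(1)] inner_argmin_minimal) auto
  then show ?thesis using assms by (simp add: smooth_fun_inner_obj(2))
qed

text \<open>Strong monotonicity of the gradient of the objective; the special case in which one of the
  two points is stationary bounds the distance to the minimizer.\<close>

lemma inner_obj_strong_monotone:
  assumes cvx: "convex_on UNIV g" and sm: "smooth_fun l g"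
  shows "\<alpha> * norm (u - w) \<le> norm (\<alpha> *\<^sub>R (u - w) + (grad g u - grad g w))"
proof -
  have "0 \<le> inner (grad g u - grad g w) (u - w)"
    using convex_above_tangent[OF cvx smooth_fun_gderiv[OF sm], of w u]
      convex_above_tangent[OF cvx smooth_fun_gderiv[OF sm], of u w]
    by (simp add: algebra_simps)
  then have "\<alpha> * norm (u - w) * norm (u - w) \<le> inner (\<alpha> *\<^sub>R (u - w) + (grad g u - grad g w)) (u - w)"
    by (simp only: inner_add_left inner_scaleR_left dot_square_norm power2_eq_square mult.assoc)
  also have "\<dots> \<le> norm (\<alpha> *\<^sub>R (u - w) + (grad g u - grad g w)) * norm (u - w)"
    by (rule norm_cauchy_schwarz)
  finally show ?thesis by (cases "u = w") auto
qed

text \<open>The gradient of the objective vanishes at the minimizer, so its size elsewhere certifies the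
  distance.\<close>

lemma dist_inner_argmin:
  assumes "convex_on UNIV g" "smooth_fun l g" "0 < \<alpha>"
  shows "\<alpha> * norm (v - inner_argmin g \<alpha> \<beta>) \<le> norm (\<beta> + \<alpha> *\<^sub>R v + grad g v)"
proof -
  have "\<beta> + \<alpha> *\<^sub>R v + grad g v = \<alpha> *\<^sub>R (v - inner_argmin g \<alpha> \<beta>) + (grad g v - grad g (inner_argmin g \<alpha> \<beta>))"
    using inner_argmin_stationary[OF assms, of \<beta>] by (simp add: algebra_simps eq_neg_iff_add_eq_0)
  then show ?thesis using inner_obj_strong_monotone[OF assms(1,2)] by metis
qed

text \<open>At the minimizer for \<open>\<beta>\<close>, the gradient of the objective for \<open>\<beta>'\<close> is \<open>\<beta>' - \<beta>\<close>, so the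
  minimizer is a Lipschitz function of \<open>\<beta>\<close>. This is what makes the relative error of a random
  inner call measurable.\<close>

lemma continuous_inner_argmin:
  assumes "convex_on UNIV g" "smooth_fun l g" "0 < \<alpha>"
  shows "continuous_on UNIV (inner_argmin g \<alpha>)"
proof (rule lipschitz_on_continuous_on[of "1 / \<alpha>"], rule lipschitz_onI)
  fix \<beta> \<beta>' :: 'a
  let ?v = "inner_argmin g \<alpha> \<beta>"
  have "\<beta>' + \<alpha> *\<^sub>R ?v + grad g ?v = \<beta>' - \<beta>"
    using inner_argmin_stationary[OF assms, of \<beta>] by (simp add: algebra_simps eq_neg_iff_add_eq_0)
  then have "\<alpha> * norm (?v - inner_argmin g \<alpha> \<beta>') \<le> norm (\<beta>' - \<beta>)"
    using dist_inner_argmin[OF assms, of ?v \<beta>'] by (simp only:)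
  then show "dist (inner_argmin g \<alpha> \<beta>) (inner_argmin g \<alpha> \<beta>') \<le> 1 / \<alpha> * dist \<beta> \<beta>'"
    using assms(3) by (simp add: dist_norm norm_minus_commute[of \<beta>] field_simps)
qed (use assms in auto)

lemma prox_obj_eq_inner_obj:
  "prox_obj f L x = (\<lambda>y. inner_obj f L (- L *\<^sub>R x) y + L / 2 * (norm x)\<^sup>2)"
  unfolding prox_obj_def inner_obj_def power2_norm_eq_inner
  by (simp add: fun_eq_iff inner_commute algebra_simps add_divide_distrib diff_divide_distrib)

lemma grad_prox_obj:
  assumes "smooth_fun l f" "0 \<le> L"
  shows "grad (prox_obj f L x) y = grad f y + L *\<^sub>R (y - x)"
proof -
  have c: "GDERIV (\<lambda>y::'a. L / 2 * (norm x)\<^sup>2) y :> 0"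
    unfolding gderiv_def by (auto intro!: derivative_eq_intros)
  have "GDERIV (inner_obj f L (- L *\<^sub>R x)) y :> - L *\<^sub>R x + L *\<^sub>R y + grad f y"
    using smooth_fun_gderiv[OF smooth_fun_inner_obj(1)[OF assms], where x=y]
      smooth_fun_inner_obj(2)[OF assms] by metis
  from grad_eqI[OF GDERIV_add[OF this c]] show ?thesis
    unfolding prox_obj_eq_inner_obj by (simp add: algebra_simps)
qed

section \<open>Proximal gradient steps with relative errors\<close>

text \<open>The recursion of a proximal gradient method in the abstract: \<open>r j\<close> is the distance of the
  iterate to the minimizer, \<open>\<Delta> j\<close> the gap in value, \<open>d j\<close> the length of the step and \<open>s j\<close> its
  relative error. The gap \<open>\<Delta> 0\<close> is not controlled by \<open>r 0\<close>, because the composite function may be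
  much less smooth than \<open>h\<close>; hence the first step is bounded by the triangle inequality, and the
  descent inequality is summed from \<open>\<Delta> 1\<close> on, which is at most \<open>Lh * (r 0)^2\<close>.\<close>

lemma relative_error_path_length:
  fixes r d \<Delta> s :: "nat \<Rightarrow> real"
  assumes Lh: "0 < Lh"
    and nonneg: "\<And>j. 0 \<le> r j" "\<And>j. 0 \<le> \<Delta> j" "\<And>j. 0 \<le> d j" "\<And>j. 0 \<le> s j"
    and descent: "\<And>j. j < m \<Longrightarrow> \<Delta> (Suc j) \<le> \<Delta> j - Lh / 4 * (d j)\<^sup>2"
    and prox: "\<And>j. j < m \<Longrightarrow> \<Delta> (Suc j) \<le> Lh / 2 * ((r j)\<^sup>2 - (r (Suc j))\<^sup>2) + 2 * s j * Lh * d j * r (Suc j)"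
    and tri: "\<And>j. j < m \<Longrightarrow> d j \<le> r j + r (Suc j)"
    and first: "r 1 \<le> 11 / 10 * r 0"
    and small: "(\<Sum>j<m. (s j)\<^sup>2) \<le> 1 / 400"
  shows "(\<Sum>j<m. (d j)\<^sup>2) \<le> 9 * (r 0)\<^sup>2"
proof (cases m)
  case 0 then show ?thesis by simp
next
  case (Suc m')
  have tele: "(\<Sum>j<Suc k. (d j)\<^sup>2) \<le> (d 0)\<^sup>2 + 4 / Lh * (\<Delta> 1 - \<Delta> (Suc k))" if "k \<le> m'" for k
    using that
  proof (induction k)
    case (Suc k)
    then have "(d (Suc k))\<^sup>2 \<le> 4 / Lh * (\<Delta> (Suc k) - \<Delta> (Suc (Suc k)))"
      using descent[of "Suc k"] Lh \<open>m = Suc m'\<close> by (simp add: field_simps)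
    then show ?case using Suc by (simp add: algebra_simps)
  qed simp
  have s0: "s 0 \<le> 1 / 20"
  proof -
    have "(s 0)\<^sup>2 \<le> (\<Sum>j<m. (s j)\<^sup>2)" using \<open>m = Suc m'\<close> by (intro member_le_sum) auto
    then have "(s 0)\<^sup>2 \<le> (1 / 20)\<^sup>2" using small by (simp add: power2_eq_square)
    then show ?thesis by (rule power2_le_imp_le) simp
  qed
  have d0: "d 0 \<le> 21 / 10 * r 0" using tri[of 0] first Suc by simp
  have "\<Delta> 1 \<le> Lh * (r 0)\<^sup>2"
  proof -
    have "s 0 * (d 0 * r 1) \<le> 1 / 20 * ((21 / 10 * r 0) * (11 / 10 * r 0))"
      using s0 d0 first nonneg by (intro mult_mono) (auto intro: mult_nonneg_nonneg)
    then have "2 * (s 0 * (d 0 * r 1)) \<le> 1 / 2 * (r 0)\<^sup>2"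
      using zero_le_square[of "r 0"] unfolding power2_eq_square by linarith
    then have "Lh * (2 * (s 0 * (d 0 * r 1))) \<le> Lh * (1 / 2 * (r 0)\<^sup>2)"
      using Lh by (intro mult_left_mono) auto
    then have "2 * s 0 * Lh * d 0 * r 1 \<le> Lh * (1 / 2 * (r 0)\<^sup>2)" by (simp add: mult_ac)
    moreover have "\<Delta> 1 \<le> Lh / 2 * (r 0)\<^sup>2 + 2 * s 0 * Lh * d 0 * r 1"
    proof -
      have "Lh / 2 * ((r 0)\<^sup>2 - (r 1)\<^sup>2) \<le> Lh / 2 * (r 0)\<^sup>2" using Lh by (intro mult_left_mono) auto
      then show ?thesis using prox[of 0] Suc by simp
    qed
    ultimately show ?thesis by simp
  qed
  then have "4 / Lh * (\<Delta> 1 - \<Delta> (Suc m')) \<le> 4 * (r 0)\<^sup>2"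
    using Lh nonneg(2)[of "Suc m'"] by (simp add: field_simps)
  moreover have "(d 0)\<^sup>2 \<le> (21 / 10 * r 0)\<^sup>2" using d0 nonneg by (intro power_mono) auto
  ultimately show ?thesis using tele[of m'] zero_le_square[of "r 0"]
    unfolding Suc power2_eq_square by linarith
qed

text \<open>By the Cauchy-Schwarz inequality, \<open>\<Sum> s j * d j\<close> is a small fraction of \<open>r 0\<close> as soon as
  the sum of the squared relative errors is small. So the iterates do not drift away, and the
  telescoped proximal inequality gives the rate \<open>1 / m\<close>. A bound on every single \<open>s j\<close> would
  control this sum only up to a factor \<open>sqrt m\<close>.\<close>

lemma relative_error_bounds:
  fixes r d \<Delta> s :: "nat \<Rightarrow> real"
  assumes Lh: "0 < Lh"
    and nonneg: "\<And>j. 0 \<le> r j" "\<And>j. 0 \<le> \<Delta> j" "\<And>j. 0 \<le> d j" "\<And>j. 0 \<le> s j"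
    and descent: "\<And>j. j < m \<Longrightarrow> \<Delta> (Suc j) \<le> \<Delta> j - Lh / 4 * (d j)\<^sup>2"
    and prox: "\<And>j. j < m \<Longrightarrow> \<Delta> (Suc j) \<le> Lh / 2 * ((r j)\<^sup>2 - (r (Suc j))\<^sup>2) + 2 * s j * Lh * d j * r (Suc j)"
    and tri: "\<And>j. j < m \<Longrightarrow> d j \<le> r j + r (Suc j)"
    and first: "r 1 \<le> 11 / 10 * r 0"
    and small: "(\<Sum>j<m. (s j)\<^sup>2) \<le> 1 / 400"
  shows "r m \<le> 2 * r 0" and "real m * \<Delta> m \<le> 2 * Lh * (r 0)\<^sup>2"
proof -
  define R where "R = Max (r ` {..m})"
  have rR: "r j \<le> R" if "j \<le> m" for j using that by (auto simp: R_def)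
  obtain i where i: "i \<le> m" "r i = R" unfolding R_def
    using Max_in[of "r ` {..m}"] by (auto simp: image_iff)
  have sd: "(\<Sum>j<k. s j * d j) \<le> 3 / 20 * r 0" if "k \<le> m" for k
  proof -
    have "(\<Sum>j<k. s j * d j) \<le> (\<Sum>j<m. s j * d j)"
      using that nonneg by (intro sum_mono2) auto
    also have "\<dots> = (\<Sum>j<m. \<bar>s j\<bar> * \<bar>d j\<bar>)" using nonneg by simp
    also have "\<dots> \<le> L2_set s {..<m} * L2_set d {..<m}" by (rule L2_set_mult_ineq)
    also have "\<dots> \<le> sqrt (1 / 400) * sqrt (9 * (r 0)\<^sup>2)"
      unfolding L2_set_def
      using small relative_error_path_length[OF assms] by (intro mult_mono) (auto simp: sum_nonneg)
    also have "\<dots> = 3 / 20 * r 0"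
    proof -
      have "sqrt 400 = 20" by (rule real_sqrt_unique) auto
      moreover have "sqrt 9 = 3" by (rule real_sqrt_unique) auto
      ultimately show ?thesis using nonneg by (simp add: real_sqrt_mult real_sqrt_divide)
    qed
    finally show ?thesis .
  qed
  have tele: "(r k)\<^sup>2 + 2 / Lh * (\<Sum>j<k. \<Delta> (Suc j)) \<le> (r 0)\<^sup>2 + 4 * R * (\<Sum>j<k. s j * d j)"
    if "k \<le> m" for k
    using that
  proof (induction k)
    case (Suc k)
    have "2 / Lh * \<Delta> (Suc k)
        \<le> 2 / Lh * (Lh / 2 * ((r k)\<^sup>2 - (r (Suc k))\<^sup>2) + 2 * s k * Lh * d k * r (Suc k))"
      using prox[of k] Suc Lh by (intro mult_left_mono) auto
    also have "\<dots> = (r k)\<^sup>2 - (r (Suc k))\<^sup>2 + 4 * (s k * d k * r (Suc k))"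
      using Lh by (simp add: field_simps)
    also have "s k * d k * r (Suc k) \<le> s k * d k * R"
      using rR[of "Suc k"] Suc nonneg by (intro mult_left_mono) auto
    finally show ?case using Suc by (simp add: algebra_simps)
  qed simp
  have tele': "(r k)\<^sup>2 + 2 / Lh * (\<Sum>j<k. \<Delta> (Suc j)) \<le> (r 0)\<^sup>2 + 3 / 5 * R * r 0" if "k \<le> m" for k
  proof -
    have "4 * R * (\<Sum>j<k. s j * d j) \<le> 4 * R * (3 / 20 * r 0)"
      using sd[OF that] nonneg(1)[of i] i by (intro mult_left_mono) auto
    then show ?thesis using tele[OF that] by simp
  qed
  have R2: "R \<le> 2 * r 0"
  proof (rule ccontr)
    assume *: "\<not> R \<le> 2 * r 0"
    have "0 \<le> 2 / Lh * (\<Sum>j<i. \<Delta> (Suc j))"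
      using Lh nonneg by (intro mult_nonneg_nonneg sum_nonneg) auto
    then have "R\<^sup>2 \<le> (r 0)\<^sup>2 + 3 / 5 * R * r 0" using tele'[OF i(1)] i by simp
    moreover have "(r 0)\<^sup>2 \<le> (R / 2)\<^sup>2" using * nonneg by (intro power_mono) auto
    moreover have "R * r 0 \<le> R * (R / 2)" using * nonneg(1)[of i] i by (intro mult_left_mono) auto
    moreover have "0 < R\<^sup>2" using * nonneg(1)[of 0] by simp
    ultimately show False by (simp add: power2_eq_square)
  qed
  then show "r m \<le> 2 * r 0" using rR[of m] by simp
  have mono: "\<Delta> m \<le> \<Delta> (Suc j)" if "j < m" for j
  proof -
    have "\<Delta> (Suc j + k) \<le> \<Delta> (Suc j)" if "Suc j + k \<le> m" for k
      using that
    proof (induction k)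
      case (Suc k)
      then show ?case using descent[of "Suc j + k"] Lh
        by (smt (verit) add_Suc_right less_eq_Suc_le mult_nonneg_nonneg zero_le_power2 divide_nonneg_pos Suc_leD)
    qed simp
    from this[of "m - Suc j"] that show ?thesis by simp
  qed
  have "real m * \<Delta> m = (\<Sum>j<m. \<Delta> m)" by simp
  also have "\<dots> \<le> (\<Sum>j<m. \<Delta> (Suc j))" using mono by (intro sum_mono) auto
  also have "\<dots> \<le> 2 * Lh * (r 0)\<^sup>2"
  proof -
    have "2 / Lh * (\<Sum>j<m. \<Delta> (Suc j)) \<le> (r 0)\<^sup>2 + 3 / 5 * R * r 0"
      using tele'[of m] by (smt (verit) le_refl zero_le_power2)
    moreover have "R * r 0 \<le> 2 * r 0 * r 0" using R2 nonneg by (intro mult_right_mono) auto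
    ultimately have "2 / Lh * (\<Sum>j<m. \<Delta> (Suc j)) \<le> 4 * (r 0)\<^sup>2"
      using zero_le_square[of "r 0"] unfolding power2_eq_square by linarith
    then show ?thesis using Lh by (simp add: field_simps)
  qed
  finally show "real m * \<Delta> m \<le> 2 * Lh * (r 0)\<^sup>2" .
qed

text \<open>The steps from \<open>n\<close> to \<open>2 * n\<close> have to share the gap \<open>\<Delta> n\<close>, which is already of order
  \<open>1 / n\<close>; one of them has length of order \<open>1 / n\<close>.\<close>

lemma relative_error_short_step:
  fixes d \<Delta> :: "nat \<Rightarrow> real"
  assumes Lh: "0 < Lh" and n: "0 < n"
    and nonneg: "\<And>j. 0 \<le> \<Delta> j" "\<And>j. 0 \<le> d j" "0 \<le> \<rho>"
    and descent: "\<And>j. j < 2 * n \<Longrightarrow> \<Delta> (Suc j) \<le> \<Delta> j - Lh / 4 * (d j)\<^sup>2"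
    and half: "real n * \<Delta> n \<le> 2 * Lh * \<rho>\<^sup>2"
  shows "\<exists>j<2 * n. real n * d j \<le> 3 * \<rho>"
proof (rule ccontr)
  assume "\<not> ?thesis"
  then have big: "3 * \<rho> < real n * d j" if "j < 2 * n" for j using that by force
  have big2: "9 * \<rho>\<^sup>2 \<le> (real n * d j)\<^sup>2" "0 < d j" if "j < 2 * n" for j
  proof -
    have "(3 * \<rho>)\<^sup>2 \<le> (real n * d j)\<^sup>2" using big[OF that] nonneg by (intro power_mono) auto
    then show "9 * \<rho>\<^sup>2 \<le> (real n * d j)\<^sup>2" by (simp add: power_mult_distrib)
    show "0 < d j" using big[OF that] nonneg(2)[of j] nonneg(3) n
      by (metis less_eq_real_def mult_zero_right mult_nonneg_nonneg not_less zero_le_numeral)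
  qed
  have tele: "\<Delta> (n + k) \<le> \<Delta> n - Lh / 4 * (\<Sum>j<k. (d (n + j))\<^sup>2)" if "k \<le> n" for k
    using that
  proof (induction k)
    case (Suc k)
    then show ?case using descent[of "n + k"] by (simp add: algebra_simps)
  qed simp
  have "(\<Sum>j<n. (real n * d (n + j))\<^sup>2) \<ge> (\<Sum>j<n. 9 * \<rho>\<^sup>2)"
    using big2 by (intro sum_mono) auto
  then have a: "9 * \<rho>\<^sup>2 * real n \<le> (real n)\<^sup>2 * (\<Sum>j<n. (d (n + j))\<^sup>2)"
    by (simp add: power_mult_distrib sum_distrib_left mult.commute)
  have "0 < (d (n + j))\<^sup>2" if "j < n" for j using big2(2)[of "n + j"] that by simp
  then have "0 < (\<Sum>j<n. (d (n + j))\<^sup>2)" using n by (intro sum_pos) (auto simp: lessThan_empty_iff)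
  moreover have c: "Lh * (\<Sum>j<n. (d (n + j))\<^sup>2) \<le> 4 * \<Delta> n"
    using tele[of n] nonneg(1)[of "n + n"] by simp
  moreover have "9 * \<rho>\<^sup>2 \<le> real n * (\<Sum>j<n. (d (n + j))\<^sup>2)"
    using a n by (simp add: power2_eq_square)
  ultimately have *: "Lh * (9 * \<rho>\<^sup>2) \<le> Lh * (real n * (\<Sum>j<n. (d (n + j))\<^sup>2))" "0 < Lh * (real n * (\<Sum>j<n. (d (n + j))\<^sup>2))"
    using Lh n by auto
  have "real n * (Lh * (\<Sum>j<n. (d (n + j))\<^sup>2)) \<le> real n * (4 * \<Delta> n)"
    using c by (intro mult_left_mono) auto
  also have "\<dots> \<le> 8 * (Lh * \<rho>\<^sup>2)" using half by simp
  finally have "Lh * (real n * (\<Sum>j<n. (d (n + j))\<^sup>2)) \<le> 8 * (Lh * \<rho>\<^sup>2)" by (simp add: mult.left_commute)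
  with * show False by (simp add: algebra_simps)
qed

locale splitting =
  fixes h g :: "'a::euclidean_space \<Rightarrow> real" and L Lh Lg :: real
  assumes convex_h: "convex_on UNIV h" and convex_g: "convex_on UNIV g"
    and smooth_h: "smooth_fun Lh h" and smooth_g: "smooth_fun Lg g"
    and L_pos: "0 < L" and L_le: "L \<le> Lh" and Lh_le: "Lh \<le> Lg"
begin

abbreviation f :: "'a \<Rightarrow> real" where "f \<equiv> \<lambda>x. h x + g x"

text \<open>The gradient at \<open>v\<close> of the objective of the GMCO iteration that starts from \<open>\<zeta>\<close>.\<close>

definition resid :: "'a \<Rightarrow> 'a \<Rightarrow> 'a \<Rightarrow> 'a" where
  "resid \<zeta>0 \<zeta> v = gmco_lin h L Lh \<zeta>0 \<zeta> + (L + Lh) *\<^sub>R v + grad g v"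

definition exact_step :: "'a \<Rightarrow> 'a \<Rightarrow> 'a" where
  "exact_step \<zeta>0 \<zeta> = inner_argmin g (L + Lh) (gmco_lin h L Lh \<zeta>0 \<zeta>)"

text \<open>The minimizer of \<open>prox_obj f L \<zeta>0\<close>.\<close>

definition prox_center :: "'a \<Rightarrow> 'a" where
  "prox_center \<zeta>0 = inner_argmin f L (- L *\<^sub>R \<zeta>0)"

text \<open>The error is measured relative to the distance from the current point to the exact solution,
  because the guarantee of the inner method is proportional to the square of this distance.\<close>

definition inexact_step :: "'a \<Rightarrow> real \<Rightarrow> 'a \<Rightarrow> 'a \<Rightarrow> bool" where
  "inexact_step \<zeta>0 \<sigma> \<zeta> v \<longleftrightarrow>
     0 \<le> \<sigma> \<and> (norm (resid \<zeta>0 \<zeta> v))\<^sup>2 \<le> \<sigma> * Lh\<^sup>2 * (norm (\<zeta> - exact_step \<zeta>0 \<zeta>))\<^sup>2"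

lemma Lh_pos: "0 < Lh" and Lg_pos: "0 < Lg" and \<alpha>_pos: "0 < L + Lh"
  using L_pos L_le Lh_le by auto

lemma smooth_f: "smooth_fun (Lh + Lg) f" and grad_f: "grad f x = grad h x + grad g x"
  using smooth_fun_add[OF smooth_h smooth_g] by auto

lemma convex_f: "convex_on UNIV f"
  by (intro convex_on_add convex_h convex_g)

lemma grad_prox: "grad (prox_obj f L \<zeta>0) v = grad f v + L *\<^sub>R (v - \<zeta>0)"
  using grad_prox_obj[OF smooth_f] L_pos by simp

lemma resid_exact_step: "resid \<zeta>0 \<zeta> (exact_step \<zeta>0 \<zeta>) = 0"
  unfolding resid_def exact_step_def
  using inner_argmin_stationary[OF convex_g smooth_g \<alpha>_pos] by simp

lemma dist_exact_step: "Lh * norm (v - exact_step \<zeta>0 \<zeta>) \<le> norm (resid \<zeta>0 \<zeta> v)"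
proof -
  have "Lh * norm (v - exact_step \<zeta>0 \<zeta>) \<le> (L + Lh) * norm (v - exact_step \<zeta>0 \<zeta>)"
    using L_pos by (intro mult_right_mono) auto
  then show ?thesis
    using dist_inner_argmin[OF convex_g smooth_g \<alpha>_pos, of v] 
    unfolding resid_def exact_step_def by (rule order_trans)
qed

lemma prox_growth:
  "L / 2 * (norm (u - prox_center \<zeta>0))\<^sup>2 \<le> prox_obj f L \<zeta>0 u - prox_obj f L \<zeta>0 (prox_center \<zeta>0)"
proof -
  let ?c = "prox_center \<zeta>0"
  have "- L *\<^sub>R \<zeta>0 + L *\<^sub>R ?c + grad f ?c = 0"
    unfolding prox_center_def by (rule inner_argmin_stationary[OF convex_f smooth_f L_pos])
  then show ?thesis
    using inner_obj_lower_bound[OF convex_f smooth_f, of L "- L *\<^sub>R \<zeta>0" ?c u]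
    unfolding prox_obj_eq_inner_obj by simp
qed

lemma dist_prox_center: "L * norm (u - prox_center \<zeta>0) \<le> norm (grad (prox_obj f L \<zeta>0) u)"
proof -
  have "grad (prox_obj f L \<zeta>0) u = - L *\<^sub>R \<zeta>0 + L *\<^sub>R u + grad f u"
    unfolding grad_prox by (simp add: algebra_simps)
  then show ?thesis
    using dist_inner_argmin[OF convex_f smooth_f L_pos, of u "- L *\<^sub>R \<zeta>0"]
    unfolding prox_center_def by metis
qed

text \<open>The basic inequality of the proximal gradient method: \<open>h\<close> is bounded from above at \<open>v\<close> by the
  descent lemma and from below at \<open>u\<close> by its tangent at \<open>\<zeta>\<close>, and the remaining part of the
  objective is \<open>L\<close>-strongly convex with a gradient at \<open>v\<close> that is given by the residual.\<close>

lemma prox_step_inequality: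
  "prox_obj f L \<zeta>0 v - prox_obj f L \<zeta>0 u
     \<le> Lh / 2 * ((norm (u - \<zeta>))\<^sup>2 - (norm (u - v))\<^sup>2) - L / 2 * (norm (u - v))\<^sup>2
       - inner (resid \<zeta>0 \<zeta> v) (u - v)"
proof -
  have 1: "h v \<le> h \<zeta> + inner (grad h \<zeta>) (v - \<zeta>) + Lh / 2 * (norm (v - \<zeta>))\<^sup>2"
    by (rule smooth_fun_upper_bound[OF smooth_h])
  have 2: "h u \<ge> h \<zeta> + inner (grad h \<zeta>) (u - \<zeta>)"
    by (rule convex_above_tangent[OF convex_h smooth_fun_gderiv[OF smooth_h]])
  have 3: "g u \<ge> g v + inner (grad g v) (u - v)"
    by (rule convex_above_tangent[OF convex_g smooth_fun_gderiv[OF smooth_g]])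
  have 4: "Lh / 2 * ((norm (u - \<zeta>))\<^sup>2 - (norm (u - v))\<^sup>2) - L / 2 * (norm (u - v))\<^sup>2
       - inner (resid \<zeta>0 \<zeta> v) (u - v) = 
       inner (grad h \<zeta>) (v - \<zeta>) + Lh / 2 * (norm (v - \<zeta>))\<^sup>2 - inner (grad h \<zeta>) (u - \<zeta>)
       - inner (grad g v) (u - v) + L / 2 * (norm (v - \<zeta>0))\<^sup>2 - L / 2 * (norm (u - \<zeta>0))\<^sup>2"
    unfolding resid_def gmco_lin_def power2_norm_eq_inner
    by (simp add: inner_commute algebra_simps add_divide_distrib diff_divide_distrib)
  show ?thesis using 1 2 3 unfolding 4 prox_obj_def by linarith
qed

lemma exact_step_nonexpansive:
  "norm (exact_step \<zeta>0 \<zeta> - prox_center \<zeta>0) \<le> norm (\<zeta> - prox_center \<zeta>0)"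
proof -
  let ?c = "prox_center \<zeta>0" and ?v = "exact_step \<zeta>0 \<zeta>"
  have "0 \<le> L / 2 * (norm (?v - ?c))\<^sup>2" "0 \<le> L / 2 * (norm (?c - ?v))\<^sup>2" using L_pos by auto
  then have "0 \<le> Lh / 2 * ((norm (?c - \<zeta>))\<^sup>2 - (norm (?c - ?v))\<^sup>2)"
    using prox_growth[of ?v \<zeta>0] prox_step_inequality[of \<zeta>0 ?v ?c \<zeta>] by (simp add: resid_exact_step)
  then have "(norm (?c - ?v))\<^sup>2 \<le> (norm (?c - \<zeta>))\<^sup>2" using Lh_pos by (simp add: zero_le_mult_iff)
  then show ?thesis by (metis norm_minus_commute norm_ge_zero power2_le_imp_le)
qed

lemma inexact_step_resid:
  assumes "inexact_step \<zeta>0 \<sigma> \<zeta> v"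
  shows "norm (resid \<zeta>0 \<zeta> v) \<le> sqrt \<sigma> * Lh * norm (\<zeta> - exact_step \<zeta>0 \<zeta>)"
proof (rule power2_le_imp_le)
  show "(norm (resid \<zeta>0 \<zeta> v))\<^sup>2 \<le> (sqrt \<sigma> * Lh * norm (\<zeta> - exact_step \<zeta>0 \<zeta>))\<^sup>2"
    using assms unfolding inexact_step_def by (simp add: power_mult_distrib)
qed (use assms Lh_pos in \<open>auto simp: inexact_step_def\<close>)

lemma inexact_step_dist:
  assumes "inexact_step \<zeta>0 \<sigma> \<zeta> v"
  shows "norm (v - exact_step \<zeta>0 \<zeta>) \<le> sqrt \<sigma> * norm (\<zeta> - exact_step \<zeta>0 \<zeta>)"
proof -
  have "Lh * norm (v - exact_step \<zeta>0 \<zeta>) \<le> Lh * (sqrt \<sigma> * norm (\<zeta> - exact_step \<zeta>0 \<zeta>))"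
    using order_trans[OF dist_exact_step inexact_step_resid[OF assms]] by (simp add: mult_ac)
  then show ?thesis using Lh_pos by simp
qed

text \<open>This bound holds for calls of any quality; it limits the damage of a bad one.\<close>

lemma inexact_step_growth:
  assumes "inexact_step \<zeta>0 \<sigma> \<zeta> v"
  shows "norm (v - prox_center \<zeta>0) \<le> (1 + 2 * sqrt \<sigma>) * norm (\<zeta> - prox_center \<zeta>0)"
proof -
  let ?c = "prox_center \<zeta>0" and ?e = "exact_step \<zeta>0 \<zeta>"
  have s: "0 \<le> sqrt \<sigma>" using assms by (simp add: inexact_step_def)
  have "norm (\<zeta> - ?e) \<le> norm (\<zeta> - ?c) + norm (?e - ?c)"
    using norm_triangle_ineq4[of "\<zeta> - ?c" "?e - ?c"] by simp
  then have "norm (\<zeta> - ?e) \<le> 2 * norm (\<zeta> - ?c)" using exact_step_nonexpansive[of \<zeta>0 \<zeta>] by linarith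
  then have "sqrt \<sigma> * norm (\<zeta> - ?e) \<le> sqrt \<sigma> * (2 * norm (\<zeta> - ?c))" using s by (rule mult_left_mono)
  moreover have "norm (v - ?c) \<le> norm (v - ?e) + norm (?e - ?c)"
    using norm_triangle_ineq[of "v - ?e" "?e - ?c"] by simp
  ultimately show ?thesis
    using exact_step_nonexpansive[of \<zeta>0 \<zeta>] inexact_step_dist[OF assms] by (simp add: algebra_simps)
qed

text \<open>For small \<open>\<sigma>\<close> the distance to the exact solution is comparable to the length of the step that
  is made, so the error can be absorbed by the decrease in value.\<close>

lemma inexact_step_relative:
  assumes st: "inexact_step \<zeta>0 \<sigma> \<zeta> v" and s: "sqrt \<sigma> \<le> 1 / 20"
  shows "norm (resid \<zeta>0 \<zeta> v) \<le> 2 * sqrt \<sigma> * Lh * norm (v - \<zeta>)"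
proof -
  let ?e = "exact_step \<zeta>0 \<zeta>"
  have s0: "0 \<le> sqrt \<sigma>" using st by (simp add: inexact_step_def)
  have "norm (\<zeta> - ?e) \<le> norm (v - \<zeta>) + norm (v - ?e)"
    using norm_triangle_ineq4[of "v - ?e" "v - \<zeta>"] by simp
  moreover have "sqrt \<sigma> * norm (\<zeta> - ?e) \<le> 1 / 20 * norm (\<zeta> - ?e)" using s by (rule mult_right_mono) simp
  ultimately have "norm (\<zeta> - ?e) \<le> 2 * norm (v - \<zeta>)" using inexact_step_dist[OF st] norm_ge_zero[of "v - \<zeta>"] by linarith
  then have "sqrt \<sigma> * Lh * norm (\<zeta> - ?e) \<le> sqrt \<sigma> * Lh * (2 * norm (v - \<zeta>))"
    using s0 Lh_pos by (intro mult_left_mono) auto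
  then show ?thesis using inexact_step_resid[OF st] by simp
qed

lemma inexact_step_descent:
  assumes st: "inexact_step \<zeta>0 \<sigma> \<zeta> v" and s: "sqrt \<sigma> \<le> 1 / 20"
  shows "prox_obj f L \<zeta>0 v \<le> prox_obj f L \<zeta>0 \<zeta> - Lh / 4 * (norm (v - \<zeta>))\<^sup>2"
proof -
  have "- inner (resid \<zeta>0 \<zeta> v) (\<zeta> - v) \<le> norm (resid \<zeta>0 \<zeta> v) * norm (v - \<zeta>)"
    using norm_cauchy_schwarz[of "resid \<zeta>0 \<zeta> v" "v - \<zeta>"] by (simp add: inner_diff_right)
  also have "\<dots> \<le> 2 * sqrt \<sigma> * Lh * norm (v - \<zeta>) * norm (v - \<zeta>)"
    using inexact_step_relative[OF assms] by (rule mult_right_mono) simp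
  also have "\<dots> = sqrt \<sigma> * (2 * Lh * (norm (v - \<zeta>))\<^sup>2)" by (simp add: power2_eq_square)
  also have "\<dots> \<le> 1 / 20 * (2 * Lh * (norm (v - \<zeta>))\<^sup>2)"
    using s Lh_pos by (intro mult_right_mono) auto
  finally have "- inner (resid \<zeta>0 \<zeta> v) (\<zeta> - v) \<le> 1 / 10 * (Lh * (norm (v - \<zeta>))\<^sup>2)" by simp
  moreover have "0 \<le> L / 2 * (norm (v - \<zeta>))\<^sup>2" "0 \<le> Lh * (norm (v - \<zeta>))\<^sup>2" using L_pos Lh_pos by auto
  ultimately show ?thesis
    using prox_step_inequality[of \<zeta>0 v \<zeta> \<zeta>] by (simp add: norm_minus_commute[of \<zeta> v])
qed

lemma inexact_step_fejer:
  assumes st: "inexact_step \<zeta>0 \<sigma> \<zeta> v" and s: "sqrt \<sigma> \<le> 1 / 20"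
  shows "prox_obj f L \<zeta>0 v - prox_obj f L \<zeta>0 u
    \<le> Lh / 2 * ((norm (\<zeta> - u))\<^sup>2 - (norm (v - u))\<^sup>2) + 2 * sqrt \<sigma> * Lh * norm (v - \<zeta>) * norm (v - u)"
proof -
  have "- inner (resid \<zeta>0 \<zeta> v) (u - v) \<le> norm (resid \<zeta>0 \<zeta> v) * norm (v - u)"
    using norm_cauchy_schwarz[of "resid \<zeta>0 \<zeta> v" "v - u"] by (simp add: inner_diff_right)
  also have "\<dots> \<le> 2 * sqrt \<sigma> * Lh * norm (v - \<zeta>) * norm (v - u)"
    using inexact_step_relative[OF assms] by (rule mult_right_mono) simp
  finally have "- inner (resid \<zeta>0 \<zeta> v) (u - v) \<le> 2 * sqrt \<sigma> * Lh * norm (v - \<zeta>) * norm (v - u)" .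
  moreover have "0 \<le> L / 2 * (norm (u - v))\<^sup>2" using L_pos by auto
  ultimately show ?thesis
    using prox_step_inequality[of \<zeta>0 v u \<zeta>] by (simp add: norm_minus_commute[of u])
qed

lemma inexact_step_grad:
  assumes st: "inexact_step \<zeta>0 \<sigma> \<zeta> v" and s: "sqrt \<sigma> \<le> 1 / 20"
  shows "norm (grad (prox_obj f L \<zeta>0) v) \<le> 3 * Lh * norm (v - \<zeta>)"
proof -
  have "grad (prox_obj f L \<zeta>0) v = (grad h v - grad h \<zeta>) + (resid \<zeta>0 \<zeta> v - Lh *\<^sub>R (v - \<zeta>))"
    unfolding grad_prox grad_f resid_def gmco_lin_def by (simp add: algebra_simps)
  also have "norm \<dots> \<le> norm (grad h v - grad h \<zeta>) + (norm (resid \<zeta>0 \<zeta> v) + norm (Lh *\<^sub>R (v - \<zeta>)))"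
    by (intro order_trans[OF norm_triangle_ineq] add_left_mono norm_triangle_ineq4)
  also have "\<dots> \<le> Lh * norm (v - \<zeta>) + (2 * sqrt \<sigma> * Lh * norm (v - \<zeta>) + Lh * norm (v - \<zeta>))"
    using smooth_fun_lipschitz[OF smooth_h] inexact_step_relative[OF assms] Lh_pos
    by (intro add_mono) auto
  also have "\<dots> \<le> 3 * Lh * norm (v - \<zeta>)"
  proof -
    have "sqrt \<sigma> * (2 * Lh * norm (v - \<zeta>)) \<le> 1 / 20 * (2 * Lh * norm (v - \<zeta>))"
      using s Lh_pos by (intro mult_right_mono) auto
    moreover have "0 \<le> Lh * norm (v - \<zeta>)" using Lh_pos by simp
    ultimately show ?thesis by simp
  qed
  finally show ?thesis .
qed

section \<open>Termination of GMCO\<close>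

lemma small_block_errors:
  assumes st: "\<And>j. j < m \<Longrightarrow> inexact_step \<zeta>0 (\<sigma> j) (x j) (x (Suc j))"
    and small: "(\<Sum>j<m. \<sigma> j) \<le> 1 / 400"
    and j: "j < m"
  shows "0 \<le> \<sigma> j" "sqrt (\<sigma> j) \<le> 1 / 20"
proof -
  have nn: "0 \<le> \<sigma> i" if "i < m" for i using st[OF that] by (simp add: inexact_step_def)
  show "0 \<le> \<sigma> j" using nn[OF j] .
  have "\<sigma> j \<le> (\<Sum>j<m. \<sigma> j)" using nn j by (intro member_le_sum) auto
  then have "\<sigma> j \<le> (1 / 20)\<^sup>2" using small by (simp add: power2_eq_square)
  then show "sqrt (\<sigma> j) \<le> 1 / 20" by (rule real_le_lsqrt[rotated -1]) auto
qed

text \<open>A block of steps is an instance of the abstract recursion. Its sequences are continued after the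
  end of the block by the minimizer itself, where all quantities are nonnegative or zero.\<close>

lemma block_bounds:
  assumes st: "\<And>j. j < m \<Longrightarrow> inexact_step \<zeta>0 (\<sigma> j) (x j) (x (Suc j))"
    and small: "(\<Sum>j<m. \<sigma> j) \<le> 1 / 400"
  shows "norm (x m - prox_center \<zeta>0) \<le> 2 * norm (x 0 - prox_center \<zeta>0)"
    and "real m * (prox_obj f L \<zeta>0 (x m) - prox_obj f L \<zeta>0 (prox_center \<zeta>0))
           \<le> 2 * Lh * (norm (x 0 - prox_center \<zeta>0))\<^sup>2"
proof -
  let ?c = "prox_center \<zeta>0"
  define x' where "x' j = (if j \<le> m then x j else ?c)" for j
  define r where "r j = norm (x' j - ?c)" for j
  define d where "d j = (if j < m then norm (x (Suc j) - x j) else 0)" for j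
  define \<Delta> where "\<Delta> j = prox_obj f L \<zeta>0 (x' j) - prox_obj f L \<zeta>0 ?c" for j
  define s where "s j = (if j < m then sqrt (\<sigma> j) else 0)" for j
  have hyp: "0 \<le> \<sigma> j" "sqrt (\<sigma> j) \<le> 1 / 20" if "j < m" for j
    using small_block_errors[OF st small that] by auto
  have "r 1 \<le> 11 / 10 * r 0"
  proof (cases "m = 0")
    case True then show ?thesis by (simp add: r_def x'_def)
  next
    case False
    then have "r 1 \<le> (1 + 2 * sqrt (\<sigma> 0)) * r 0"
      using inexact_step_growth[OF st[of 0]] by (simp add: r_def x'_def)
    also have "\<dots> \<le> 11 / 10 * r 0"
      using hyp(2)[of 0] False by (intro mult_right_mono) (auto simp: r_def)
    finally show ?thesis .
  qed
  moreover have "(\<Sum>j<m. (s j)\<^sup>2) = (\<Sum>j<m. \<sigma> j)"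
    using hyp(1) by (intro sum.cong) (auto simp: s_def)
  moreover have "0 \<le> \<Delta> j" for j
  proof -
    have "0 \<le> L / 2 * (norm (x' j - ?c))\<^sup>2" using L_pos by simp
    then show ?thesis using prox_growth[of "x' j" \<zeta>0] unfolding \<Delta>_def by linarith
  qed
  moreover have "\<Delta> (Suc j) \<le> \<Delta> j - Lh / 4 * (d j)\<^sup>2" if "j < m" for j
    using inexact_step_descent[OF st hyp(2), OF that that] that by (simp add: \<Delta>_def d_def x'_def)
  moreover have "\<Delta> (Suc j) \<le> Lh / 2 * ((r j)\<^sup>2 - (r (Suc j))\<^sup>2) + 2 * s j * Lh * d j * r (Suc j)"
    if "j < m" for j
    using inexact_step_fejer[OF st hyp(2), OF that that, of ?c] that
    by (simp add: \<Delta>_def d_def x'_def r_def s_def)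
  moreover have "d j \<le> r j + r (Suc j)" if "j < m" for j
    using norm_triangle_ineq4[of "x (Suc j) - ?c" "x j - ?c"] that by (simp add: d_def x'_def r_def)
  moreover have "0 \<le> r j" "0 \<le> d j" "0 \<le> s j" for j
    using hyp(1) by (auto simp: r_def d_def s_def)
  ultimately have "r m \<le> 2 * r 0" "real m * \<Delta> m \<le> 2 * Lh * (r 0)\<^sup>2"
    using relative_error_bounds[OF Lh_pos, of r \<Delta> d s m] small by auto
  then show "norm (x m - ?c) \<le> 2 * norm (x 0 - ?c)"
    "real m * (prox_obj f L \<zeta>0 (x m) - prox_obj f L \<zeta>0 ?c) \<le> 2 * Lh * (norm (x 0 - ?c))\<^sup>2"
    by (auto simp: r_def \<Delta>_def x'_def)
qed

text \<open>A block of \<open>2 * n\<close> steps with \<open>n\<close> of order \<open>Lh / L\<close> and small total error brings the iterate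
  closer to the minimizer by a constant factor and contains a point with a small gradient. There
  is no logarithm of \<open>Lh / L\<close> in the length, since the sublinear rate is used and the gap in value
  is turned into a distance only once. The constant \<open>300\<close> makes the gradient bound \<open>9 * Lh / n\<close> at
  most \<open>L / 30\<close>.\<close>

lemma block_decrease:
  assumes n: "300 * Lh / L \<le> real n"
    and st: "\<And>j. j < 2 * n \<Longrightarrow> inexact_step \<zeta>0 (\<sigma> j) (x j) (x (Suc j))"
    and small: "(\<Sum>j<2 * n. \<sigma> j) \<le> 1 / 400"
  shows "norm (x (2 * n) - prox_center \<zeta>0) \<le> 1 / 3 * norm (x 0 - prox_center \<zeta>0)"
    and "\<exists>j. 1 \<le> j \<and> j \<le> 2 * n
           \<and> norm (grad (prox_obj f L \<zeta>0) (x j)) \<le> L / 30 * norm (x 0 - prox_center \<zeta>0)"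
proof -
  let ?c = "prox_center \<zeta>0"
  let ?\<rho> = "norm (x 0 - ?c)"
  have "0 < 300 * Lh / L" using Lh_pos L_pos by simp
  then have n0: "0 < real n" using n by linarith
  have Ln: "300 * Lh \<le> L * real n" using n L_pos by (simp add: field_simps)
  have "L / 2 * (norm (x (2 * n) - ?c))\<^sup>2 \<le> prox_obj f L \<zeta>0 (x (2 * n)) - prox_obj f L \<zeta>0 ?c"
    by (rule prox_growth)
  then have "real (2 * n) * (L / 2 * (norm (x (2 * n) - ?c))\<^sup>2) \<le> 2 * Lh * ?\<rho>\<^sup>2"
    using block_bounds(2)[OF st small] 
    by (smt (verit) mult_left_mono of_nat_0_le_iff)
  then have "L * real n * (norm (x (2 * n) - ?c))\<^sup>2 \<le> 2 * Lh * ?\<rho>\<^sup>2" by (simp add: mult_ac)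
  moreover have "300 * Lh * (norm (x (2 * n) - ?c))\<^sup>2 \<le> L * real n * (norm (x (2 * n) - ?c))\<^sup>2"
    using Ln by (intro mult_right_mono) auto
  ultimately have "Lh * (300 * (norm (x (2 * n) - ?c))\<^sup>2) \<le> Lh * (2 * ?\<rho>\<^sup>2)" by simp
  then have "300 * (norm (x (2 * n) - ?c))\<^sup>2 \<le> 2 * ?\<rho>\<^sup>2" using Lh_pos by simp
  moreover have "(1 / 3 * ?\<rho>)\<^sup>2 = ?\<rho>\<^sup>2 / 9" by (simp add: power2_eq_square)
  ultimately have "(norm (x (2 * n) - ?c))\<^sup>2 \<le> (1 / 3 * ?\<rho>)\<^sup>2"
    using zero_le_power2[of ?\<rho>] by linarith
  then show "norm (x (2 * n) - ?c) \<le> 1 / 3 * ?\<rho>" by (rule power2_le_imp_le) simp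
  define d where "d j = norm (x (Suc j) - x j)" for j
  define \<Delta> where "\<Delta> j = prox_obj f L \<zeta>0 (x j) - prox_obj f L \<zeta>0 ?c" for j
  have hyp: "0 \<le> \<sigma> j" "sqrt (\<sigma> j) \<le> 1 / 20" if "j < 2 * n" for j
    using small_block_errors[OF st small that] by auto
  have half: "(\<Sum>j<n. \<sigma> j) \<le> 1 / 400"
  proof -
    have "(\<Sum>j<n. \<sigma> j) \<le> (\<Sum>j<2 * n. \<sigma> j)" using hyp(1) by (intro sum_mono2) auto
    then show ?thesis using small by simp
  qed
  have nn: "0 \<le> \<Delta> j" for j
  proof -
    have "0 \<le> L / 2 * (norm (x j - ?c))\<^sup>2" using L_pos by simp
    then show ?thesis using prox_growth[of "x j" \<zeta>0] unfolding \<Delta>_def by linarith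
  qed
  have "\<exists>j<2 * n. real n * d j \<le> 3 * ?\<rho>"
  proof (rule relative_error_short_step[OF Lh_pos, of n \<Delta> d ?\<rho>])
    show "\<Delta> (Suc j) \<le> \<Delta> j - Lh / 4 * (d j)\<^sup>2" if "j < 2 * n" for j
      using inexact_step_descent[OF st hyp(2), OF that that] by (simp add: \<Delta>_def d_def)
    show "real n * \<Delta> n \<le> 2 * Lh * ?\<rho>\<^sup>2"
      unfolding \<Delta>_def by (rule block_bounds(2)[OF st half]) auto
  qed (use n0 nn in \<open>auto simp: d_def\<close>)
  then obtain j where j: "j < 2 * n" "real n * d j \<le> 3 * ?\<rho>" by blast
  have "norm (grad (prox_obj f L \<zeta>0) (x (Suc j))) \<le> 3 * Lh * d j"
    unfolding d_def by (rule inexact_step_grad[OF st hyp(2)]) (use j in auto)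
  also have "\<dots> \<le> L / 100 * (real n * d j)"
  proof -
    have "3 * Lh * d j \<le> L / 100 * real n * d j" using Ln by (intro mult_right_mono) (auto simp: d_def)
    then show ?thesis by simp
  qed
  also have "\<dots> \<le> L / 100 * (3 * ?\<rho>)" using j L_pos by (intro mult_left_mono) auto
  also have "\<dots> \<le> L / 30 * ?\<rho>" using L_pos by simp
  finally show "\<exists>j. 1 \<le> j \<and> j \<le> 2 * n \<and> norm (grad (prox_obj f L \<zeta>0) (x j)) \<le> L / 30 * ?\<rho>"
    using j by (intro exI[of _ "Suc j"]) auto
qed

text \<open>A small gradient forces \<open>v\<close> to be close to the minimizer. If the test fails nevertheless, then
  \<open>v\<close> is also close to \<open>\<zeta>0\<close>, so \<open>\<zeta>0\<close> is close to the minimizer on the scale of \<open>\<rho>\<close>.\<close>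

lemma small_grad_far_start:
  assumes small: "norm (grad (prox_obj f L \<zeta>0) v) \<le> L / 30 * \<rho>"
    and "\<not> gmco_stop f L \<zeta>0 v"
  shows "10 * norm (\<zeta>0 - prox_center \<zeta>0) < \<rho>"
proof -
  let ?c = "prox_center \<zeta>0"
  have "L * norm (v - ?c) \<le> L * (\<rho> / 30)" using order_trans[OF dist_prox_center small] by simp
  then have 1: "norm (v - ?c) \<le> \<rho> / 30" using L_pos by simp
  have "L / 2 * norm (v - \<zeta>0) < L / 30 * \<rho>" using assms unfolding gmco_stop_def by linarith
  then have "L * norm (v - \<zeta>0) < L * (\<rho> / 15)" by simp
  then have "norm (v - \<zeta>0) < \<rho> / 15" using L_pos by (rule mult_left_less_imp_less[OF _ less_imp_le])
  moreover have "norm (\<zeta>0 - ?c) \<le> norm (v - ?c) + norm (v - \<zeta>0)"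
    using norm_triangle_ineq4[of "v - ?c" "v - \<zeta>0"] by simp
  ultimately show ?thesis using 1 by simp
qed

text \<open>A run of GMCO can last longer than one block only at the expense of errors. The number \<open>u\<close>
  bounds the logarithm of the distance to the minimizer on the scale of the initial distance.
  A block with small total error makes the test succeed unless \<open>u \<ge> 1\<close>, and then decreases \<open>u\<close> by
  \<open>1\<close>, which pays for the block. Otherwise the steps until the total error exceeds \<open>1 / 400\<close> are cut
  off; they number at most \<open>2 * n\<close>, and the last of them, of error \<open>\<sigma>\<close>, increases \<open>u\<close> by at most
  \<open>2 + \<sigma>\<close>. This is paid for by the error that is consumed, at the price \<open>1201 = 3 * 400 + 1\<close> per
  unit.\<close>

lemma running_gmco_length:
  assumes n: "300 * Lh / L \<le> real n"
    and "\<And>j. j < J \<Longrightarrow> inexact_step \<zeta>0 (\<sigma> j) (x j) (x (Suc j))"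
    and "\<And>j. 1 \<le> j \<Longrightarrow> j < J \<Longrightarrow> \<not> gmco_stop f L \<zeta>0 (x j)"
    and "norm (x 0 - prox_center \<zeta>0) \<le> 3 * norm (\<zeta>0 - prox_center \<zeta>0) * exp u" and "0 \<le> u"
  shows "real J \<le> real (2 * n) * (1 + 1201 * (\<Sum>j<J. \<sigma> j) + u)"
  using assms(2-)
proof (induction J arbitrary: x \<sigma> u rule: less_induct)
  case (less J)
  let ?c = "prox_center \<zeta>0"
  let ?D = "norm (\<zeta>0 - ?c)"
  let ?K = "2 * n"
  note st = less.prems(1) and run = less.prems(2) and start = less.prems(3) and u = less.prems(4)
  have "0 < 300 * Lh / L" using Lh_pos L_pos by simp
  then have n0: "0 < n" using n by (metis of_nat_0_less_iff less_le_trans)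
  have \<sigma>: "0 \<le> \<sigma> j" if "j < J" for j using st[OF that] by (simp add: inexact_step_def)
  have sum_nn: "0 \<le> (\<Sum>j<J. \<sigma> j)" using \<sigma> by (intro sum_nonneg) auto
  have split: "(\<Sum>j<J. \<sigma> j) = (\<Sum>j<k. \<sigma> j) + (\<Sum>j<J - k. \<sigma> (k + j))" if "k \<le> J" for k
  proof -
    have "(\<Sum>j<J. \<sigma> j) = (\<Sum>j\<in>{..<k} \<union> {k..<J}. \<sigma> j)" using that by (intro sum.cong) auto
    also have "\<dots> = (\<Sum>j<k. \<sigma> j) + (\<Sum>j\<in>{k..<J}. \<sigma> j)" by (intro sum.union_disjoint) auto
    also have "(\<Sum>j\<in>{k..<J}. \<sigma> j) = (\<Sum>j<J - k. \<sigma> (k + j))"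
      by (rule sum.reindex_bij_witness[of _ "\<lambda>j. k + j" "\<lambda>j. j - k"]) (use that in auto)
    finally show ?thesis .
  qed
  have rest: "real (J - k) \<le> real ?K * (1 + 1201 * (\<Sum>j<J - k. \<sigma> (k + j)) + u')"
    if "1 \<le> k" "k \<le> J" "0 < J" "norm (x k - ?c) \<le> 3 * ?D * exp u'" "0 \<le> u'" for k u'
  proof (rule less.IH)
    show "inexact_step \<zeta>0 (\<sigma> (k + j)) (x (k + j)) (x (k + Suc j))" if "j < J - k" for j
      using st[of "k + j"] that by simp
    show "\<not> gmco_stop f L \<zeta>0 (x (k + j))" if "1 \<le> j" "j < J - k" for j
      using run[of "k + j"] that \<open>1 \<le> k\<close> by simp
  qed (use that in auto)
  show ?case
  proof (cases "J \<le> ?K")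
    case True
    then have "real J \<le> real ?K * 1" by simp
    also have "\<dots> \<le> real ?K * (1 + 1201 * (\<Sum>j<J. \<sigma> j) + u)"
      using sum_nn u by (intro mult_left_mono) auto
    finally show ?thesis .
  next
    case False
    show ?thesis
    proof (cases "(\<Sum>j<?K. \<sigma> j) \<le> 1 / 400")
      case True
      have st': "inexact_step \<zeta>0 (\<sigma> j) (x j) (x (Suc j))" if "j < ?K" for j
        using st[of j] that False by simp
      note dec = block_decrease[OF n st' True]
      obtain j where j: "1 \<le> j" "j \<le> ?K" "norm (grad (prox_obj f L \<zeta>0) (x j)) \<le> L / 30 * norm (x 0 - ?c)"
        using dec(2) by blast
      have far: "10 * ?D < norm (x 0 - ?c)"
        using small_grad_far_start[OF j(3)] run[of j] j False by auto
      have u1: "1 \<le> u"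
      proof (rule ccontr)
        assume "\<not> 1 \<le> u"
        then have "exp u \<le> exp (1::real)" by simp
        also have "\<dots> \<le> 3" by (rule exp_le)
        finally have "3 * ?D * exp u \<le> 3 * ?D * 3" by (intro mult_left_mono) auto
        then show False using far start norm_ge_zero[of "\<zeta>0 - ?c"] by linarith
      qed
      have "norm (x ?K - ?c) \<le> 3 * ?D * exp (u - 1)"
      proof -
        have "exp u = exp (u - 1) * exp 1" by (simp add: exp_add[symmetric])
        also have "\<dots> \<le> exp (u - 1) * 3" by (intro mult_left_mono exp_le) auto
        finally have "3 * ?D * exp u \<le> 3 * ?D * (exp (u - 1) * 3)" by (intro mult_left_mono) auto
        then show ?thesis using dec(1) start by linarith
      qed
      then have "real (J - ?K) \<le> real ?K * (1 + 1201 * (\<Sum>j<J - ?K. \<sigma> (?K + j)) + (u - 1))"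
        using False n0 u1 by (intro rest) auto
      moreover have "(\<Sum>j<J - ?K. \<sigma> (?K + j)) \<le> (\<Sum>j<J. \<sigma> j)"
        using split[of ?K] False \<sigma> sum_nonneg[of "{..<?K}" \<sigma>] by force
      then have "real ?K * (1 + 1201 * (\<Sum>j<J - ?K. \<sigma> (?K + j)) + (u - 1))
          \<le> real ?K * (1 + 1201 * (\<Sum>j<J. \<sigma> j) + (u - 1))"
        by (intro mult_left_mono) auto
      ultimately have le: "real (J - ?K) \<le> real ?K * (1 + 1201 * (\<Sum>j<J. \<sigma> j) + (u - 1))"
        by (rule order_trans)
      have e: "a * (1 + b + u) = a * (1 + b + (u - 1)) + a" for a b :: real
        by (simp add: algebra_simps)
      have "real J = real (J - ?K) + real ?K" using False by simp
      also have "\<dots> \<le> real ?K * (1 + 1201 * (\<Sum>j<J. \<sigma> j) + (u - 1)) + real ?K"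
        using le by (rule add_right_mono)
      finally show ?thesis unfolding e .
    next
      case big: False
      define k where "k = (LEAST k. \<not> (\<Sum>j<k. \<sigma> j) \<le> 1 / 400)"
      have k: "\<not> (\<Sum>j<k. \<sigma> j) \<le> 1 / 400" unfolding k_def by (rule LeastI[of _ ?K]) (rule big)
      have kK: "k \<le> ?K" unfolding k_def by (rule Least_le) (rule big)
      have "k \<noteq> 0" using k by (cases k) auto
      then obtain i where i: "k = Suc i" using not0_implies_Suc by blast
      have "(\<Sum>j<i. \<sigma> j) \<le> 1 / 400"
        using not_less_Least[of i "\<lambda>k. \<not> (\<Sum>j<k. \<sigma> j) \<le> 1 / 400"] i unfolding k_def by simp
      then have xi: "norm (x i - ?c) \<le> 2 * norm (x 0 - ?c)"
        using st kK i False by (intro block_bounds(1)[of i \<zeta>0 \<sigma> x]) auto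
      have \<sigma>i: "0 \<le> \<sigma> i" using \<sigma> kK i False by simp
      let ?u = "u + 1 + 2 * sqrt (\<sigma> i)"
      have "norm (x k - ?c) \<le> (1 + 2 * sqrt (\<sigma> i)) * norm (x i - ?c)"
        unfolding i by (rule inexact_step_growth[OF st]) (use kK i False in auto)
      also have "\<dots> \<le> (1 + 2 * sqrt (\<sigma> i)) * (2 * norm (x 0 - ?c))"
        using xi \<sigma>i by (intro mult_left_mono) auto
      also have "\<dots> \<le> (1 + 2 * sqrt (\<sigma> i)) * (2 * (3 * ?D * exp u))"
        using start \<sigma>i by (intro mult_left_mono) auto
      also have "\<dots> \<le> exp (2 * sqrt (\<sigma> i)) * (exp 1 * (3 * ?D * exp u))"
        using exp_ge_add_one_self[of "2 * sqrt (\<sigma> i)"] exp_ge_add_one_self[of 1] \<sigma>i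
        by (intro mult_mono) (auto intro!: mult_nonneg_nonneg)
      also have "\<dots> = 3 * ?D * exp ?u" by (simp add: exp_add)
      finally have "real (J - k) \<le> real ?K * (1 + 1201 * (\<Sum>j<J - k. \<sigma> (k + j)) + ?u)"
        using kK False n0 u i \<sigma>i by (intro rest) auto
      moreover have "real ?K * (1 + 1201 * (\<Sum>j<J - k. \<sigma> (k + j)) + ?u)
          \<le> real ?K * (1201 * (\<Sum>j<J. \<sigma> j) + u)"
      proof (rule mult_left_mono)
        have "\<sigma> i \<le> (\<Sum>j<k. \<sigma> j)" using \<sigma> kK i False by (intro member_le_sum) auto
        moreover have "2 * sqrt (\<sigma> i) \<le> 1 + \<sigma> i"
          using \<sigma>i sum_squares_bound[of "sqrt (\<sigma> i)" 1] by simp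
        ultimately show "1 + 1201 * (\<Sum>j<J - k. \<sigma> (k + j)) + ?u \<le> 1201 * (\<Sum>j<J. \<sigma> j) + u"
          using k split[of k] kK False by simp
      qed simp
      ultimately have le: "real (J - k) \<le> real ?K * (1201 * (\<Sum>j<J. \<sigma> j) + u)"
        by (rule order_trans)
      have e: "a * (1 + b + u) = a + a * (b + u)" for a b :: real
        by (simp add: algebra_simps)
      have "real J \<le> real ?K + real (J - k)" using kK by simp
      also have "\<dots> \<le> real ?K + real ?K * (1201 * (\<Sum>j<J. \<sigma> j) + u)"
        using le by (rule add_left_mono)
      finally show ?thesis unfolding e .
    qed
  qed
qed

end

section \<open>The cost of the randomized inner calls\<close>

text \<open>Resampling one coordinate of a product measure does not change the measure. So if \<open>X\<close> and \<open>Q\<close>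
  ignore coordinate \<open>i\<close>, then coordinate \<open>i\<close> may be integrated first, with \<open>X\<close> held fixed.\<close>

lemma nn_integral_fresh_coordinate:
  fixes \<Xi> :: "'s measure" and i :: 'i
  defines "P \<equiv> PiM (UNIV :: 'i set) (\<lambda>_. \<Xi>)"
  assumes \<Xi>: "prob_space \<Xi>"
    and X[measurable]: "X \<in> P \<rightarrow>\<^sub>M N" and Q[measurable]: "Measurable.pred P Q"
    and fresh: "\<And>\<omega> s. X (fun_upd \<omega> i s) = X \<omega>" "\<And>\<omega> s. Q (fun_upd \<omega> i s) = Q \<omega>"
    and q[measurable]: "(\<lambda>(s, x). q s x) \<in> borel_measurable (\<Xi> \<Otimes>\<^sub>M N)"
    and le: "\<And>x. (\<integral>\<^sup>+ s. q s x \<partial>\<Xi>) \<le> c"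
  shows "(\<integral>\<^sup>+ \<omega>. indicator {\<omega>. Q \<omega>} \<omega> * q (\<omega> i) (X \<omega>) \<partial>P) \<le> c * (\<integral>\<^sup>+ \<omega>. indicator {\<omega>. Q \<omega>} \<omega> \<partial>P)"
proof -
  interpret \<Xi>: prob_space \<Xi> by fact
  interpret P: prob_space P unfolding P_def by (intro prob_space_PiM \<Xi>)
  interpret pair_sigma_finite \<Xi> P ..
  have upd[measurable]: "(\<lambda>(s, \<omega>). fun_upd \<omega> i s) \<in> \<Xi> \<Otimes>\<^sub>M P \<rightarrow>\<^sub>M P"
    unfolding P_def split_beta' by (rule measurable_fun_upd[of _ UNIV]) auto
  have coord[measurable]: "(\<lambda>\<omega>. \<omega> i) \<in> P \<rightarrow>\<^sub>M \<Xi>" unfolding P_def by simp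
  have distr: "distr (\<Xi> \<Otimes>\<^sub>M P) P (\<lambda>(s, \<omega>). fun_upd \<omega> i s) = P"
    using distr_pair_PiM_eq_PiM[of UNIV "\<lambda>_. \<Xi>" i] \<Xi> unfolding P_def by simp
  have "(\<integral>\<^sup>+ \<omega>. indicator {\<omega>. Q \<omega>} \<omega> * q (\<omega> i) (X \<omega>) \<partial>P)
      = (\<integral>\<^sup>+ \<omega>. indicator {\<omega>. Q \<omega>} \<omega> * q (\<omega> i) (X \<omega>) \<partial>(distr (\<Xi> \<Otimes>\<^sub>M P) P (\<lambda>(s, \<omega>). fun_upd \<omega> i s)))"
    unfolding distr ..
  also have "\<dots> = (\<integral>\<^sup>+ (s, \<omega>). indicator {\<omega>. Q \<omega>} \<omega> * q s (X \<omega>) \<partial>(\<Xi> \<Otimes>\<^sub>M P))"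
    by (subst nn_integral_distr) (auto simp: fresh indicator_def intro!: nn_integral_cong)
  also have "\<dots> = (\<integral>\<^sup>+ \<omega>. (\<integral>\<^sup>+ s. indicator {\<omega>. Q \<omega>} \<omega> * q s (X \<omega>) \<partial>\<Xi>) \<partial>P)"
    by (subst nn_integral_snd[symmetric]) auto
  also have "\<dots> \<le> (\<integral>\<^sup>+ \<omega>. c * indicator {\<omega>. Q \<omega>} \<omega> \<partial>P)"
  proof (rule nn_integral_mono)
    fix \<omega> assume [measurable]: "\<omega> \<in> space P"
    have "(\<integral>\<^sup>+ s. indicator {\<omega>. Q \<omega>} \<omega> * q s (X \<omega>) \<partial>\<Xi>) = indicator {\<omega>. Q \<omega>} \<omega> * (\<integral>\<^sup>+ s. q s (X \<omega>) \<partial>\<Xi>)"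
      by (rule nn_integral_cmult) measurable
    also have "\<dots> \<le> indicator {\<omega>. Q \<omega>} \<omega> * c" by (intro mult_left_mono le) auto
    finally show "(\<integral>\<^sup>+ s. indicator {\<omega>. Q \<omega>} \<omega> * q s (X \<omega>) \<partial>\<Xi>) \<le> c * indicator {\<omega>. Q \<omega>} \<omega>"
      by (simp add: mult.commute)
  qed
  also have "\<dots> = c * (\<integral>\<^sup>+ \<omega>. indicator {\<omega>. Q \<omega>} \<omega> \<partial>P)"
    by (rule nn_integral_cmult) auto
  finally show ?thesis .
qed

text \<open>\<open>X\<close> is the argument of the logarithm in the budget \<open>NM\<close>, and \<open>2 * n\<close> is the length of a block.
  The assumption on the accuracy says that a block of calls has a small expected total error, with
  the price \<open>1201\<close> of errors taken into account.\<close>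

locale randomized_splitting = splitting h g L Lh Lg + \<Xi>: prob_space \<Xi>
  for h g :: "'a::euclidean_space \<Rightarrow> real" and L Lh Lg :: real and \<Xi> :: "'s measure" +
  fixes M :: "('a, 's) rmethod" and \<tau> C0 C X :: real and NM n :: nat and \<delta> :: real
  assumes inner_guarantee: "inner_method \<Xi> g M \<tau> C0 C"
    and C_pos: "0 < C" and \<tau>: "sqrt (L + Lh) < \<tau>" and X_pos: "0 < X"
    and budget: "C0 * \<tau> / sqrt (L + Lh) * ln X \<le> real NM"
    and block: "300 * Lh / L \<le> real n"
    and accuracy: "real (2 * n) * 1201 * (6 * Lg / Lh\<^sup>2 * (C / X)) \<le> \<delta> / 4"
    and \<delta>: "0 < \<delta>" "\<delta> < 1"
begin

abbreviation \<phi> :: "'a \<Rightarrow> 'a \<Rightarrow> real" where "\<phi> \<equiv> inner_obj g (L + Lh)"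
abbreviation vmin :: "'a \<Rightarrow> 'a" where "vmin \<equiv> inner_argmin g (L + Lh)"
abbreviation iter where "iter \<equiv> gmco_iter h g M L Lh NM"

text \<open>The smallest \<open>\<sigma>\<close> that the gap in value certifies. With the conventions of extended nonnegative
  reals it is infinite if the call starts at the exact solution and returns a worse point.\<close>

definition rel_err :: "'s \<Rightarrow> 'a \<Rightarrow> 'a \<Rightarrow> ennreal" where
  "rel_err s \<beta> v = ennreal (6 * Lg / Lh\<^sup>2) *
     (ennreal (\<phi> \<beta> (M (\<phi> \<beta>) v NM s) - \<phi> \<beta> (vmin \<beta>)) / ennreal ((norm (v - vmin \<beta>))\<^sup>2))"

lemma n_pos: "0 < n"
proof -
  have "0 < 300 * Lh / L" using Lh_pos L_pos by simp
  then show ?thesis using block by (metis of_nat_0_less_iff less_le_trans)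
qed

lemma vmin_minimal: "\<phi> \<beta> (vmin \<beta>) \<le> \<phi> \<beta> u"
  by (rule inner_argmin_minimal[OF convex_g smooth_g \<alpha>_pos])

lemma measurable_M[measurable]:
  "(\<lambda>(s, \<beta>, v). M (\<phi> \<beta>) v NM s) \<in> \<Xi> \<Otimes>\<^sub>M (borel \<Otimes>\<^sub>M borel) \<rightarrow>\<^sub>M borel"
  using inner_guarantee \<alpha>_pos \<tau> unfolding inner_method_def by blast

lemma measurable_basics[measurable]:
  "grad h \<in> borel_measurable borel" "grad g \<in> borel_measurable borel"
  "h \<in> borel_measurable borel" "g \<in> borel_measurable borel"
  "vmin \<in> borel_measurable borel"
  using smooth_fun_continuous_grad smooth_h smooth_g smooth_fun_continuous
    continuous_inner_argmin[OF convex_g smooth_g \<alpha>_pos]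
  by (blast intro: borel_measurable_continuous_onI)+

lemma measurable_rel_err[measurable]:
  "(\<lambda>(s, \<beta>, v). rel_err s \<beta> v) \<in> borel_measurable (\<Xi> \<Otimes>\<^sub>M (borel \<Otimes>\<^sub>M borel))"
proof -
  have [measurable]: "(\<lambda>x. M (\<phi> (fst (snd x))) (snd (snd x)) NM (fst x))
      \<in> \<Xi> \<Otimes>\<^sub>M (borel \<Otimes>\<^sub>M borel) \<rightarrow>\<^sub>M borel"
    using measurable_M unfolding split_beta' .
  have [measurable]: "(\<lambda>x. \<phi> (fst x) (snd x)) \<in> borel_measurable (borel \<Otimes>\<^sub>M borel)"
    unfolding inner_obj_def by measurable
  have "(\<lambda>x. \<phi> (fst (snd x)) (M (\<phi> (fst (snd x))) (snd (snd x)) NM (fst x)))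
      \<in> borel_measurable (\<Xi> \<Otimes>\<^sub>M (borel \<Otimes>\<^sub>M borel))"
    unfolding inner_obj_def[of g "L + Lh" "fst (snd x)" "M y z NM u" for x y z u] by measurable
  moreover have "(\<lambda>x. \<phi> (fst (snd x)) (vmin (fst (snd x))))
      \<in> borel_measurable (\<Xi> \<Otimes>\<^sub>M (borel \<Otimes>\<^sub>M borel))"
    unfolding inner_obj_def[of g "L + Lh" "fst (snd x)" "vmin y" for x y] by measurable
  ultimately show ?thesis
    unfolding rel_err_def split_beta' by measurable
qed

text \<open>If the call starts at the solution, every accuracy is guaranteed, so the gap vanishes almost
  surely. Otherwise the accuracy \<open>e\<close> is chosen such that the logarithm in the guarantee is \<open>ln X\<close>.\<close>

lemma rel_err_expectation:
  "(\<integral>\<^sup>+ s. rel_err s \<beta> v \<partial>\<Xi>) \<le> ennreal (6 * Lg / Lh\<^sup>2 * (C / X))"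
proof -
  let ?gap = "\<lambda>s. \<phi> \<beta> (M (\<phi> \<beta>) v NM s) - \<phi> \<beta> (vmin \<beta>)"
  let ?D = "(norm (v - vmin \<beta>))\<^sup>2"
  have [measurable]: "(\<lambda>s. M (\<phi> \<beta>) v NM s) \<in> \<Xi> \<rightarrow>\<^sub>M borel"
  proof -
    have "(\<lambda>s. (\<lambda>(s, \<beta>, v). M (\<phi> \<beta>) v NM s) (s, \<beta>, v)) \<in> \<Xi> \<rightarrow>\<^sub>M borel" by measurable
    then show ?thesis by simp
  qed
  have gap[measurable]: "?gap \<in> borel_measurable \<Xi>" unfolding inner_obj_def[of g _ _ "M y z NM u" for y z u] by measurable
  have guarantee: "(\<integral>\<^sup>+ s. ennreal (?gap s) \<partial>\<Xi>) \<le> ennreal e"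
    if "0 < e" "C0 * \<tau> / sqrt (L + Lh) * ln (C * ?D / e) \<le> real NM" for e
    using inner_guarantee that \<alpha>_pos \<tau> vmin_minimal[of \<beta>] unfolding inner_method_def is_arg_min_linorder by blast
  have "(\<integral>\<^sup>+ s. ennreal (?gap s) / ennreal ?D \<partial>\<Xi>) \<le> ennreal (C / X)"
  proof (cases "v = vmin \<beta>")
    case True
    have "(\<integral>\<^sup>+ s. ennreal (?gap s) \<partial>\<Xi>) \<le> ennreal e" if "0 < e" for e
      using guarantee[OF that] True by simp
    then have "(\<integral>\<^sup>+ s. ennreal (?gap s) \<partial>\<Xi>) \<le> 0 + ennreal e" if "0 < e" for e
      using that by simp
    then have "(\<integral>\<^sup>+ s. ennreal (?gap s) \<partial>\<Xi>) \<le> 0" by (rule ennreal_le_epsilon)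
    then have "(\<integral>\<^sup>+ s. ennreal (?gap s) \<partial>\<Xi>) = 0" by (rule le_zero_eq[THEN iffD1])
    then have "AE s in \<Xi>. ennreal (?gap s) = 0" by (subst (asm) nn_integral_0_iff_AE) auto
    then have "(\<integral>\<^sup>+ s. ennreal (?gap s) / ennreal ?D \<partial>\<Xi>) = 0"
      by (subst nn_integral_0_iff_AE) (auto elim: eventually_mono)
    then show ?thesis by simp
  next
    case False
    then have D: "0 < ?D" by simp
    define e where "e = C * ?D / X"
    have e: "0 < e" using C_pos X_pos D by (simp add: e_def)
    have "C * ?D / e = X" using C_pos X_pos D by (simp add: e_def)
    then have "(\<integral>\<^sup>+ s. ennreal (?gap s) \<partial>\<Xi>) \<le> ennreal e" using guarantee[OF e] budget by simp
    then have "(\<integral>\<^sup>+ s. ennreal (?gap s) / ennreal ?D \<partial>\<Xi>) \<le> ennreal e / ennreal ?D"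
      by (subst nn_integral_divide) (auto intro: divide_right_mono_ennreal)
    also have "\<dots> = ennreal (C / X)" using D e by (simp add: divide_ennreal e_def)
    finally show ?thesis .
  qed
  then have "ennreal (6 * Lg / Lh\<^sup>2) * (\<integral>\<^sup>+ s. ennreal (?gap s) / ennreal ?D \<partial>\<Xi>)
     \<le> ennreal (6 * Lg / Lh\<^sup>2) * ennreal (C / X)" by (rule mult_left_mono) simp
  also have "\<dots> = ennreal (6 * Lg / Lh\<^sup>2 * (C / X))"
    using Lg_pos C_pos X_pos by (intro ennreal_mult[symmetric]) auto
  finally show ?thesis unfolding rel_err_def by (subst nn_integral_cmult) auto
qed

lemma rel_err_inexact_step:
  assumes "rel_err s (gmco_lin h L Lh \<zeta>0 \<zeta>) \<zeta> < \<top>"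
  shows "inexact_step \<zeta>0 (enn2real (rel_err s (gmco_lin h L Lh \<zeta>0 \<zeta>) \<zeta>)) \<zeta>
           (M (\<phi> (gmco_lin h L Lh \<zeta>0 \<zeta>)) \<zeta> NM s)"
proof -
  define \<beta> where "\<beta> = gmco_lin h L Lh \<zeta>0 \<zeta>"
  define v where "v = M (\<phi> \<beta>) \<zeta> NM s"
  define gap where "gap = \<phi> \<beta> v - \<phi> \<beta> (vmin \<beta>)"
  define D where "D = (norm (\<zeta> - vmin \<beta>))\<^sup>2"
  have gap0: "0 \<le> gap" using vmin_minimal by (simp add: gap_def)
  have k: "0 < 6 * Lg / Lh\<^sup>2" using Lg_pos Lh_pos by simp
  have err: "rel_err s \<beta> \<zeta> = ennreal (6 * Lg / Lh\<^sup>2) * (ennreal gap / ennreal D)"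
    unfolding rel_err_def gap_def D_def v_def ..
  have "(norm (resid \<zeta>0 \<zeta> v))\<^sup>2 \<le> 2 * (L + Lh + Lg) * gap"
  proof -
    have "resid \<zeta>0 \<zeta> v = grad (\<phi> \<beta>) v"
      using smooth_fun_inner_obj(2)[OF smooth_g] \<alpha>_pos unfolding resid_def \<beta>_def by simp
    then show ?thesis
      using smooth_fun_grad_bound[OF smooth_fun_inner_obj(1)[OF smooth_g], of "L + Lh" "\<beta>" "vmin \<beta>" v]
        \<alpha>_pos Lg_pos vmin_minimal unfolding gap_def by simp
  qed
  also have "\<dots> \<le> 6 * Lg * gap" using L_le Lh_le gap0 by (intro mult_right_mono) auto
  also have "\<dots> \<le> enn2real (rel_err s \<beta> \<zeta>) * Lh\<^sup>2 * D"
  proof (cases "D = 0")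
    case True
    have "gap = 0"
    proof (rule ccontr)
      assume "gap \<noteq> 0"
      then have "ennreal gap / ennreal D = \<top>" using gap0 True by (simp add: ennreal_divide_zero)
      then have "rel_err s \<beta> \<zeta> = \<top>" using Lg_pos Lh_pos unfolding err by (simp add: ennreal_mult_top)
      then show False using assms unfolding \<beta>_def by simp
    qed
    then show ?thesis using True by simp
  next
    case False
    then have D: "0 < D" by (simp add: D_def)
    then have "enn2real (rel_err s \<beta> \<zeta>) = 6 * Lg / Lh\<^sup>2 * (gap / D)"
      unfolding err using gap0 k by (simp add: divide_ennreal enn2real_mult)
    then show ?thesis using D Lh_pos by simp
  qed
  finally show ?thesis
    unfolding inexact_step_def exact_step_def \<beta>_def[symmetric] v_def[symmetric] D_def by simp
qed

section \<open>The number of calls in a GMCO run\<close>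

definition gstop :: "'a \<Rightarrow> (nat \<Rightarrow> 's) \<Rightarrow> nat \<Rightarrow> bool" where
  "gstop \<zeta>0 w k \<longleftrightarrow> 1 \<le> k \<and> gmco_stop f L \<zeta>0 (iter \<zeta>0 w k)"

definition halts :: "'a \<Rightarrow> (nat \<Rightarrow> 's) \<Rightarrow> bool" where
  "halts \<zeta>0 w \<longleftrightarrow> (\<exists>k. gstop \<zeta>0 w k)"

definition len :: "'a \<Rightarrow> (nat \<Rightarrow> 's) \<Rightarrow> nat" where
  "len \<zeta>0 w = (LEAST k. gstop \<zeta>0 w k)"

definition out :: "'a \<Rightarrow> (nat \<Rightarrow> 's) \<Rightarrow> 'a" where
  "out \<zeta>0 w = iter \<zeta>0 w (len \<zeta>0 w)"

definition running :: "'a \<Rightarrow> (nat \<Rightarrow> 's) \<Rightarrow> nat \<Rightarrow> bool" where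
  "running \<zeta>0 w j \<longleftrightarrow> (\<forall>k\<le>j. \<not> gstop \<zeta>0 w k)"

text \<open>The number of inner calls made by a run that is interrupted after \<open>J\<close> calls. Unlike \<open>len\<close>, it is
  meaningful for runs that do not halt, and it is bounded, so that its expectation is finite.\<close>

definition calls :: "nat \<Rightarrow> 'a \<Rightarrow> (nat \<Rightarrow> 's) \<Rightarrow> nat" where
  "calls J \<zeta>0 w = card {j. j < J \<and> running \<zeta>0 w j}"

lemma gmco_eq:
  "gmco h g M L Lh NM \<zeta>0 w = (if halts \<zeta>0 w then Some (out \<zeta>0 w, len \<zeta>0 w) else None)"
  unfolding gmco_def halts_def out_def len_def gstop_def by (simp add: Let_def)

lemma halts_stop: "halts \<zeta>0 w \<Longrightarrow> gmco_stop f L \<zeta>0 (out \<zeta>0 w)"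
  unfolding halts_def out_def len_def using LeastI_ex[of "gstop \<zeta>0 w"] gstop_def by blast

lemma iter_cong: "(\<And>j. j < k \<Longrightarrow> w j = w' j) \<Longrightarrow> iter \<zeta>0 w k = iter \<zeta>0 w' k"
  by (induction k) (auto simp: Let_def)

lemma running_cong: "(\<And>j. j < k \<Longrightarrow> w j = w' j) \<Longrightarrow> running \<zeta>0 w k = running \<zeta>0 w' k"
  unfolding running_def gstop_def
  by (intro all_cong imp_cong refl arg_cong[where f=Not] conj_cong arg_cong[where f="gmco_stop f L \<zeta>0"] iter_cong)
     auto

lemma running_set: "{j. j < J \<and> running \<zeta>0 w j} = {..<calls J \<zeta>0 w}"
proof -
  have "\<exists>m. {j. j < J \<and> running \<zeta>0 w j} = {..<m}"
  proof (induction J)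
    case (Suc J)
    show ?case
    proof (cases "running \<zeta>0 w J")
      case True
      then have "{j. j < Suc J \<and> running \<zeta>0 w j} = {..<Suc J}" by (auto simp: running_def)
      then show ?thesis by blast
    next
      case False
      then have "{j. j < Suc J \<and> running \<zeta>0 w j} = {j. j < J \<and> running \<zeta>0 w j}"
        using less_Suc_eq by auto
      then show ?thesis using Suc by simp
    qed
  qed (auto intro: exI[of _ 0])
  then show ?thesis unfolding calls_def by force
qed

lemma calls_le: "calls J \<zeta>0 w \<le> J"
proof -
  have "{..<calls J \<zeta>0 w} \<subseteq> {..<J}" unfolding running_set[symmetric] by auto
  then show ?thesis by simp
qed

lemma calls_less:
  assumes "calls J \<zeta>0 w < J"
  shows "halts \<zeta>0 w" and "len \<zeta>0 w = calls J \<zeta>0 w"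
proof -
  let ?m = "calls J \<zeta>0 w"
  have "\<not> running \<zeta>0 w ?m" using running_set[of J \<zeta>0 w] assms by blast
  then obtain k where k: "k \<le> ?m" "gstop \<zeta>0 w k" by (auto simp: running_def)
  then show "halts \<zeta>0 w" by (auto simp: halts_def)
  have no: "\<not> gstop \<zeta>0 w j" if "j < ?m" for j
    using running_set[of J \<zeta>0 w] that by (auto simp: running_def)
  show "len \<zeta>0 w = ?m" unfolding len_def
  proof (rule Least_equality)
    show "gstop \<zeta>0 w ?m" using k no by (metis le_neq_implies_less)
    show "?m \<le> j" if "gstop \<zeta>0 w j" for j using no that not_less by blast
  qed
qed

definition err_at :: "'a \<Rightarrow> (nat \<Rightarrow> 's) \<Rightarrow> nat \<Rightarrow> ennreal" where
  "err_at \<zeta>0 w j = rel_err (w j) (gmco_lin h L Lh \<zeta>0 (iter \<zeta>0 w j)) (iter \<zeta>0 w j)"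

text \<open>Only the errors of calls that are made count; this will bound the expected number of calls in
  terms of itself.\<close>

lemma calls_bound:
  "ennreal (real (calls J \<zeta>0 w)) \<le> ennreal (real (2 * n))
     + ennreal (real (2 * n) * 1201) * (\<Sum>j<J. indicator {w. running \<zeta>0 w j} w * err_at \<zeta>0 w j)"
proof -
  let ?m = "calls J \<zeta>0 w"
  let ?s = "\<Sum>j<J. indicator {w. running \<zeta>0 w j} w * err_at \<zeta>0 w j"
  have s: "?s = (\<Sum>j<?m. err_at \<zeta>0 w j)"
  proof -
    have "?s = (\<Sum>j\<in>{..<J}. if running \<zeta>0 w j then err_at \<zeta>0 w j else 0)"
      by (intro sum.cong) (auto simp: indicator_def)
    also have "\<dots> = (\<Sum>j\<in>{j. j < J \<and> running \<zeta>0 w j}. err_at \<zeta>0 w j)"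
      by (subst sum.inter_filter[symmetric]) auto
    finally show ?thesis unfolding running_set .
  qed
  show ?thesis
  proof (cases "\<forall>j<?m. err_at \<zeta>0 w j < \<top>")
    case True
    define \<sigma> where "\<sigma> j = enn2real (err_at \<zeta>0 w j)" for j
    have "real ?m \<le> real (2 * n) * (1 + 1201 * (\<Sum>j<?m. \<sigma> j) + 0)"
    proof (rule running_gmco_length[OF block])
      show "inexact_step \<zeta>0 (\<sigma> j) (iter \<zeta>0 w j) (iter \<zeta>0 w (Suc j))" if "j < ?m" for j
        using rel_err_inexact_step[of "w j" \<zeta>0 "iter \<zeta>0 w j"] True that
        unfolding \<sigma>_def err_at_def by (simp add: Let_def)
      show "\<not> gmco_stop f L \<zeta>0 (iter \<zeta>0 w j)" if "1 \<le> j" "j < ?m" for j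
        using running_set[of J \<zeta>0 w] that by (auto simp: running_def gstop_def)
    qed simp_all
    then have "ennreal (real ?m) \<le> ennreal (real (2 * n) + real (2 * n) * 1201 * (\<Sum>j<?m. \<sigma> j))"
      by (intro ennreal_leI) (simp add: algebra_simps)
    also have "\<dots> = ennreal (real (2 * n)) + ennreal (real (2 * n) * 1201) * ennreal (\<Sum>j<?m. \<sigma> j)"
      by (subst ennreal_plus, simp, simp add: \<sigma>_def sum_nonneg, subst ennreal_mult) (auto simp: \<sigma>_def sum_nonneg)
    also have "ennreal (\<Sum>j<?m. \<sigma> j) = ?s"
      unfolding s using True by (subst sum_ennreal[symmetric]) (auto simp: \<sigma>_def intro!: sum.cong)
    finally show ?thesis .
  next
    case False
    then have top: "?s = \<top>" unfolding s by (subst ennreal_sum_eq_top) (auto simp: less_top[symmetric])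
    show ?thesis unfolding top using n_pos by (simp add: ennreal_mult_top)
  qed
qed

lemma measurable_iter:
  assumes [measurable]: "x \<in> borel_measurable P" "\<And>j. (\<lambda>\<omega>. w \<omega> j) \<in> P \<rightarrow>\<^sub>M \<Xi>"
  shows "(\<lambda>\<omega>. iter (x \<omega>) (w \<omega>) k) \<in> borel_measurable P"
proof (induction k)
  case (Suc k)
  note [measurable] = Suc
  have "(\<lambda>\<omega>. (w \<omega> k, gmco_lin h L Lh (x \<omega>) (iter (x \<omega>) (w \<omega>) k), iter (x \<omega>) (w \<omega>) k))
      \<in> P \<rightarrow>\<^sub>M \<Xi> \<Otimes>\<^sub>M (borel \<Otimes>\<^sub>M borel)"
    unfolding gmco_lin_def by measurable
  from measurable_compose[OF this measurable_M] show ?case by (simp add: Let_def)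
qed (simp add: assms)

lemma measurable_gstop:
  assumes [measurable]: "x \<in> borel_measurable P" "\<And>j. (\<lambda>\<omega>. w \<omega> j) \<in> P \<rightarrow>\<^sub>M \<Xi>"
  shows "Measurable.pred P (\<lambda>\<omega>. gstop (x \<omega>) (w \<omega>) k)"
proof -
  note [measurable] = measurable_iter[OF assms]
  show ?thesis unfolding gstop_def gmco_stop_def grad_prox grad_f by measurable
qed

lemma measurable_gmco:
  assumes [measurable]: "x \<in> borel_measurable P" "\<And>j. (\<lambda>\<omega>. w \<omega> j) \<in> P \<rightarrow>\<^sub>M \<Xi>"
  shows "Measurable.pred P (\<lambda>\<omega>. halts (x \<omega>) (w \<omega>))"
    and "(\<lambda>\<omega>. len (x \<omega>) (w \<omega>)) \<in> P \<rightarrow>\<^sub>M count_space UNIV"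
    and "(\<lambda>\<omega>. out (x \<omega>) (w \<omega>)) \<in> borel_measurable P"
    and "Measurable.pred P (\<lambda>\<omega>. running (x \<omega>) (w \<omega>) j)"
    and "(\<lambda>\<omega>. calls J (x \<omega>) (w \<omega>)) \<in> P \<rightarrow>\<^sub>M count_space UNIV"
proof -
  note [measurable] = measurable_iter[OF assms] measurable_gstop[OF assms]
  show "Measurable.pred P (\<lambda>\<omega>. halts (x \<omega>) (w \<omega>))" unfolding halts_def by measurable
  show len[measurable]: "(\<lambda>\<omega>. len (x \<omega>) (w \<omega>)) \<in> P \<rightarrow>\<^sub>M count_space UNIV"
    unfolding len_def by measurable
  show "(\<lambda>\<omega>. out (x \<omega>) (w \<omega>)) \<in> borel_measurable P"
    unfolding out_def by (rule measurable_compose_countable[OF _ len]) measurable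
  show running[measurable]: "Measurable.pred P (\<lambda>\<omega>. running (x \<omega>) (w \<omega>) j)" for j
    unfolding running_def by measurable
  have "calls J \<zeta>0 w = (\<Sum>j<J. if running \<zeta>0 w j then 1 else 0)" for \<zeta>0 w
    unfolding calls_def by (subst sum.inter_filter[symmetric]) auto
  then show "(\<lambda>\<omega>. calls J (x \<omega>) (w \<omega>)) \<in> P \<rightarrow>\<^sub>M count_space UNIV" by simp
qed

lemma measurable_err_at:
  assumes [measurable]: "x \<in> borel_measurable P" "\<And>j. (\<lambda>\<omega>. w \<omega> j) \<in> P \<rightarrow>\<^sub>M \<Xi>"
  shows "(\<lambda>\<omega>. err_at (x \<omega>) (w \<omega>) j) \<in> borel_measurable P"
proof -
  note [measurable] = measurable_iter[OF assms]
  have "(\<lambda>\<omega>. (w \<omega> j, gmco_lin h L Lh (x \<omega>) (iter (x \<omega>) (w \<omega>) j), iter (x \<omega>) (w \<omega>) j))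
      \<in> P \<rightarrow>\<^sub>M \<Xi> \<Otimes>\<^sub>M (borel \<Otimes>\<^sub>M borel)"
    unfolding gmco_lin_def by measurable
  from measurable_compose[OF this measurable_rel_err] show ?thesis unfolding err_at_def by simp
qed

text \<open>Whether call \<open>j\<close> is made, and with which data, is determined by the start and the earlier seeds.
  So the expected total error is at most \<open>p\<close> times the expected number of calls, where \<open>p\<close> bounds
  the expected error of a single call. With \<open>calls_bound\<close> this gives \<open>z \<le> 2 * n + \<eta> * z\<close> for the
  expected number \<open>z\<close> of calls, where \<open>\<eta> \<le> \<delta> / 4\<close>; hence \<open>z\<close> is at most \<open>4 * n\<close>, and the
  expected excess over \<open>2 * n\<close> is at most \<open>\<eta> * z\<close>.\<close>

lemma excess_calls_expectation:
  fixes \<iota> :: "nat \<Rightarrow> 'i" and x :: "('i \<Rightarrow> 's) \<Rightarrow> 'a"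
  defines "P \<equiv> PiM (UNIV :: 'i set) (\<lambda>_. \<Xi>)"
  assumes inj: "inj \<iota>" and x[measurable]: "x \<in> borel_measurable P"
    and fresh: "\<And>w j s. x (w(\<iota> j := s)) = x w"
  shows "(\<integral>\<^sup>+ \<omega>. ennreal (real (calls J (x \<omega>) (\<lambda>j. \<omega> (\<iota> j)) - 2 * n)) \<partial>P) \<le> ennreal (real n * \<delta>)"
proof -
  interpret P: prob_space P unfolding P_def by (intro prob_space_PiM) unfold_locales
  let ?p = "6 * Lg / Lh\<^sup>2 * (C / X)"
  let ?K = "real (2 * n)"
  define \<eta> where "\<eta> = ?K * 1201 * ?p"
  let ?w = "\<lambda>\<omega> j. \<omega> (\<iota> j)"
  let ?z = "\<lambda>\<omega>. ennreal (real (calls J (x \<omega>) (?w \<omega>)))"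
  let ?e = "\<lambda>\<omega>. \<Sum>j<J. indicator {w. running (x \<omega>) w j} (?w \<omega>) * err_at (x \<omega>) (?w \<omega>) j"
  have coord: "(\<lambda>\<omega>. \<omega> (\<iota> j)) \<in> P \<rightarrow>\<^sub>M \<Xi>" for j unfolding P_def by simp
  note [measurable] = coord measurable_gmco[OF x coord] measurable_err_at[OF x coord]
    measurable_iter[OF x coord]
  have p0: "0 \<le> ?p" using Lg_pos C_pos X_pos by (intro mult_nonneg_nonneg divide_nonneg_nonneg) auto
  have \<eta>0: "0 \<le> \<eta>" unfolding \<eta>_def by (rule mult_nonneg_nonneg[OF _ p0]) simp
  have \<eta>: "\<eta> \<le> \<delta> / 4" using accuracy by (simp only: \<eta>_def)
  have "ennreal (real (calls J (x \<omega>) (?w \<omega>))) = (\<Sum>j<J. indicator {\<omega>. running (x \<omega>) (?w \<omega>) j} \<omega>)" for \<omega>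
  proof -
    have "real (calls J (x \<omega>) (?w \<omega>)) = (\<Sum>j<J. if running (x \<omega>) (?w \<omega>) j then 1 else 0)"
      unfolding calls_def by (subst sum.inter_filter[symmetric]) auto
    also have "ennreal \<dots> = (\<Sum>j<J. ennreal (if running (x \<omega>) (?w \<omega>) j then 1 else 0))"
      by (rule sum_ennreal[symmetric]) auto
    also have "\<dots> = (\<Sum>j<J. indicator {\<omega>. running (x \<omega>) (?w \<omega>) j} \<omega>)"
      by (intro sum.cong) (auto simp: indicator_def)
    finally show ?thesis .
  qed
  then have zsum: "(\<integral>\<^sup>+ \<omega>. ?z \<omega> \<partial>P) = (\<Sum>j<J. \<integral>\<^sup>+ \<omega>. indicator {\<omega>. running (x \<omega>) (?w \<omega>) j} \<omega> \<partial>P)"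
    by (simp add: nn_integral_sum)
  have one: "(\<integral>\<^sup>+ \<omega>. indicator {\<omega>. running (x \<omega>) (?w \<omega>) j} \<omega> * err_at (x \<omega>) (?w \<omega>) j \<partial>P)
      \<le> ennreal ?p * (\<integral>\<^sup>+ \<omega>. indicator {\<omega>. running (x \<omega>) (?w \<omega>) j} \<omega> \<partial>P)" for j
  proof -
    let ?X = "\<lambda>\<omega>. (gmco_lin h L Lh (x \<omega>) (iter (x \<omega>) (?w \<omega>) j), iter (x \<omega>) (?w \<omega>) j)"
    have Xm: "?X \<in> P \<rightarrow>\<^sub>M borel \<Otimes>\<^sub>M borel" unfolding gmco_lin_def by measurable
    have ne: "\<iota> i \<noteq> \<iota> j" if "i < j" for i using injD[OF inj, of i j] that by blast
    have past: "iter \<zeta>0 (?w (\<omega>' (\<iota> j := s))) j = iter \<zeta>0 (?w \<omega>') j"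
      "running \<zeta>0 (?w (\<omega>' (\<iota> j := s))) j = running \<zeta>0 (?w \<omega>') j" for \<omega>' s \<zeta>0
      by (auto intro!: iter_cong running_cong simp: ne)
    have "(\<integral>\<^sup>+ \<omega>. indicator {\<omega>. running (x \<omega>) (?w \<omega>) j} \<omega>
            * (\<lambda>s (\<beta>, v). rel_err s \<beta> v) (\<omega> (\<iota> j)) (?X \<omega>) \<partial>P)
        \<le> ennreal ?p * (\<integral>\<^sup>+ \<omega>. indicator {\<omega>. running (x \<omega>) (?w \<omega>) j} \<omega> \<partial>P)"
      unfolding P_def
    proof (rule nn_integral_fresh_coordinate[where X="?X" and N="borel \<Otimes>\<^sub>M borel"
          and Q="\<lambda>\<omega>. running (x \<omega>) (?w \<omega>) j" and q="\<lambda>s (\<beta>, v). rel_err s \<beta> v"])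
      show "prob_space \<Xi>" by unfold_locales
      show "?X \<in> PiM UNIV (\<lambda>_. \<Xi>) \<rightarrow>\<^sub>M borel \<Otimes>\<^sub>M borel" using Xm unfolding P_def .
      show "Measurable.pred (PiM UNIV (\<lambda>_. \<Xi>)) (\<lambda>\<omega>. running (x \<omega>) (?w \<omega>) j)"
        using measurable_gmco(4)[OF x coord] unfolding P_def .
      show "(\<lambda>(s, x). (case x of (\<beta>, v) \<Rightarrow> rel_err s \<beta> v)) \<in> borel_measurable (\<Xi> \<Otimes>\<^sub>M borel \<Otimes>\<^sub>M borel)"
        by (rule measurable_rel_err)
      show "(\<integral>\<^sup>+ s. (case y of (\<beta>, v) \<Rightarrow> rel_err s \<beta> v) \<partial>\<Xi>) \<le> ennreal ?p" for y
        using rel_err_expectation by (cases y) simp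
    qed (simp_all only: fresh past)
    then show ?thesis unfolding err_at_def by simp
  qed
  have "(\<integral>\<^sup>+ \<omega>. ?e \<omega> \<partial>P) = (\<Sum>j<J. \<integral>\<^sup>+ \<omega>. indicator {\<omega>. running (x \<omega>) (?w \<omega>) j} \<omega> * err_at (x \<omega>) (?w \<omega>) j \<partial>P)"
    by (subst nn_integral_sum[symmetric]) (auto simp: indicator_def)
  also have "\<dots> \<le> (\<Sum>j<J. ennreal ?p * (\<integral>\<^sup>+ \<omega>. indicator {\<omega>. running (x \<omega>) (?w \<omega>) j} \<omega> \<partial>P))"
    by (intro sum_mono one)
  also have "\<dots> = ennreal ?p * (\<integral>\<^sup>+ \<omega>. ?z \<omega> \<partial>P)" unfolding zsum sum_distrib_left ..
  finally have Ee: "(\<integral>\<^sup>+ \<omega>. ?e \<omega> \<partial>P) \<le> ennreal ?p * (\<integral>\<^sup>+ \<omega>. ?z \<omega> \<partial>P)" .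
  define z where "z = enn2real (\<integral>\<^sup>+ \<omega>. ?z \<omega> \<partial>P)"
  have "(\<integral>\<^sup>+ \<omega>. ?z \<omega> \<partial>P) \<le> (\<integral>\<^sup>+ \<omega>. ennreal (real J) \<partial>P)"
    by (intro nn_integral_mono ennreal_leI) (simp add: calls_le)
  also have "\<dots> < \<top>" by (simp add: P.emeasure_space_1)
  finally have z: "(\<integral>\<^sup>+ \<omega>. ?z \<omega> \<partial>P) = ennreal z" unfolding z_def by simp
  have z0: "0 \<le> z" by (simp add: z_def)
  have em: "?e \<in> borel_measurable P"
    unfolding indicator_def by measurable
  have Kee: "(\<integral>\<^sup>+ \<omega>. ennreal (?K * 1201) * ?e \<omega> \<partial>P) \<le> ennreal (\<eta> * z)"
  proof -
    have "(\<integral>\<^sup>+ \<omega>. ennreal (?K * 1201) * ?e \<omega> \<partial>P) = ennreal (?K * 1201) * (\<integral>\<^sup>+ \<omega>. ?e \<omega> \<partial>P)"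
      by (rule nn_integral_cmult[OF em])
    also have "\<dots> \<le> ennreal (?K * 1201) * (ennreal ?p * ennreal z)"
      using Ee unfolding z by (rule mult_left_mono) simp
    also have "ennreal ?p * ennreal z = ennreal (?p * z)"
      by (rule ennreal_mult[OF p0 z0, symmetric])
    also have "ennreal (?K * 1201) * \<dots> = ennreal (?K * 1201 * (?p * z))"
      by (rule ennreal_mult[symmetric, OF _ mult_nonneg_nonneg[OF p0 z0]]) simp
    finally show ?thesis by (simp only: mult.assoc \<eta>_def)
  qed
  have "ennreal z \<le> (\<integral>\<^sup>+ \<omega>. ennreal ?K + ennreal (?K * 1201) * ?e \<omega> \<partial>P)"
    unfolding z[symmetric] by (intro nn_integral_mono calls_bound)
  also have "\<dots> = (\<integral>\<^sup>+ \<omega>. ennreal ?K \<partial>P) + (\<integral>\<^sup>+ \<omega>. ennreal (?K * 1201) * ?e \<omega> \<partial>P)"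
    by (rule nn_integral_add) (use em in auto)
  also have "\<dots> \<le> ennreal ?K + ennreal (\<eta> * z)"
    using Kee by (intro add_mono) (auto simp: P.emeasure_space_1)
  also have "\<dots> = ennreal (?K + \<eta> * z)" using \<eta>0 z0 by (intro ennreal_plus[symmetric]) auto
  finally have "z \<le> ?K + \<eta> * z" using \<eta>0 z0 by (subst (asm) ennreal_le_iff) auto
  moreover have "\<eta> * z \<le> 1 / 2 * z" using \<eta> \<delta> z0 by (intro mult_right_mono) auto
  ultimately have z2: "z \<le> 2 * ?K" by simp
  have "(\<integral>\<^sup>+ \<omega>. ennreal (real (calls J (x \<omega>) (?w \<omega>) - 2 * n)) \<partial>P)
      \<le> (\<integral>\<^sup>+ \<omega>. ennreal (?K * 1201) * ?e \<omega> \<partial>P)"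
  proof (rule nn_integral_mono)
    fix \<omega>
    have "ennreal (real (calls J (x \<omega>) (?w \<omega>) - 2 * n)) \<le> ?z \<omega> - ennreal ?K"
      by (cases "calls J (x \<omega>) (?w \<omega>) \<le> 2 * n") (auto simp: ennreal_minus of_nat_diff intro!: ennreal_leI)
    also have "\<dots> \<le> ennreal (?K * 1201) * ?e \<omega>"
      unfolding ennreal_minus_le_iff by (intro conjI impI, rule calls_bound, simp)
    finally show "ennreal (real (calls J (x \<omega>) (?w \<omega>) - 2 * n)) \<le> ennreal (?K * 1201) * ?e \<omega>" .
  qed
  also note Kee
  also have "ennreal (\<eta> * z) \<le> ennreal (\<delta> / 4 * (2 * ?K))"
    using \<eta> z2 z0 \<delta> by (intro ennreal_leI mult_mono) auto
  also have "\<delta> / 4 * (2 * ?K) = real n * \<delta>" by simp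
  finally show ?thesis .
qed

section \<open>Total cost with high probability\<close>

text \<open>Markov's inequality for the total excess of all runs. The expected excess is proportional to the
  number of runs, and so is the excess that is tolerated; therefore the probability of failure
  does not grow with the number of runs, as it would under a union bound.\<close>

lemma total_calls_with_high_probability:
  fixes \<iota> :: "'r \<Rightarrow> nat \<Rightarrow> 'i" and x :: "'r \<Rightarrow> ('i \<Rightarrow> 's) \<Rightarrow> 'a"
  defines "P \<equiv> PiM (UNIV :: 'i set) (\<lambda>_. \<Xi>)"
  assumes I: "finite I" "I \<noteq> {}" and inj: "\<And>r. inj (\<iota> r)"
    and x: "\<And>r. x r \<in> borel_measurable P"
    and fresh: "\<And>r w j s. x r (w(\<iota> r j := s)) = x r w"
  shows "measure P {\<omega> \<in> space P. (\<forall>r\<in>I. halts (x r \<omega>) (\<lambda>j. \<omega> (\<iota> r j)))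
           \<and> (\<Sum>r\<in>I. len (x r \<omega>) (\<lambda>j. \<omega> (\<iota> r j))) \<le> 2 * card I * (2 * n)} \<ge> 1 - \<delta>"
    (is "measure P ?G \<ge> _")
proof -
  interpret P: prob_space P unfolding P_def by (intro prob_space_PiM) unfold_locales
  have cI: "0 < card I" using I by (simp add: card_gt_0_iff)
  define B where "B = card I * (2 * n)"
  \<comment> \<open>A run that is still active after \<open>J\<close> calls would exceed the tolerated total on its own.\<close>
  let ?J = "2 * B + 1"
  let ?w = "\<lambda>r \<omega> j. \<omega> (\<iota> r j)"
  have B0: "0 < B" using n_pos cI by (simp add: B_def)
  have coord: "(\<lambda>\<omega>. \<omega> (\<iota> r j)) \<in> P \<rightarrow>\<^sub>M \<Xi>" for r j unfolding P_def by simp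
  note [measurable] = measurable_gmco[OF x coord]
  let ?exc = "\<lambda>r \<omega>. calls ?J (x r \<omega>) (?w r \<omega>) - 2 * n"
  let ?E = "\<lambda>\<omega>. \<Sum>r\<in>I. ennreal (real (?exc r \<omega>))"
  have G[measurable]: "?G \<in> sets P" using I by measurable
  have good: "\<omega> \<in> ?G" if \<omega>: "\<omega> \<in> space P" and small: "(\<Sum>r\<in>I. ?exc r \<omega>) < B" for \<omega>
  proof -
    have exc: "?exc r \<omega> < B" if "r \<in> I" for r
      using member_le_sum[of r I "\<lambda>r. ?exc r \<omega>"] that I small by simp
    have "2 * n \<le> B" using cI by (simp add: B_def)
    then have less: "calls ?J (x r \<omega>) (?w r \<omega>) < ?J" if "r \<in> I" for r
      using exc[OF that] by linarith
    note stop = calls_less[OF less]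
    have "(\<Sum>r\<in>I. len (x r \<omega>) (?w r \<omega>)) \<le> (\<Sum>r\<in>I. ?exc r \<omega> + 2 * n)"
      using stop(2) by (intro sum_mono) simp
    also have "\<dots> = (\<Sum>r\<in>I. ?exc r \<omega>) + B" by (simp add: sum.distrib B_def)
    also have "\<dots> \<le> B + B" using small by simp
    also have "B + B = 2 * card I * (2 * n)" by (simp add: B_def)
    finally show ?thesis using \<omega> stop(1) by simp
  qed
  have "emeasure P (space P - ?G) \<le> emeasure P {\<omega> \<in> space P. 1 \<le> ennreal (1 / real B) * ?E \<omega>}"
  proof (rule emeasure_mono)
    show "space P - ?G \<subseteq> {\<omega> \<in> space P. 1 \<le> ennreal (1 / real B) * ?E \<omega>}"
    proof
      fix \<omega> assume \<omega>: "\<omega> \<in> space P - ?G"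
      then have "B \<le> (\<Sum>r\<in>I. ?exc r \<omega>)" using good[of \<omega>] by (meson DiffD1 DiffD2 not_less)
      then have "real B \<le> real (\<Sum>r\<in>I. ?exc r \<omega>)" by (rule of_nat_mono)
      then have "real B \<le> (\<Sum>r\<in>I. real (?exc r \<omega>))" by (simp only: of_nat_sum)
      then have "1 \<le> 1 / real B * (\<Sum>r\<in>I. real (?exc r \<omega>))" using B0 by (simp add: field_simps)
      then have "ennreal 1 \<le> ennreal (1 / real B * (\<Sum>r\<in>I. real (?exc r \<omega>)))" by (rule ennreal_leI)
      also have "\<dots> = ennreal (1 / real B) * ?E \<omega>"
        by (subst ennreal_mult) (auto simp: sum_nonneg)
      finally show "\<omega> \<in> {\<omega> \<in> space P. 1 \<le> ennreal (1 / real B) * ?E \<omega>}" using \<omega> by simp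
    qed
  qed measurable
  also have "\<dots> \<le> ennreal (1 / real B) * (\<integral>\<^sup>+ \<omega>. ?E \<omega> * indicator (space P) \<omega> \<partial>P)"
    by (rule nn_integral_Markov_inequality) measurable
  also have "(\<integral>\<^sup>+ \<omega>. ?E \<omega> * indicator (space P) \<omega> \<partial>P) = (\<integral>\<^sup>+ \<omega>. ?E \<omega> \<partial>P)"
    by (intro nn_integral_cong) simp
  also have "ennreal (1 / real B) * (\<integral>\<^sup>+ \<omega>. ?E \<omega> \<partial>P)
      \<le> ennreal (1 / real B) * ennreal (real (card I) * (real n * \<delta>))"
  proof (rule mult_left_mono)
    have "(\<integral>\<^sup>+ \<omega>. ?E \<omega> \<partial>P) = (\<Sum>r\<in>I. \<integral>\<^sup>+ \<omega>. ennreal (real (?exc r \<omega>)) \<partial>P)"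
      by (rule nn_integral_sum) measurable
    also have "\<dots> \<le> (\<Sum>r\<in>I. ennreal (real n * \<delta>))"
      unfolding P_def by (intro sum_mono excess_calls_expectation inj fresh x[unfolded P_def])
    also have "\<dots> = ennreal (real (card I) * (real n * \<delta>))"
      using \<delta> by (subst sum_ennreal) auto
    finally show "(\<integral>\<^sup>+ \<omega>. ?E \<omega> \<partial>P) \<le> ennreal (real (card I) * (real n * \<delta>))" .
  qed simp
  also have "\<dots> = ennreal (1 / real B * (real (card I) * (real n * \<delta>)))"
    using \<delta> by (subst ennreal_mult) auto
  also have "1 / real B * (real (card I) * (real n * \<delta>)) = \<delta> / 2" using n_pos cI by (simp add: B_def field_simps)
  finally have "emeasure P (space P - ?G) \<le> ennreal (\<delta> / 2)" .
  then have "measure P (space P - ?G) \<le> \<delta> / 2" using \<delta> by (simp add: P.emeasure_eq_measure)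
  then show ?thesis using P.prob_compl[OF G] \<delta> by simp
qed

section \<open>Convergence of SAE\<close>

lemma sae_step_pos: "0 \<le> A \<Longrightarrow> 0 < sae_step L A"
  and sae_step_square: "0 \<le> A \<Longrightarrow> L * (sae_step L A)\<^sup>2 = A + sae_step L A"
proof -
  assume A: "0 \<le> A"
  let ?D = "1 / L\<^sup>2 + 4 * A / L"
  have D: "0 \<le> ?D" using A L_pos by simp
  then show "0 < sae_step L A" unfolding sae_step_def using L_pos by (simp add: add_pos_nonneg)
  define s where "s = sqrt ?D"
  have s: "s\<^sup>2 = ?D" using D by (simp add: s_def)
  have step: "sae_step L A = (1 / L + s) / 2" unfolding sae_step_def s_def ..
  have "L * (sae_step L A)\<^sup>2 = L * ((1 / L)\<^sup>2 + 2 * (1 / L) * s + s\<^sup>2) / 4"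
    unfolding step by (simp add: power2_eq_square algebra_simps)
  also have "\<dots> = A + sae_step L A"
    unfolding s step using L_pos by (simp add: power2_eq_square distrib_left add_divide_distrib)
  finally show "L * (sae_step L A)\<^sup>2 = A + sae_step L A" .
qed

text \<open>The step is at least \<open>(1 / L + 2 * sqrt (A / L)) / 2\<close>, so the square root of \<open>sae_A L k\<close> grows
  by at least \<open>1 / (2 * sqrt L)\<close> per iteration.\<close>

lemma sae_A_lower_bound: "(real k)\<^sup>2 / (4 * L) \<le> sae_A L k"
proof (induction k)
  case (Suc k)
  let ?A = "sae_A L k"
  have "(real k)\<^sup>2 / L\<^sup>2 \<le> 1 / L\<^sup>2 + 4 * ?A / L"
  proof -
    have "(real k)\<^sup>2 / L\<^sup>2 = 4 * ((real k)\<^sup>2 / (4 * L)) / L" using L_pos by (simp add: power2_eq_square)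
    also have "\<dots> \<le> 4 * ?A / L" using Suc L_pos by (intro divide_right_mono mult_left_mono) auto
    also have "\<dots> \<le> 1 / L\<^sup>2 + 4 * ?A / L" by simp
    finally show ?thesis .
  qed
  then have "(real k / L)\<^sup>2 \<le> 1 / L\<^sup>2 + 4 * ?A / L" by (simp add: power_divide)
  then have "real k / L \<le> sqrt (1 / L\<^sup>2 + 4 * ?A / L)" by (rule real_le_rsqrt)
  then have "(1 / L + real k / L) / 2 \<le> sae_step L ?A" unfolding sae_step_def
    by (intro divide_right_mono add_left_mono) auto
  then have "(real k)\<^sup>2 / (4 * L) + (1 / L + real k / L) / 2 \<le> sae_A L (Suc k)"
    using Suc unfolding sae_A.simps by linarith
  moreover have "(real (Suc k))\<^sup>2 / (4 * L) \<le> (real k)\<^sup>2 / (4 * L) + (1 / L + real k / L) / 2"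
    using L_pos by (simp add: power2_eq_square field_simps)
  ultimately show ?case by simp
qed simp

lemma sae_A_nonneg: "0 \<le> sae_A L k"
  using sae_A_lower_bound[of k] L_pos by (smt (verit) divide_nonneg_pos zero_le_power2)

text \<open>The analysis of the accelerated hybrid proximal extragradient method. The change of the potential
  is at most \<open>A + a\<close> times \<open>inner G (y' - x) + |G|^2 / (2 * L)\<close> with \<open>G = grad f y'\<close>, and this is
  \<open>(|G + L * (y' - x)|^2 - L^2 * |y' - x|^2) / (2 * L)\<close>. The stopping test makes it nonpositive.\<close>

lemma sae_potential_step:
  fixes y z y' :: 'a and a A :: real
  defines "x \<equiv> (A / (A + a)) *\<^sub>R y + (a / (A + a)) *\<^sub>R z"
  assumes A: "0 \<le> A" and a: "0 < a" and sq: "L * a\<^sup>2 = A + a"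
    and stop: "gmco_stop f L x y'"
  shows "(A + a) * (f y' - f u) + (norm (z - a *\<^sub>R grad f y' - u))\<^sup>2 / 2
           \<le> A * (f y - f u) + (norm (z - u))\<^sup>2 / 2"
proof -
  let ?G = "grad f y'"
  have A': "0 < A + a" using A a by simp
  have tangent: "f v \<ge> f y' + inner ?G (v - y')" for v
    by (rule convex_above_tangent[OF convex_f smooth_fun_gderiv[OF smooth_f]])
  have Ax: "(A + a) *\<^sub>R x = A *\<^sub>R y + a *\<^sub>R z"
    using A' unfolding x_def by (simp add: scaleR_add_right)
  have "A * (f y' + inner ?G (y - y')) \<le> A * f y" using tangent A by (rule mult_left_mono)
  moreover have "a * (f y' + inner ?G (u - y')) \<le> a * f u" using tangent a by (intro mult_left_mono) auto
  moreover have "A * inner ?G (y - y') + a * inner ?G (u - y')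
      = - ((A + a) * inner ?G (y' - x)) - a * inner ?G (z - u)"
  proof -
    have "A * inner ?G (y - y') + a * inner ?G (u - y')
        = inner ?G (A *\<^sub>R y + a *\<^sub>R z - (A + a) *\<^sub>R y' - a *\<^sub>R (z - u))"
      by (simp add: algebra_simps)
    then show ?thesis unfolding Ax[symmetric] by (simp add: algebra_simps)
  qed
  ultimately have val: "(A + a) * (f y' - f u)
      \<le> A * (f y - f u) + (A + a) * inner ?G (y' - x) + a * inner ?G (z - u)"
    by (simp add: algebra_simps)
  have dist: "(norm (z - a *\<^sub>R ?G - u))\<^sup>2 / 2
      = (norm (z - u))\<^sup>2 / 2 - a * inner ?G (z - u) + a\<^sup>2 * (norm ?G)\<^sup>2 / 2"
    unfolding power2_norm_eq_inner
    by (simp add: inner_commute power2_eq_square algebra_simps add_divide_distrib diff_divide_distrib)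
  have "(norm (?G + L *\<^sub>R (y' - x)))\<^sup>2 \<le> (L / 2 * norm (y' - x))\<^sup>2"
    using stop unfolding gmco_stop_def grad_prox by (intro power_mono) auto
  then have "(norm ?G)\<^sup>2 + 2 * L * inner ?G (y' - x) + L\<^sup>2 * (norm (y' - x))\<^sup>2
      \<le> L\<^sup>2 / 4 * (norm (y' - x))\<^sup>2"
    unfolding power2_norm_eq_inner power_mult_distrib
    by (simp add: inner_commute power2_eq_square algebra_simps)
  moreover have "0 \<le> L\<^sup>2 * (norm (y' - x))\<^sup>2" by simp
  ultimately have "(norm ?G)\<^sup>2 + 2 * L * inner ?G (y' - x) \<le> 0" by linarith
  then have "a\<^sup>2 / 2 * ((norm ?G)\<^sup>2 + 2 * L * inner ?G (y' - x)) \<le> 0"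
    by (intro mult_nonneg_nonpos) auto
  then have "a\<^sup>2 * (norm ?G)\<^sup>2 / 2 + (L * a\<^sup>2) * inner ?G (y' - x) \<le> 0"
    by (simp add: algebra_simps)
  then show ?thesis using val dist unfolding sq by linarith
qed

text \<open>A total version of the algorithm: where GMCO does not halt, \<open>out\<close> is some iterate. This keeps
  the dependence on the seeds measurable without a measurable structure on optional results.\<close>

primrec sae_run :: "'a \<Rightarrow> (nat \<times> nat \<Rightarrow> 's) \<Rightarrow> nat \<Rightarrow> 'a \<times> 'a" where
  "sae_run x0 w 0 = (x0, x0)"
| "sae_run x0 w (Suc k) =
     (let A = sae_A L k; a = sae_step L A; y = fst (sae_run x0 w k); z = snd (sae_run x0 w k);
          y' = out ((A / (A + a)) *\<^sub>R y + (a / (A + a)) *\<^sub>R z) (\<lambda>j. w (k, j))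
      in (y', z - a *\<^sub>R grad f y'))"

text \<open>The point at which GMCO is started in iteration \<open>k + 1\<close>.\<close>

definition query :: "'a \<Rightarrow> (nat \<times> nat \<Rightarrow> 's) \<Rightarrow> nat \<Rightarrow> 'a" where
  "query x0 w k =
     (let A = sae_A L k; a = sae_step L A
      in (A / (A + a)) *\<^sub>R fst (sae_run x0 w k) + (a / (A + a)) *\<^sub>R snd (sae_run x0 w k))"

definition sae_halts :: "'a \<Rightarrow> (nat \<times> nat \<Rightarrow> 's) \<Rightarrow> nat \<Rightarrow> bool" where
  "sae_halts x0 w N \<longleftrightarrow> (\<forall>k<N. halts (query x0 w k) (\<lambda>j. w (k, j)))"

definition sae_len :: "'a \<Rightarrow> (nat \<times> nat \<Rightarrow> 's) \<Rightarrow> nat \<Rightarrow> nat" where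
  "sae_len x0 w N = (\<Sum>k<N. len (query x0 w k) (\<lambda>j. w (k, j)))"

lemma sae_run_Suc:
  "sae_run x0 w (Suc k) =
     (out (query x0 w k) (\<lambda>j. w (k, j)),
      snd (sae_run x0 w k) - sae_step L (sae_A L k) *\<^sub>R grad f (out (query x0 w k) (\<lambda>j. w (k, j))))"
  by (simp add: query_def Let_def)

lemma sae_state_eq:
  "sae_state h g M L Lh NM x0 w k =
     (if sae_halts x0 w k then Some (fst (sae_run x0 w k), snd (sae_run x0 w k), sae_len x0 w k) else None)"
proof (induction k)
  case 0 then show ?case by (simp add: sae_halts_def sae_len_def)
next
  case (Suc k)
  have H: "sae_halts x0 w (Suc k) \<longleftrightarrow> sae_halts x0 w k \<and> halts (query x0 w k) (\<lambda>j. w (k, j))"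
    unfolding sae_halts_def by (auto simp: less_Suc_eq)
  show ?case
    unfolding sae_state.simps Suc H sae_run_Suc
    by (simp add: gmco_eq query_def[symmetric] Let_def sae_len_def)
       (simp add: query_def Let_def)
qed

lemma sae_eq:
  "sae h g M L Lh NM x0 N w = (if sae_halts x0 w N then Some (fst (sae_run x0 w N), sae_len x0 w N) else None)"
  unfolding sae_def sae_state_eq by simp

lemma sae_convergence:
  assumes halts: "sae_halts x0 w N" and N: "0 < N"
  shows "f (fst (sae_run x0 w N)) - f u \<le> 2 * L * (norm (x0 - u))\<^sup>2 / (real N)\<^sup>2"
proof -
  have pot: "sae_A L k * (f (fst (sae_run x0 w k)) - f u) + (norm (snd (sae_run x0 w k) - u))\<^sup>2 / 2
      \<le> (norm (x0 - u))\<^sup>2 / 2" if "k \<le> N" for k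
    using that
  proof (induction k)
    case (Suc k)
    have "gmco_stop f L (query x0 w k) (out (query x0 w k) (\<lambda>j. w (k, j)))"
      using halts Suc.prems unfolding sae_halts_def by (intro halts_stop) auto
    then have "sae_A L (Suc k) * (f (fst (sae_run x0 w (Suc k))) - f u) + (norm (snd (sae_run x0 w (Suc k)) - u))\<^sup>2 / 2
      \<le> sae_A L k * (f (fst (sae_run x0 w k)) - f u) + (norm (snd (sae_run x0 w k) - u))\<^sup>2 / 2"
      unfolding sae_run_Suc sae_A.simps fst_conv snd_conv
      by (intro sae_potential_step sae_A_nonneg sae_step_pos sae_step_square) (simp_all add: query_def Let_def)
    then show ?case using Suc by simp
  qed simp
  let ?g = "f (fst (sae_run x0 w N)) - f u"
  show ?thesis
  proof (cases "?g \<le> 0")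
    case True
    have "0 \<le> 2 * L * (norm (x0 - u))\<^sup>2 / (real N)\<^sup>2" using L_pos by simp
    then show ?thesis using True by linarith
  next
    case False
    have "(real N)\<^sup>2 / (4 * L) * ?g \<le> sae_A L N * ?g"
      using False sae_A_lower_bound by (intro mult_right_mono) auto
    also have "\<dots> \<le> (norm (x0 - u))\<^sup>2 / 2"
      using pot[OF order_refl] zero_le_power2[of "norm (snd (sae_run x0 w N) - u)"] by linarith
    finally show ?thesis using N L_pos by (simp add: field_simps)
  qed
qed

lemma sae_run_cong: "(\<And>k' j. k' < k \<Longrightarrow> w (k', j) = w' (k', j)) \<Longrightarrow> sae_run x0 w k = sae_run x0 w' k"
proof (induction k)
  case (Suc k)
  then have "sae_run x0 w k = sae_run x0 w' k" "(\<lambda>j. w (k, j)) = (\<lambda>j. w' (k, j))" by auto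
  then show ?case unfolding sae_run_Suc query_def by simp
qed simp

lemma query_cong:
  assumes "\<And>k' j. k' < k \<Longrightarrow> w (k', j) = w' (k', j)"
  shows "query x0 w k = query x0 w' k"
proof -
  have "sae_run x0 w k = sae_run x0 w' k" using assms by (rule sae_run_cong)
  then show ?thesis by (simp add: query_def)
qed

lemma measurable_query:
  assumes x: "x \<in> borel_measurable P" and w: "\<And>p. (\<lambda>\<omega>. w \<omega> p) \<in> P \<rightarrow>\<^sub>M \<Xi>"
  shows "(\<lambda>\<omega>. query (x \<omega>) (w \<omega>) k) \<in> borel_measurable P"
    and "(\<lambda>\<omega>. fst (sae_run (x \<omega>) (w \<omega>) k)) \<in> borel_measurable P"
proof -
  have run: "(\<lambda>\<omega>. fst (sae_run (x \<omega>) (w \<omega>) k)) \<in> borel_measurable P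
     \<and> (\<lambda>\<omega>. snd (sae_run (x \<omega>) (w \<omega>) k)) \<in> borel_measurable P" for k
  proof (induction k)
    case (Suc k)
    then have [measurable]: "(\<lambda>\<omega>. fst (sae_run (x \<omega>) (w \<omega>) k)) \<in> borel_measurable P"
      "(\<lambda>\<omega>. snd (sae_run (x \<omega>) (w \<omega>) k)) \<in> borel_measurable P" by auto
    have q: "(\<lambda>\<omega>. query (x \<omega>) (w \<omega>) k) \<in> borel_measurable P"
      unfolding query_def Let_def by measurable
    note [measurable] = measurable_gmco(3)[OF q, of "\<lambda>\<omega> j. w \<omega> (k, j)", OF w]
    show ?case unfolding sae_run_Suc grad_f fst_conv snd_conv by (intro conjI; measurable)
  qed (simp add: x)
  then have [measurable]: "(\<lambda>\<omega>. fst (sae_run (x \<omega>) (w \<omega>) k)) \<in> borel_measurable P"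
      "(\<lambda>\<omega>. snd (sae_run (x \<omega>) (w \<omega>) k)) \<in> borel_measurable P" for k by auto
  show "(\<lambda>\<omega>. query (x \<omega>) (w \<omega>) k) \<in> borel_measurable P" unfolding query_def Let_def by measurable
  show "(\<lambda>\<omega>. fst (sae_run (x \<omega>) (w \<omega>) k)) \<in> borel_measurable P" by measurable
qed

lemma measurable_sae:
  assumes x: "x \<in> borel_measurable P" and w: "\<And>p. (\<lambda>\<omega>. w \<omega> p) \<in> P \<rightarrow>\<^sub>M \<Xi>"
  shows "Measurable.pred P (\<lambda>\<omega>. sae_halts (x \<omega>) (w \<omega>) N)"
    and "(\<lambda>\<omega>. sae_len (x \<omega>) (w \<omega>) N) \<in> P \<rightarrow>\<^sub>M count_space UNIV"
proof -
  note [measurable] = measurable_gmco[OF measurable_query(1)[OF assms], of "\<lambda>\<omega> j. w \<omega> (k, j)" for k, OF w]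
  show "Measurable.pred P (\<lambda>\<omega>. sae_halts (x \<omega>) (w \<omega>) N)" unfolding sae_halts_def by measurable
  show "(\<lambda>\<omega>. sae_len (x \<omega>) (w \<omega>) N) \<in> P \<rightarrow>\<^sub>M count_space UNIV" unfolding sae_len_def by measurable
qed

section \<open>Restarts\<close>

primrec rsae_run :: "nat \<Rightarrow> 'a \<Rightarrow> (nat \<times> nat \<times> nat \<Rightarrow> 's) \<Rightarrow> nat \<Rightarrow> 'a" where
  "rsae_run N0 x0 w 0 = x0"
| "rsae_run N0 x0 w (Suc t) = fst (sae_run (rsae_run N0 x0 w t) (\<lambda>p. w (t, p)) N0)"

definition rsae_halts :: "nat \<Rightarrow> 'a \<Rightarrow> (nat \<times> nat \<times> nat \<Rightarrow> 's) \<Rightarrow> nat \<Rightarrow> bool" where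
  "rsae_halts N0 x0 w T \<longleftrightarrow> (\<forall>t<T. sae_halts (rsae_run N0 x0 w t) (\<lambda>p. w (t, p)) N0)"

definition rsae_len :: "nat \<Rightarrow> 'a \<Rightarrow> (nat \<times> nat \<times> nat \<Rightarrow> 's) \<Rightarrow> nat \<Rightarrow> nat" where
  "rsae_len N0 x0 w T = (\<Sum>t<T. sae_len (rsae_run N0 x0 w t) (\<lambda>p. w (t, p)) N0)"

lemma rsae_eq:
  "rsae h g M L Lh NM N0 x0 w T =
     (if rsae_halts N0 x0 w T then Some (rsae_run N0 x0 w T, rsae_len N0 x0 w T) else None)"
proof (induction T)
  case 0 then show ?case by (simp add: rsae_halts_def rsae_len_def)
next
  case (Suc T)
  have H: "rsae_halts N0 x0 w (Suc T)
      \<longleftrightarrow> rsae_halts N0 x0 w T \<and> sae_halts (rsae_run N0 x0 w T) (\<lambda>p. w (T, p)) N0"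
    unfolding rsae_halts_def by (auto simp: less_Suc_eq)
  have e: "(\<lambda>(k, j). w (T, k, j)) = (\<lambda>p. w (T, p))" by auto
  show ?case unfolding rsae.simps Suc H e sae_eq by (simp add: rsae_len_def)
qed

lemma rsae_run_cong:
  "(\<And>t' p. t' < t \<Longrightarrow> w (t', p) = w' (t', p)) \<Longrightarrow> rsae_run N0 x0 w t = rsae_run N0 x0 w' t"
proof (induction t)
  case (Suc t)
  then have "rsae_run N0 x0 w t = rsae_run N0 x0 w' t" "(\<lambda>p. w (t, p)) = (\<lambda>p. w' (t, p))" by auto
  then show ?case by simp
qed simp

lemma measurable_rsae_run:
  assumes w: "\<And>p. (\<lambda>\<omega>. w \<omega> p) \<in> P \<rightarrow>\<^sub>M \<Xi>"
  shows "(\<lambda>\<omega>. rsae_run N0 x0 (w \<omega>) t) \<in> borel_measurable P"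
proof (induction t)
  case (Suc t)
  show ?case unfolding rsae_run.simps by (rule measurable_query(2)[OF Suc w])
qed simp

text \<open>\<open>N0\<close> is large enough for a run of SAE to bring the gap below \<open>\<mu> / 4\<close> times the squared distance,
  which halves the squared distance by strong convexity. The last restart ends with a bound on the
  gap itself.\<close>

lemma rsae_convergence:
  assumes halts: "rsae_halts N0 x0 w T" and min: "\<And>v. f u \<le> f v" and sc: "strongly_convex \<mu> f"
    and \<mu>: "0 < \<mu>" and N0: "8 * L / \<mu> \<le> (real N0)\<^sup>2" and T: "0 < T"
  shows "f (rsae_run N0 x0 w T) - f u \<le> \<mu> / 2 * (norm (x0 - u))\<^sup>2 / 2 ^ T"
proof -
  have "0 < 8 * L / \<mu>" using L_pos \<mu> by simp
  then have N0p: "0 < N0" using N0 by (cases "N0 = 0") auto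
  have step: "f (rsae_run N0 x0 w (Suc t)) - f u \<le> \<mu> / 4 * (norm (rsae_run N0 x0 w t - u))\<^sup>2" if "t < T" for t
  proof -
    let ?r = "(norm (rsae_run N0 x0 w t - u))\<^sup>2"
    have "f (rsae_run N0 x0 w (Suc t)) - f u \<le> 2 * L * ?r / (real N0)\<^sup>2"
      using halts that unfolding rsae_run.simps rsae_halts_def by (intro sae_convergence N0p) auto
    also have "\<dots> \<le> 2 * L * ?r / (8 * L / \<mu>)"
      using N0 N0p \<open>0 < 8 * L / \<mu>\<close> L_pos by (intro divide_left_mono mult_pos_pos) auto
    also have "\<dots> = \<mu> / 4 * ?r" using L_pos \<mu> by (simp add: field_simps)
    finally show ?thesis .
  qed
  have dist: "(norm (rsae_run N0 x0 w t - u))\<^sup>2 \<le> (norm (x0 - u))\<^sup>2 / 2 ^ t" if "t \<le> T" for t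
    using that
  proof (induction t)
    case (Suc t)
    have "\<mu> / 2 * (norm (rsae_run N0 x0 w (Suc t) - u))\<^sup>2 \<le> \<mu> / 4 * (norm (rsae_run N0 x0 w t - u))\<^sup>2"
      using strongly_convex_growth[OF sc min] step[of t] Suc.prems by (meson order_trans Suc_le_lessD)
    then have "(norm (rsae_run N0 x0 w (Suc t) - u))\<^sup>2 \<le> (norm (rsae_run N0 x0 w t - u))\<^sup>2 / 2"
      using \<mu> by simp
    then show ?case using Suc by simp
  qed simp
  obtain t where t: "T = Suc t" using T by (cases T) auto
  have "f (rsae_run N0 x0 w T) - f u \<le> \<mu> / 4 * (norm (rsae_run N0 x0 w t - u))\<^sup>2"
    unfolding t by (rule step) (simp add: t)
  also have "\<dots> \<le> \<mu> / 4 * ((norm (x0 - u))\<^sup>2 / 2 ^ t)"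
    using dist[of t] t \<mu> by (intro mult_left_mono) auto
  finally show ?thesis unfolding t by simp
qed

text \<open>The iterations are the runs in \<open>total_calls_with_high_probability\<close>. The event in the conclusion
  is rewritten in terms of the total version to see that it is measurable.\<close>

lemma sae_high_probability:
  defines "P \<equiv> PiM (UNIV :: (nat \<times> nat) set) (\<lambda>_. \<Xi>)"
  assumes N: "0 < N"
    and Q: "\<And>w. sae_halts x0 w N \<Longrightarrow> sae_len x0 w N \<le> 2 * N * (2 * n) \<Longrightarrow> Q1 (fst (sae_run x0 w N)) \<and> Q2 (sae_len x0 w N)"
    and [measurable]: "Measurable.pred borel Q1"
  shows "measure P {\<omega> \<in> space P. \<exists>xh m. sae h g M L Lh NM x0 N \<omega> = Some (xh, m) \<and> Q1 xh \<and> Q2 m} \<ge> 1 - \<delta>"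
proof -
  interpret P: prob_space P unfolding P_def by (intro prob_space_PiM) unfold_locales
  let ?\<iota> = "\<lambda>k j. (k, j)"
  have c: "(\<lambda>\<omega>. \<omega> p) \<in> P \<rightarrow>\<^sub>M \<Xi>" for p unfolding P_def by simp
  note [measurable] = measurable_sae[where x="\<lambda>_. x0" and w="\<lambda>\<omega>. \<omega>", OF borel_measurable_const c]
    measurable_query[where x="\<lambda>_. x0" and w="\<lambda>\<omega>. \<omega>", OF borel_measurable_const c]
  have "1 - \<delta> \<le> measure P {\<omega> \<in> space P. (\<forall>k\<in>{..<N}. halts (query x0 \<omega> k) (\<lambda>j. \<omega> (k, j)))
           \<and> (\<Sum>k\<in>{..<N}. len (query x0 \<omega> k) (\<lambda>j. \<omega> (k, j))) \<le> 2 * card {..<N} * (2 * n)}"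
    unfolding P_def
  proof (rule total_calls_with_high_probability[of _ ?\<iota>])
    show "query x0 (w(?\<iota> k j := s)) k = query x0 w k" for k w j s by (rule query_cong) auto
    show "(\<lambda>\<omega>. query x0 \<omega> k) \<in> borel_measurable (PiM UNIV (\<lambda>_. \<Xi>))" for k
      using measurable_query(1)[where x="\<lambda>_. x0" and w="\<lambda>\<omega>. \<omega>", OF borel_measurable_const c]
      unfolding P_def .
  qed (use N in \<open>auto simp: inj_on_def\<close>)
  also have "\<dots> \<le> measure P {\<omega> \<in> space P. \<exists>xh m. sae h g M L Lh NM x0 N \<omega> = Some (xh, m) \<and> Q1 xh \<and> Q2 m}"
  proof (rule P.finite_measure_mono)
    show "{\<omega> \<in> space P. (\<forall>k\<in>{..<N}. halts (query x0 \<omega> k) (\<lambda>j. \<omega> (k, j)))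
           \<and> (\<Sum>k\<in>{..<N}. len (query x0 \<omega> k) (\<lambda>j. \<omega> (k, j))) \<le> 2 * card {..<N} * (2 * n)}
        \<subseteq> {\<omega> \<in> space P. \<exists>xh m. sae h g M L Lh NM x0 N \<omega> = Some (xh, m) \<and> Q1 xh \<and> Q2 m}"
    proof
      fix \<omega> assume "\<omega> \<in> {\<omega> \<in> space P. (\<forall>k\<in>{..<N}. halts (query x0 \<omega> k) (\<lambda>j. \<omega> (k, j)))
           \<and> (\<Sum>k\<in>{..<N}. len (query x0 \<omega> k) (\<lambda>j. \<omega> (k, j))) \<le> 2 * card {..<N} * (2 * n)}"
      then have \<omega>: "\<omega> \<in> space P" and H: "sae_halts x0 \<omega> N" and l: "sae_len x0 \<omega> N \<le> 2 * N * (2 * n)"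
        unfolding mem_Collect_eq sae_halts_def sae_len_def card_lessThan by blast+
      show "\<omega> \<in> {\<omega> \<in> space P. \<exists>xh m. sae h g M L Lh NM x0 N \<omega> = Some (xh, m) \<and> Q1 xh \<and> Q2 m}"
        unfolding mem_Collect_eq sae_eq if_P[OF H] using \<omega> Q[OF H l] by blast
    qed
    have "{\<omega> \<in> space P. \<exists>xh m. sae h g M L Lh NM x0 N \<omega> = Some (xh, m) \<and> Q1 xh \<and> Q2 m}
        = {\<omega> \<in> space P. sae_halts x0 \<omega> N \<and> Q1 (fst (sae_run x0 \<omega> N)) \<and> Q2 (sae_len x0 \<omega> N)}"
      by (auto simp: sae_eq split: if_splits)
    also have "\<dots> \<in> sets P" by measurable
    finally show "{\<omega> \<in> space P. \<exists>xh m. sae h g M L Lh NM x0 N \<omega> = Some (xh, m) \<and> Q1 xh \<and> Q2 m} \<in> sets P" .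
  qed
  finally show ?thesis .
qed

lemma rsae_high_probability:
  defines "P \<equiv> PiM (UNIV :: (nat \<times> nat \<times> nat) set) (\<lambda>_. \<Xi>)"
  assumes N0: "0 < N0" and T: "0 < T"
    and Q: "\<And>w. rsae_halts N0 x0 w T \<Longrightarrow> rsae_len N0 x0 w T \<le> 2 * (T * N0) * (2 * n)
              \<Longrightarrow> Q1 (rsae_run N0 x0 w T) \<and> Q2 (rsae_len N0 x0 w T)"
    and [measurable]: "Measurable.pred borel Q1"
  shows "measure P {\<omega> \<in> space P. \<exists>xh m. rsae h g M L Lh NM N0 x0 \<omega> T = Some (xh, m) \<and> Q1 xh \<and> Q2 m} \<ge> 1 - \<delta>"
proof -
  interpret P: prob_space P unfolding P_def by (intro prob_space_PiM) unfold_locales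
  let ?\<iota> = "\<lambda>(t, k) j. (t, k, j)"
  let ?x = "\<lambda>(t, k) \<omega>. query (rsae_run N0 x0 \<omega> t) (\<lambda>p. \<omega> (t, p)) k"
  have c: "(\<lambda>\<omega>. \<omega> p) \<in> P \<rightarrow>\<^sub>M \<Xi>" for p unfolding P_def by simp
  note run = measurable_rsae_run[where w="\<lambda>\<omega>. \<omega>", OF c]
  note [measurable] = run measurable_sae[OF run, where w="\<lambda>\<omega> p. \<omega> (t, p)" for t, OF c]
  have "1 - \<delta> \<le> measure P {\<omega> \<in> space P. (\<forall>r\<in>{..<T} \<times> {..<N0}. halts (?x r \<omega>) (\<lambda>j. \<omega> (?\<iota> r j)))
           \<and> (\<Sum>r\<in>{..<T} \<times> {..<N0}. len (?x r \<omega>) (\<lambda>j. \<omega> (?\<iota> r j))) \<le> 2 * card ({..<T} \<times> {..<N0}) * (2 * n)}"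
    unfolding P_def
  proof (rule total_calls_with_high_probability[of _ ?\<iota>])
    show "?x r (w(?\<iota> r j := s)) = ?x r w" for r w j s
    proof (cases r)
      case (Pair t k)
      have "rsae_run N0 x0 (w((t, k, j) := s)) t = rsae_run N0 x0 w t" by (rule rsae_run_cong) auto
      moreover have "query y (\<lambda>p. (w((t, k, j) := s)) (t, p)) k = query y (\<lambda>p. w (t, p)) k" for y
        by (rule query_cong) auto
      ultimately show ?thesis unfolding Pair by simp
    qed
    show "?x r \<in> borel_measurable (PiM UNIV (\<lambda>_. \<Xi>))" for r
      using measurable_query(1)[OF run, where w="\<lambda>\<omega> p. \<omega> (fst r, p)", OF c]
      unfolding P_def by (simp add: case_prod_beta)
  qed (use N0 T in \<open>auto simp: inj_on_def\<close>)
  also have "\<dots> \<le> measure P {\<omega> \<in> space P. \<exists>xh m. rsae h g M L Lh NM N0 x0 \<omega> T = Some (xh, m) \<and> Q1 xh \<and> Q2 m}"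
  proof (rule P.finite_measure_mono)
    show "{\<omega> \<in> space P. (\<forall>r\<in>{..<T} \<times> {..<N0}. halts (?x r \<omega>) (\<lambda>j. \<omega> (?\<iota> r j)))
           \<and> (\<Sum>r\<in>{..<T} \<times> {..<N0}. len (?x r \<omega>) (\<lambda>j. \<omega> (?\<iota> r j))) \<le> 2 * card ({..<T} \<times> {..<N0}) * (2 * n)}
        \<subseteq> {\<omega> \<in> space P. \<exists>xh m. rsae h g M L Lh NM N0 x0 \<omega> T = Some (xh, m) \<and> Q1 xh \<and> Q2 m}"
    proof
      fix \<omega> assume "\<omega> \<in> {\<omega> \<in> space P. (\<forall>r\<in>{..<T} \<times> {..<N0}. halts (?x r \<omega>) (\<lambda>j. \<omega> (?\<iota> r j)))
           \<and> (\<Sum>r\<in>{..<T} \<times> {..<N0}. len (?x r \<omega>) (\<lambda>j. \<omega> (?\<iota> r j))) \<le> 2 * card ({..<T} \<times> {..<N0}) * (2 * n)}"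
      then have \<omega>: "\<omega> \<in> space P"
        and halt: "\<And>r. r \<in> {..<T} \<times> {..<N0} \<Longrightarrow> halts (?x r \<omega>) (\<lambda>j. \<omega> (?\<iota> r j))"
        and l: "(\<Sum>r\<in>{..<T} \<times> {..<N0}. len (?x r \<omega>) (\<lambda>j. \<omega> (?\<iota> r j))) \<le> 2 * (T * N0) * (2 * n)"
        unfolding mem_Collect_eq card_cartesian_product card_lessThan by blast+
      have H: "rsae_halts N0 x0 \<omega> T"
        unfolding rsae_halts_def sae_halts_def
      proof (intro allI impI)
        fix t k assume "t < T" "k < N0"
        then show "halts (query (rsae_run N0 x0 \<omega> t) (\<lambda>p. \<omega> (t, p)) k) (\<lambda>j. \<omega> (t, k, j))"
          using halt[of "(t, k)"] by simp
      qed
      have "rsae_len N0 x0 \<omega> T = (\<Sum>r\<in>{..<T} \<times> {..<N0}. len (?x r \<omega>) (\<lambda>j. \<omega> (?\<iota> r j)))"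
        unfolding rsae_len_def sae_len_def sum.cartesian_product by (intro sum.cong) auto
      with l have l: "rsae_len N0 x0 \<omega> T \<le> 2 * (T * N0) * (2 * n)" by (simp only:)
      show "\<omega> \<in> {\<omega> \<in> space P. \<exists>xh m. rsae h g M L Lh NM N0 x0 \<omega> T = Some (xh, m) \<and> Q1 xh \<and> Q2 m}"
        unfolding mem_Collect_eq rsae_eq if_P[OF H] using \<omega> Q[OF H l] by blast
    qed
    have "{\<omega> \<in> space P. \<exists>xh m. rsae h g M L Lh NM N0 x0 \<omega> T = Some (xh, m) \<and> Q1 xh \<and> Q2 m}
        = {\<omega> \<in> space P. rsae_halts N0 x0 \<omega> T \<and> Q1 (rsae_run N0 x0 \<omega> T) \<and> Q2 (rsae_len N0 x0 \<omega> T)}"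
      by (auto simp: rsae_eq split: if_splits)
    also have "\<dots> \<in> sets P" unfolding rsae_halts_def rsae_len_def by measurable
    finally show "{\<omega> \<in> space P. \<exists>xh m. rsae h g M L Lh NM N0 x0 \<omega> T = Some (xh, m) \<and> Q1 xh \<and> Q2 m} \<in> sets P" .
  qed
  finally show ?thesis .
qed

end

section \<open>Oracle complexity\<close>

text \<open>Here \<open>\<rho> = Lh / L\<close>, \<open>t = \<tau> / sqrt (L + Lh)\<close>, \<open>W\<close> is the displayed number of iterations without its
  constant, and \<open>l\<close> is the logarithm in the budget, which may be replaced by any \<open>l'\<close> with
  \<open>l \<le> 2 * l'\<close>.\<close>

lemma oracle_call_bounds:
  fixes N m n \<kappa> NM :: nat and W \<rho> t l l' C0 :: real
  assumes N: "real N \<le> 12 * W" and \<rho>: "1 \<le> \<rho>" and n: "real (2 * n) \<le> 602 * \<rho>"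
    and m: "m \<le> 2 * N * (2 * n)" and C0: "0 < C0" and t: "0 < t" and l: "0 \<le> l" "l \<le> 2 * l'"
    and NM: "real NM \<le> (1 + C0) * (t * l)"
  shows "real (h_calls N m) \<le> bigO_const * (W * (1 + \<rho>))"
    and "real (g_calls \<kappa> NM N m) \<le> bigO_const * (1 + C0) * (W * (\<kappa> + \<rho> * (t * l')))"
    and "real (test_calls \<kappa> m) \<le> bigO_const * (W * (\<kappa> * \<rho>))"
proof -
  have W: "0 \<le> W" using N of_nat_0_le_iff[of N, where ?'a=real] by linarith
  have W\<rho>: "W \<le> W * \<rho>" using W \<rho> by (simp add: mult_le_cancel_left1)
  have l': "0 \<le> l'" using l by simp
  have "real m \<le> real (2 * N * (2 * n))" using m by (rule of_nat_mono)
  also have "\<dots> = 2 * real N * real (2 * n)" by simp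
  also have "\<dots> \<le> 2 * (12 * W) * (602 * \<rho>)" using N n W by (intro mult_mono) auto
  finally have m': "real m \<le> 14448 * (W * \<rho>)" by simp
  show "real (h_calls N m) \<le> bigO_const * (W * (1 + \<rho>))"
  proof -
    have "real (h_calls N m) \<le> 12 * W + 2 * (14448 * (W * \<rho>))" using N m' by (simp add: h_calls_def)
    also have "\<dots> \<le> 10 ^ 6 * (W + W * \<rho>)" using W W\<rho> by simp
    finally show ?thesis by (simp add: bigO_const_def distrib_left)
  qed
  have k: "0 \<le> real \<kappa> * W" "0 \<le> real \<kappa> * (W * \<rho>)" using W \<rho> by auto
  show "real (test_calls \<kappa> m) \<le> bigO_const * (W * (\<kappa> * \<rho>))"
  proof -
    have "real (test_calls \<kappa> m) \<le> real \<kappa> * (14448 * (W * \<rho>))"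
      unfolding test_calls_def of_nat_mult using m' by (rule mult_left_mono) simp
    also have "\<dots> = 14448 * (real \<kappa> * (W * \<rho>))" by simp
    also have "\<dots> \<le> 10 ^ 6 * (real \<kappa> * (W * \<rho>))" by (rule mult_right_mono[OF _ k(2)]) simp
    finally show ?thesis by (simp add: bigO_const_def mult_ac)
  qed
  show "real (g_calls \<kappa> NM N m) \<le> bigO_const * (1 + C0) * (W * (\<kappa> + \<rho> * (t * l')))"
  proof -
    define E where "E = (1 + C0) * (W * (\<rho> * (t * l')))"
    have E: "0 \<le> E" unfolding E_def using W \<rho> t l' C0 by (intro mult_nonneg_nonneg) auto
    have "real \<kappa> * real N \<le> real \<kappa> * (12 * W)" using N by (rule mult_left_mono) simp
    also have "\<dots> \<le> 12 * ((1 + C0) * (real \<kappa> * W))"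
      using mult_right_mono[of 1 "1 + C0" "real \<kappa> * W"] k(1) C0 by linarith
    finally have "real \<kappa> * real N \<le> 12 * ((1 + C0) * (real \<kappa> * W))" .
    then have 1: "real \<kappa> * real N \<le> 10 ^ 6 * ((1 + C0) * (real \<kappa> * W))"
    proof -
      have "0 \<le> (1 + C0) * (real \<kappa> * W)" using W C0 by (intro mult_nonneg_nonneg) auto
      then have "12 * ((1 + C0) * (real \<kappa> * W)) \<le> 10 ^ 6 * ((1 + C0) * (real \<kappa> * W))"
        by (intro mult_right_mono) auto
      with \<open>real \<kappa> * real N \<le> 12 * ((1 + C0) * (real \<kappa> * W))\<close> show ?thesis by (rule order_trans)
    qed
    have "real NM \<le> (1 + C0) * (t * (2 * l'))"
      by (rule order_trans[OF NM]) (use l t C0 in \<open>auto intro!: mult_left_mono\<close>)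
    then have "real NM * real m \<le> (1 + C0) * (t * (2 * l')) * (14448 * (W * \<rho>))"
      using m' t l' C0 by (intro mult_mono) auto
    also have "\<dots> = 28896 * E" by (simp add: E_def)
    finally have 2: "real NM * real m \<le> 10 ^ 6 * E" using E by simp
    have "real (g_calls \<kappa> NM N m) \<le> 10 ^ 6 * ((1 + C0) * (real \<kappa> * W)) + 10 ^ 6 * E"
      using 1 2 by (simp add: g_calls_def)
    also have "\<dots> = bigO_const * (1 + C0) * (W * (\<kappa> + \<rho> * (t * l')))"
      by (simp add: bigO_const_def E_def algebra_simps)
    finally show ?thesis .
  qed
qed

lemma nat_ceiling_bounds:
  fixes x :: real
  assumes "0 \<le> x"
  shows "x \<le> real (nat \<lceil>x\<rceil>)" "real (nat \<lceil>x\<rceil>) \<le> x + 1"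
proof -
  show "x \<le> real (nat \<lceil>x\<rceil>)" by (rule real_nat_ceiling_ge)
  have "0 \<le> \<lceil>x\<rceil>" using assms by (simp add: le_ceiling_iff)
  then show "real (nat \<lceil>x\<rceil>) \<le> x + 1" using of_int_ceiling_le_add_one[of x] by simp
qed

lemma ln_le_twice_ln:
  fixes a b :: real
  assumes "0 < a" "a \<le> b"
  shows "ln (a * b) \<le> 2 * ln b"
proof -
  have "ln a \<le> ln b" using assms by (subst ln_le_cancel_iff) auto
  then show ?thesis using assms by (simp add: ln_mult_pos)
qed

theorem theorem3p1:
  fixes f h g :: "real ^ 'n \<Rightarrow> real"
    and M :: "(real ^ 'n, 's) rmethod"
    and \<Xi> :: "'s measure"
    and x0 xs :: "real ^ 'n"
    and \<kappa> :: nat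
    and Lf Lh Lg \<mu> \<tau> C0 C C1 R \<epsilon> \<delta> L :: real
  assumes f_def: "f = (\<lambda>x. h x + g x)"
    and "convex_on UNIV h" "convex_on UNIV g"
    and "cont_differentiable h" "cont_differentiable g"
    and "smooth_fun Lf f" "0 \<le> \<mu>" "strongly_convex \<mu> f"
    and "smooth_fun Lh h" "smooth_fun Lg g" "Lh \<le> Lg"
    and "prob_space \<Xi>" "inner_method \<Xi> g M \<tau> C0 C"
    and "0 < C0" "0 < C" "sqrt (L + Lh) < \<tau>"
    and "log_const * (1 + C * Lg / Lh\<^sup>2) \<le> C1"
    and "is_arg_min f (\<lambda>_. True) xs" "norm (x0 - xs) \<le> R"
    and "0 < \<epsilon>" "0 < \<delta>" "\<delta> < 1" "0 < L" "L \<le> Lh"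
  shows
    "(\<mu> = 0 \<and> \<epsilon> \<le> L * R\<^sup>2 \<longrightarrow>
       (let NM = inner_budget C0 \<tau> L Lh (log_arg0 C1 Lh R \<delta> \<epsilon> L);
            P = PiM (UNIV :: (nat \<times> nat) set) (\<lambda>_. \<Xi>)
        in \<exists>N. \<P>(\<omega> in P. \<exists>xh m. sae h g M L Lh NM x0 N \<omega> = Some (xh, m) \<and>
             f xh - f xs \<le> \<epsilon> \<and>
             real (h_calls N m) \<le> bigO_const * (sqrt (L * R\<^sup>2 / \<epsilon>) * (1 + Lh / L)) \<and>
             real (g_calls \<kappa> NM N m) \<le> bigO_const * (1 + C0) *
               (sqrt (L * R\<^sup>2 / \<epsilon>) *
                 (\<kappa> + Lh / L * (\<tau> / sqrt (L + Lh) * ln (log_arg0 C1 Lh R \<delta> \<epsilon> L)))) \<and>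
             (C1 * Lh / sqrt L \<le> R / (\<delta> * sqrt \<epsilon>) \<longrightarrow>
               real (g_calls \<kappa> NM N m) \<le> bigO_const * (1 + C0) *
                 (sqrt (L * R\<^sup>2 / \<epsilon>) *
                   (\<kappa> + Lh / L * (\<tau> / sqrt (L + Lh) * ln (R / (\<delta> * sqrt \<epsilon>)))))) \<and>
             real (test_calls \<kappa> m) \<le> bigO_const * (sqrt (L * R\<^sup>2 / \<epsilon>) * (\<kappa> * (Lh / L))))
           \<ge> 1 - \<delta>)) \<and>
     (0 < \<mu> \<and> \<mu> \<le> L \<longrightarrow>
       (let NM = inner_budget C0 \<tau> L Lh (log_arg1 C1 Lh \<delta> \<mu> L);
            N0 = restart_length L \<mu>;
            P = PiM (UNIV :: (nat \<times> nat \<times> nat) set) (\<lambda>_. \<Xi>)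
        in \<exists>T. \<P>(\<omega> in P. \<exists>xh m. rsae h g M L Lh NM N0 x0 \<omega> T = Some (xh, m) \<and>
             f xh - f xs \<le> \<epsilon> \<and>
             real (h_calls (T * N0) m) \<le> bigO_const *
               (sqrt (L / \<mu>) * max 1 (ln (\<mu> * R\<^sup>2 / \<epsilon>)) * (1 + Lh / L)) \<and>
             real (g_calls \<kappa> NM (T * N0) m) \<le> bigO_const * (1 + C0) *
               (sqrt (L / \<mu>) * max 1 (ln (\<mu> * R\<^sup>2 / \<epsilon>)) *
                 (\<kappa> + Lh / L * (\<tau> / sqrt (L + Lh)) * ln (log_arg1 C1 Lh \<delta> \<mu> L))) \<and>
             (C1 * Lh / sqrt (\<mu> * L) \<le> 1 / \<delta> \<longrightarrow>
               real (g_calls \<kappa> NM (T * N0) m) \<le> bigO_const * (1 + C0) *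
                 (sqrt (L / \<mu>) * max 1 (ln (\<mu> * R\<^sup>2 / \<epsilon>)) *
                   (\<kappa> + Lh / L * (\<tau> / sqrt (L + Lh)) * ln (1 / \<delta>)))) \<and>
             real (test_calls \<kappa> m) \<le> bigO_const *
               (sqrt (L / \<mu>) * max 1 (ln (\<mu> * R\<^sup>2 / \<epsilon>)) * (\<kappa> * (Lh / L))))
           \<ge> 1 - \<delta>))"
proof -
  have h_cvx: "convex_on UNIV h" and g_cvx: "convex_on UNIV g" and h_sm: "smooth_fun Lh h"
    and g_sm: "smooth_fun Lg g" and LhLg: "Lh \<le> Lg" and sc: "strongly_convex \<mu> f"
    and \<Xi>: "prob_space \<Xi>" and meth: "inner_method \<Xi> g M \<tau> C0 C" and C0: "0 < C0" and C: "0 < C"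
    and \<tau>: "sqrt (L + Lh) < \<tau>" and C1: "log_const * (1 + C * Lg / Lh\<^sup>2) \<le> C1"
    and min: "is_arg_min f (\<lambda>_. True) xs" and R: "norm (x0 - xs) \<le> R" and \<epsilon>: "0 < \<epsilon>"
    and \<delta>: "0 < \<delta>" "\<delta> < 1" and L: "0 < L" and LLh: "L \<le> Lh"
    using assms by blast+
  have Lh: "0 < Lh" and Lg: "0 < Lg" using L LLh LhLg by auto
  have fmin: "f xs \<le> f v" for v using min by (simp add: is_arg_min_linorder)
  have R0: "0 \<le> R" using R norm_ge_zero order_trans by blast
  have R2: "(norm (x0 - xs))\<^sup>2 \<le> R\<^sup>2" using R by (intro power_mono) auto
  define \<rho> where "\<rho> = Lh / L"
  define t where "t = \<tau> / sqrt (L + Lh)"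
  define n where "n = nat \<lceil>300 * \<rho>\<rceil>"
  have \<rho>: "1 \<le> \<rho>" using L LLh by (simp add: \<rho>_def)
  have n: "300 * \<rho> \<le> real n" "real (2 * n) \<le> 602 * \<rho>"
  proof -
    have "300 * \<rho> \<le> real n" "real n \<le> 300 * \<rho> + 1"
      unfolding n_def using \<rho> by (intro nat_ceiling_bounds; simp)+
    then show "300 * \<rho> \<le> real n" "real (2 * n) \<le> 602 * \<rho>" using \<rho> by auto
  qed
  have t: "1 \<le> t" using \<tau> L Lh by (simp add: t_def)
  define q where "q = C * Lg / Lh\<^sup>2"
  have q: "0 < q" using C Lg Lh by (simp add: q_def)
  have C1q: "10 ^ 9 * (1 + q) \<le> C1" using C1 unfolding log_const_def q_def .
  have C1p: "10 ^ 9 \<le> C1" by (rule order_trans[OF _ C1q]) (use q in simp)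
  \<comment> \<open>Both arguments of the logarithm contain the factor \<open>\<rho> / \<delta>\<close>. It compensates for the length of a
    block and for the required probability, while \<open>C1\<close> compensates for \<open>C * Lg / Lh^2\<close>.\<close>
  have setting: "randomized_splitting h g L Lh Lg \<Xi> M \<tau> C0 C X (inner_budget C0 \<tau> L Lh X) n \<delta>"
    if X: "C1 * \<rho> / \<delta> \<le> X" for X
  proof -
    interpret splitting h g L Lh Lg
      by (intro splitting.intro h_cvx g_cvx h_sm g_sm L LLh LhLg)
    have "0 < C1 * \<rho> / \<delta>" using C1p \<rho> \<delta> by (intro divide_pos_pos mult_pos_pos) auto
    then have Xp: "0 < X" using X by linarith
    interpret prob_space \<Xi> by fact
    show ?thesis
    proof (intro randomized_splitting.intro randomized_splitting_axioms.intro)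
      show "C0 * \<tau> / sqrt (L + Lh) * ln X \<le> real (inner_budget C0 \<tau> L Lh X)"
        unfolding inner_budget_def by (rule real_nat_ceiling_ge)
      show "300 * Lh / L \<le> real n" using n(1) by (simp add: \<rho>_def)
      show "real (2 * n) * 1201 * (6 * Lg / Lh\<^sup>2 * (C / X)) \<le> \<delta> / 4"
      proof -
        have "q * (\<rho> * 10 ^ 9) \<le> \<rho> * C1" using C1q \<rho> by (simp add: mult.commute mult_left_mono)
        also have "\<rho> * C1 \<le> \<delta> * X" using X \<delta> by (simp add: field_simps)
        finally have "602 * (q * \<rho>) \<le> 602 * (\<delta> * X / 10 ^ 9)" by (simp add: mult_ac)
        moreover have "real (2 * n) * q \<le> 602 * \<rho> * q" using n(2) q by (intro mult_right_mono) auto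
        ultimately have "real (2 * n) * q \<le> 602 * (\<delta> * X / 10 ^ 9)" by (simp only: mult_ac)
        then have "real (2 * n) * q / X \<le> 602 * (\<delta> / 10 ^ 9)" using Xp by (simp add: field_simps)
        moreover have "real (2 * n) * 1201 * (6 * Lg / Lh\<^sup>2 * (C / X)) = 7206 * (real (2 * n) * q / X)"
          by (simp add: q_def)
        ultimately show ?thesis using \<delta> by simp
      qed
    qed (fact splitting_axioms \<Xi> meth C \<tau> Xp \<delta>)+
  qed
  have budget_bound: "0 \<le> ln X" "real (inner_budget C0 \<tau> L Lh X) \<le> (1 + C0) * (t * ln X)"
    if X: "C1 * \<rho> / \<delta> \<le> X" for X
  proof -
    have "3 \<le> C1 * \<rho>" using C1p \<rho> mult_mono[of 3 C1 1 \<rho>] by simp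
    also have "\<dots> \<le> C1 * \<rho> / \<delta>" using \<delta> C1p \<rho> by (simp add: field_simps mult_left_le)
    finally have "exp 1 \<le> X" using X exp_le by linarith
    moreover from this have "0 < X" using exp_gt_zero[of "1::real"] by linarith
    ultimately have l: "1 \<le> ln X" by (simp add: ln_ge_iff)
    then show "0 \<le> ln X" by simp
    have tl: "1 \<le> t * ln X" using t l mult_mono[of 1 t 1 "ln X"] by simp
    have e: "C0 * \<tau> / sqrt (L + Lh) * ln X = C0 * (t * ln X)" by (simp add: t_def)
    have "0 \<le> C0 * (t * ln X)" using C0 t l by (intro mult_nonneg_nonneg) auto
    then have "real (inner_budget C0 \<tau> L Lh X) \<le> C0 * (t * ln X) + 1"
      unfolding inner_budget_def e by (rule nat_ceiling_bounds(2))
    then show "real (inner_budget C0 \<tau> L Lh X) \<le> (1 + C0) * (t * ln X)"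
      using tl by (simp add: algebra_simps)
  qed
  have meas: "Measurable.pred borel (\<lambda>xh. f xh - f xs \<le> \<epsilon>)"
  proof -
    have [measurable]: "f \<in> borel_measurable borel"
      using smooth_fun_continuous[OF smooth_fun_add(1)[OF h_sm g_sm]] unfolding f_def
      by (rule borel_measurable_continuous_onI)
    show ?thesis by measurable
  qed
  show ?thesis
  proof (intro conjI impI)
    assume "\<mu> = 0 \<and> \<epsilon> \<le> L * R\<^sup>2"
    then have eR: "\<epsilon> \<le> L * R\<^sup>2" by simp
    define S where "S = sqrt (L * R\<^sup>2 / \<epsilon>)"
    define X where "X = log_arg0 C1 Lh R \<delta> \<epsilon> L"
    \<comment> \<open>The gap after \<open>N\<close> iterations is at most \<open>2 * L * R^2 / N^2 = 2 * \<epsilon> * S^2 / N^2\<close>.\<close>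
    define N where "N = nat \<lceil>2 * S\<rceil>"
    have S1: "1 \<le> S" unfolding S_def using eR \<epsilon> by simp
    have S2: "S\<^sup>2 = L * R\<^sup>2 / \<epsilon>" unfolding S_def using L \<epsilon> by simp
    have N: "2 * S \<le> real N" "real N \<le> 3 * S"
    proof -
      have "2 * S \<le> real N" "real N \<le> 2 * S + 1"
        unfolding N_def using S1 by (intro nat_ceiling_bounds; simp)+
      then show "2 * S \<le> real N" "real N \<le> 3 * S" using S1 by auto
    qed
    have N0: "0 < N" using N S1 by (cases N) auto
    have Xfac: "X = C1 * Lh / sqrt L * (R / (\<delta> * sqrt \<epsilon>))"
      unfolding X_def log_arg0_def by (simp add: real_sqrt_mult)
    have "S = sqrt L * R / sqrt \<epsilon>"
      unfolding S_def using R0 by (simp add: real_sqrt_mult real_sqrt_divide)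
    then have "C1 * \<rho> * S / \<delta> = C1 * Lh * (sqrt L / L) * (R / (\<delta> * sqrt \<epsilon>))"
      by (simp add: \<rho>_def mult_ac)
    also have "sqrt L / L = 1 / sqrt L"
      using L by (simp add: sqrt_divide_self_eq inverse_eq_divide)
    finally have "X = C1 * \<rho> * S / \<delta>" unfolding Xfac by simp
    have X: "C1 * \<rho> / \<delta> \<le> X"
    proof -
      have "C1 * \<rho> * 1 \<le> C1 * \<rho> * S" using S1 C1p \<rho> by (intro mult_left_mono mult_nonneg_nonneg) auto
      then show ?thesis unfolding \<open>X = C1 * \<rho> * S / \<delta>\<close> using \<delta> by (intro divide_right_mono) auto
    qed
    interpret randomized_splitting h g L Lh Lg \<Xi> M \<tau> C0 C X "inner_budget C0 \<tau> L Lh X" n \<delta>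
      by (rule setting[OF X])
    let ?NM = "inner_budget C0 \<tau> L Lh X"
    let ?P = "PiM (UNIV :: (nat \<times> nat) set) (\<lambda>_. \<Xi>)"
    define Q2 where "Q2 m \<longleftrightarrow>
        real (h_calls N m) \<le> bigO_const * (sqrt (L * R\<^sup>2 / \<epsilon>) * (1 + Lh / L)) \<and>
        real (g_calls \<kappa> ?NM N m) \<le> bigO_const * (1 + C0) *
          (sqrt (L * R\<^sup>2 / \<epsilon>) * (\<kappa> + Lh / L * (\<tau> / sqrt (L + Lh) * ln X))) \<and>
        (C1 * Lh / sqrt L \<le> R / (\<delta> * sqrt \<epsilon>) \<longrightarrow>
          real (g_calls \<kappa> ?NM N m) \<le> bigO_const * (1 + C0) *
            (sqrt (L * R\<^sup>2 / \<epsilon>) * (\<kappa> + Lh / L * (\<tau> / sqrt (L + Lh) * ln (R / (\<delta> * sqrt \<epsilon>)))))) \<and>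
        real (test_calls \<kappa> m) \<le> bigO_const * (sqrt (L * R\<^sup>2 / \<epsilon>) * (\<kappa> * (Lh / L)))" for m
    have "1 - \<delta> \<le> measure ?P {\<omega> \<in> space ?P. \<exists>xh m. sae h g M L Lh ?NM x0 N \<omega> = Some (xh, m)
        \<and> f xh - f xs \<le> \<epsilon> \<and> Q2 m}"
    proof (rule sae_high_probability[OF N0 _ meas])
      fix w assume halt: "sae_halts x0 w N" and len: "sae_len x0 w N \<le> 2 * N * (2 * n)"
      have "f (fst (sae_run x0 w N)) - f xs \<le> 2 * L * (norm (x0 - xs))\<^sup>2 / (real N)\<^sup>2"
        unfolding f_def by (rule sae_convergence[OF halt N0])
      also have "\<dots> \<le> 2 * L * R\<^sup>2 / (2 * S)\<^sup>2"
        using R N S1 L by (intro frac_le mult_left_mono power_mono) auto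
      also have "\<dots> \<le> \<epsilon>"
      proof -
        have "0 < L * R\<^sup>2" using eR \<epsilon> by simp
        then have "2 * (L * R\<^sup>2) / (4 * (L * R\<^sup>2 / \<epsilon>)) = \<epsilon> / 2" using \<epsilon> L by auto
        then show ?thesis using \<epsilon> unfolding power_mult_distrib S2 by (simp add: mult.assoc)
      qed
      finally have opt: "f (fst (sae_run x0 w N)) - f xs \<le> \<epsilon>" .
      have "real N \<le> 12 * S" using N S1 by simp
      note cost = oracle_call_bounds[OF this \<rho> n(2) len C0 less_le_trans[OF zero_less_one t] budget_bound(1)[OF X] _ budget_bound(2)[OF X]]
      have short: "ln X \<le> 2 * ln (R / (\<delta> * sqrt \<epsilon>))" if "C1 * Lh / sqrt L \<le> R / (\<delta> * sqrt \<epsilon>)"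
        unfolding Xfac using that C1p Lh L by (intro ln_le_twice_ln) auto
      have "Q2 (sae_len x0 w N)"
        unfolding Q2_def S_def[symmetric] \<rho>_def[symmetric] t_def[symmetric]
        using cost(1)[of "ln X"] cost(2)[of "ln X"] cost(2)[OF short] cost(3)[of "ln X"] budget_bound(1)[OF X]
        by (intro conjI impI) auto
      with opt show "f (fst (sae_run x0 w N)) - f xs \<le> \<epsilon> \<and> Q2 (sae_len x0 w N)" ..
    qed
    then show "let NM = inner_budget C0 \<tau> L Lh (log_arg0 C1 Lh R \<delta> \<epsilon> L);
            P = PiM (UNIV :: (nat \<times> nat) set) (\<lambda>_. \<Xi>)
        in \<exists>N. \<P>(\<omega> in P. \<exists>xh m. sae h g M L Lh NM x0 N \<omega> = Some (xh, m) \<and>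
             f xh - f xs \<le> \<epsilon> \<and>
             real (h_calls N m) \<le> bigO_const * (sqrt (L * R\<^sup>2 / \<epsilon>) * (1 + Lh / L)) \<and>
             real (g_calls \<kappa> NM N m) \<le> bigO_const * (1 + C0) *
               (sqrt (L * R\<^sup>2 / \<epsilon>) *
                 (\<kappa> + Lh / L * (\<tau> / sqrt (L + Lh) * ln (log_arg0 C1 Lh R \<delta> \<epsilon> L)))) \<and>
             (C1 * Lh / sqrt L \<le> R / (\<delta> * sqrt \<epsilon>) \<longrightarrow>
               real (g_calls \<kappa> NM N m) \<le> bigO_const * (1 + C0) *
                 (sqrt (L * R\<^sup>2 / \<epsilon>) *
                   (\<kappa> + Lh / L * (\<tau> / sqrt (L + Lh) * ln (R / (\<delta> * sqrt \<epsilon>)))))) \<and>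
             real (test_calls \<kappa> m) \<le> bigO_const * (sqrt (L * R\<^sup>2 / \<epsilon>) * (\<kappa> * (Lh / L))))
           \<ge> 1 - \<delta>"
      unfolding Let_def Q2_def X_def by - (rule exI[of _ N], assumption)
  next
    assume "0 < \<mu> \<and> \<mu> \<le> L"
    then have \<mu>: "0 < \<mu>" and \<mu>L: "\<mu> \<le> L" by auto
    define S where "S = sqrt (L / \<mu>)"
    define \<Lambda> where "\<Lambda> = max 1 (ln (\<mu> * R\<^sup>2 / \<epsilon>))"
    define X where "X = log_arg1 C1 Lh \<delta> \<mu> L"
    define N0 where "N0 = restart_length L \<mu>"
    \<comment> \<open>The factor \<open>2\<close> turns powers of \<open>2\<close> into powers of \<open>exp 1\<close>, as \<open>ln 2 \<ge> 1 / 2\<close>.\<close>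
    define T where "T = nat \<lceil>2 * \<Lambda>\<rceil>"
    have S1: "1 \<le> S" unfolding S_def using \<mu> \<mu>L by simp
    have \<Lambda>1: "1 \<le> \<Lambda>" unfolding \<Lambda>_def by simp
    have T: "2 * \<Lambda> \<le> real T" "real T \<le> 3 * \<Lambda>"
    proof -
      have "2 * \<Lambda> \<le> real T" "real T \<le> 2 * \<Lambda> + 1"
        unfolding T_def using \<Lambda>1 by (intro nat_ceiling_bounds; simp)+
      then show "2 * \<Lambda> \<le> real T" "real T \<le> 3 * \<Lambda>" using \<Lambda>1 by auto
    qed
    have T0: "0 < T" using T \<Lambda>1 by (cases T) auto
    have s8: "0 \<le> sqrt (8 * L / \<mu>)" using L \<mu> by simp
    have "sqrt (8 * L / \<mu>) = sqrt 8 * S" unfolding S_def real_sqrt_mult[symmetric] by simp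
    also have "\<dots> \<le> 3 * S" using S1 by (intro mult_right_mono real_le_lsqrt) auto
    finally have "real N0 \<le> 3 * S + 1"
      using nat_ceiling_bounds(2)[OF s8] unfolding N0_def restart_length_def by linarith
    then have N0: "real N0 \<le> 4 * S" using S1 by simp
    have "(sqrt (8 * L / \<mu>))\<^sup>2 \<le> (real N0)\<^sup>2"
      using nat_ceiling_bounds(1)[OF s8] s8 unfolding N0_def restart_length_def by (intro power_mono) auto
    then have N0sq: "8 * L / \<mu> \<le> (real N0)\<^sup>2" using L \<mu> by simp
    have "0 < 8 * L / \<mu>" using L \<mu> by simp
    then have N0p: "0 < N0" using N0sq by (cases "N0 = 0") auto
    have TN: "real (T * N0) \<le> 12 * (S * \<Lambda>)"
      using mult_mono[OF T(2) N0] \<Lambda>1 by (simp add: mult_ac)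
    have Xfac: "X = C1 * Lh / sqrt (\<mu> * L) * (1 / \<delta>)"
      unfolding X_def log_arg1_def by simp
    have sq: "sqrt (\<mu> * L) * S = L"
      unfolding S_def real_sqrt_mult[symmetric] using \<mu> L by simp
    have "S / L = 1 / sqrt (\<mu> * L)"
      by (subst frac_eq_eq) (use sq \<mu> L in \<open>auto simp: mult.commute\<close>)
    moreover have "C1 * \<rho> * S / \<delta> = C1 * Lh * (S / L) * (1 / \<delta>)" by (simp add: \<rho>_def mult_ac)
    ultimately have "X = C1 * \<rho> * S / \<delta>" unfolding Xfac by simp
    have X: "C1 * \<rho> / \<delta> \<le> X"
    proof -
      have "C1 * \<rho> * 1 \<le> C1 * \<rho> * S" using S1 C1p \<rho> by (intro mult_left_mono mult_nonneg_nonneg) auto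
      then show ?thesis unfolding \<open>X = C1 * \<rho> * S / \<delta>\<close> using \<delta> by (intro divide_right_mono) auto
    qed
    interpret randomized_splitting h g L Lh Lg \<Xi> M \<tau> C0 C X "inner_budget C0 \<tau> L Lh X" n \<delta>
      by (rule setting[OF X])
    let ?NM = "inner_budget C0 \<tau> L Lh X"
    let ?P = "PiM (UNIV :: (nat \<times> nat \<times> nat) set) (\<lambda>_. \<Xi>)"
    define Q2 where "Q2 m \<longleftrightarrow>
        real (h_calls (T * N0) m) \<le> bigO_const *
          (sqrt (L / \<mu>) * max 1 (ln (\<mu> * R\<^sup>2 / \<epsilon>)) * (1 + Lh / L)) \<and>
        real (g_calls \<kappa> ?NM (T * N0) m) \<le> bigO_const * (1 + C0) *
          (sqrt (L / \<mu>) * max 1 (ln (\<mu> * R\<^sup>2 / \<epsilon>)) *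
            (\<kappa> + Lh / L * (\<tau> / sqrt (L + Lh)) * ln X)) \<and>
        (C1 * Lh / sqrt (\<mu> * L) \<le> 1 / \<delta> \<longrightarrow>
          real (g_calls \<kappa> ?NM (T * N0) m) \<le> bigO_const * (1 + C0) *
            (sqrt (L / \<mu>) * max 1 (ln (\<mu> * R\<^sup>2 / \<epsilon>)) *
              (\<kappa> + Lh / L * (\<tau> / sqrt (L + Lh)) * ln (1 / \<delta>)))) \<and>
        real (test_calls \<kappa> m) \<le> bigO_const *
          (sqrt (L / \<mu>) * max 1 (ln (\<mu> * R\<^sup>2 / \<epsilon>)) * (\<kappa> * (Lh / L)))" for m
    have "1 - \<delta> \<le> measure ?P {\<omega> \<in> space ?P. \<exists>xh m. rsae h g M L Lh ?NM N0 x0 \<omega> T = Some (xh, m)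
        \<and> f xh - f xs \<le> \<epsilon> \<and> Q2 m}"
    proof (rule rsae_high_probability[OF N0p T0 _ meas])
      fix w assume halt: "rsae_halts N0 x0 w T" and len: "rsae_len N0 x0 w T \<le> 2 * (T * N0) * (2 * n)"
      have pow: "\<mu> * R\<^sup>2 / \<epsilon> \<le> 2 ^ T"
      proof (cases "R = 0")
        case False
        have ln2: "1 / 2 \<le> ln (2::real)" using ln2_ge_two_thirds by simp
        have "\<mu> * R\<^sup>2 / \<epsilon> = exp (ln (\<mu> * R\<^sup>2 / \<epsilon>))" using False \<mu> \<epsilon> by simp
        also have "\<dots> \<le> exp \<Lambda>" by (simp add: \<Lambda>_def)
        also have "\<dots> \<le> exp (real T * ln 2)"
          using T(1) mult_left_mono[OF ln2, of "real T"] by simp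
        also have "\<dots> = 2 ^ T" by (simp add: exp_of_nat_mult)
        finally show ?thesis .
      qed simp
      have "f (rsae_run N0 x0 w T) - f xs \<le> \<mu> / 2 * (norm (x0 - xs))\<^sup>2 / 2 ^ T"
        unfolding f_def
        by (rule rsae_convergence[OF halt fmin[unfolded f_def] sc[unfolded f_def] \<mu> N0sq T0])
      also have "\<dots> \<le> \<mu> / 2 * R\<^sup>2 / 2 ^ T" using R2 \<mu> by (intro divide_right_mono mult_left_mono) auto
      also have "\<dots> \<le> \<epsilon>"
      proof -
        have "\<mu> * R\<^sup>2 \<le> \<epsilon> * 2 ^ T" using pow \<epsilon> by (simp add: field_simps)
        moreover have "0 \<le> \<mu> * R\<^sup>2" using \<mu> by simp
        ultimately have "\<mu> / 2 * R\<^sup>2 \<le> \<epsilon> * 2 ^ T" by linarith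
        then show ?thesis by (simp add: pos_divide_le_eq)
      qed
      finally have opt: "f (rsae_run N0 x0 w T) - f xs \<le> \<epsilon>" .
      note cost = oracle_call_bounds[OF TN \<rho> n(2) len C0 less_le_trans[OF zero_less_one t] budget_bound(1)[OF X] _ budget_bound(2)[OF X]]
      have short: "ln X \<le> 2 * ln (1 / \<delta>)" if "C1 * Lh / sqrt (\<mu> * L) \<le> 1 / \<delta>"
        unfolding Xfac using that C1p Lh L \<mu> by (intro ln_le_twice_ln) auto
      have "Q2 (rsae_len N0 x0 w T)"
        unfolding Q2_def S_def[symmetric] \<rho>_def[symmetric] t_def[symmetric] \<Lambda>_def[symmetric] mult.assoc[of \<rho> t]
        using cost(1)[of "ln X"] cost(2)[of "ln X"] cost(2)[OF short] cost(3)[of "ln X"] budget_bound(1)[OF X]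
        by (intro conjI impI) auto
      with opt show "f (rsae_run N0 x0 w T) - f xs \<le> \<epsilon> \<and> Q2 (rsae_len N0 x0 w T)" ..
    qed
    then show "let NM = inner_budget C0 \<tau> L Lh (log_arg1 C1 Lh \<delta> \<mu> L);
            N0 = restart_length L \<mu>;
            P = PiM (UNIV :: (nat \<times> nat \<times> nat) set) (\<lambda>_. \<Xi>)
        in \<exists>T. \<P>(\<omega> in P. \<exists>xh m. rsae h g M L Lh NM N0 x0 \<omega> T = Some (xh, m) \<and>
             f xh - f xs \<le> \<epsilon> \<and>
             real (h_calls (T * N0) m) \<le> bigO_const *
               (sqrt (L / \<mu>) * max 1 (ln (\<mu> * R\<^sup>2 / \<epsilon>)) * (1 + Lh / L)) \<and>
             real (g_calls \<kappa> NM (T * N0) m) \<le> bigO_const * (1 + C0) *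
               (sqrt (L / \<mu>) * max 1 (ln (\<mu> * R\<^sup>2 / \<epsilon>)) *
                 (\<kappa> + Lh / L * (\<tau> / sqrt (L + Lh)) * ln (log_arg1 C1 Lh \<delta> \<mu> L))) \<and>
             (C1 * Lh / sqrt (\<mu> * L) \<le> 1 / \<delta> \<longrightarrow>
               real (g_calls \<kappa> NM (T * N0) m) \<le> bigO_const * (1 + C0) *
                 (sqrt (L / \<mu>) * max 1 (ln (\<mu> * R\<^sup>2 / \<epsilon>)) *
                   (\<kappa> + Lh / L * (\<tau> / sqrt (L + Lh)) * ln (1 / \<delta>)))) \<and>
             real (test_calls \<kappa> m) \<le> bigO_const *
               (sqrt (L / \<mu>) * max 1 (ln (\<mu> * R\<^sup>2 / \<epsilon>)) * (\<kappa> * (Lh / L))))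
           \<ge> 1 - \<delta>"
      unfolding Let_def Q2_def X_def N0_def by - (rule exI[of _ T], assumption)
  qed
qed

end
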